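(* There is a universal constant $C>0$ such that the following holds. Let $H\in\mathbb{R}^{d\times d}$ be symmetric positive semidefinite, let $\lambda>0$, $\delta\in(0,1)$, $\varepsilon>0$, and let $m$ be a positive integer with $$m\ge 1.5\,\mathsf{d}_H(\lambda)\qquad\text{and}\qquad m\ge C\,\frac{1+\log(1/\delta)}{\varepsilon^2}.$$ Run Algorithm 2 (described in the context) on input $(H,\lambda,m)$ with a sketching matrix $S\in\mathbb{R}^{m\times d}$ having i.i.d. $\mathcal{N}(0,1/m)$ entries. Then with probability at least $1-\delta$, its output $\hat\lambda$ satisfies $$|\hat\lambda-\tilde\lambda|\le\varepsilon\,\tilde\lambda,\qquad\text{where } \tilde\lambda=\lambda\Big(1-\frac1m\mathsf{d}_H(\lambda)\Big).$$
   Context: For $\mu>0$ the effective dimension of $H$ is $\mathsf{d}_H(\mu)=\mathrm{tr}\big(H(H+\mu I)^{-1}\big)$. For a sketch $S\in\mathbb{R}^{m\times d}$ and $z\le 0$ put $$\hat{\mathsf{s}}(z)=\frac1m\,\mathrm{tr}\big((SHS^\top-zI)^{-1}\big)=\frac1m\sum_{i=1}^m\frac{1}{\lambda_i(SHS^\top)-z},$$ where $\lambda_i(SHS^\top)$ are the eigenvalues of $SHS^\top$ (and $\hat{\mathsf{s}}(0)=+\infty$ if one of them is zero). Algorithm 2 on input $(H,\lambda,m)$: sample a sketch $S\in\mathbb{R}^{m\times d}$, form $SHS^\top$ and compute its eigenvalues. If $\hat{\mathsf{s}}(0)\le 1/\lambda$, report an error and set $\hat\lambda=5\lambda/12$. Otherwise,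 find (for example by binary search) $\hat\lambda$ with $5\lambda/12\le\hat\lambda\le\lambda$ such that $\hat{\mathsf{s}}(-\hat\lambda)=1/\lambda$. Return $\hat\lambda$ together with $\hat W=S^\top(SHS^\top+\hat\lambda I)^{-1}S$.
   Formalization: The search in [5λ/12, λ] can have no solution (λ̃ may be near λ/3), so what is proved is: with probability ≥ 1−δ, every output of Algorithm 2 satisfies the bound, and an output exists whenever 5λ/12 ≤ (1−ε)λ̃. *)

theory Defs
  imports
    "HOL-Probability.Probability"
    "Jordan_Normal_Form.Gauss_Jordan_Elimination"
    "Jordan_Normal_Form.Char_Poly"
begin

definition mat_tr :: "real mat \<Rightarrow> real" where
  "mat_tr A = (\<Sum>i<dim_row A. A $$ (i, i))"

text \<open>Unspecified on singular matrices.\<close>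
definition mat_inv :: "real mat \<Rightarrow> real mat" where
  "mat_inv A = the (mat_inverse A)"

definition sym_psd_mat :: "nat \<Rightarrow> real mat \<Rightarrow> bool" where
  "sym_psd_mat d H \<longleftrightarrow>
     H \<in> carrier_mat d d \<and> transpose_mat H = H \<and>
     (\<forall>v \<in> carrier_vec d. 0 \<le> scalar_prod v (H *\<^sub>v v))"

definition eff_dim :: "real mat \<Rightarrow> real \<Rightarrow> real" where
  "eff_dim H \<mu> = mat_tr (H * mat_inv (H + \<mu> \<cdot>\<^sub>m 1\<^sub>m (dim_row H)))"

definition sketched :: "real mat \<Rightarrow> real mat \<Rightarrow> real mat" where
  "sketched H S = S * H * transpose_mat S"

text \<open>Meant for \<open>z \<le> 0\<close>. For positive semidefinite \<open>H\<close> the resolvent then exists except when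
  \<open>z = 0\<close> and \<open>sketched H S\<close> is singular, where the value is infinite.\<close>
definition s_hat :: "real mat \<Rightarrow> real mat \<Rightarrow> real \<Rightarrow> ereal" where
  "s_hat H S z =
     (if z = 0 \<and> eigenvalue (sketched H S) 0 then \<infinity>
      else ereal (1 / real (dim_row S) *
             mat_tr (mat_inv (sketched H S - z \<cdot>\<^sub>m 1\<^sub>m (dim_row S)))))"

text \<open>\<open>search_output H lam S (l, W)\<close>: on sketch \<open>S\<close>, the algorithm may return the regularisation
  \<open>l\<close> and the matrix \<open>W\<close>. It is a relation because the second branch only asks for some root in
  the search interval. For positive semidefinite \<open>H\<close>, at most one \<open>l\<close> is related to \<open>S\<close> since \<open>s_hat H S (- x)\<close> is strictly
  decreasing in \<open>x\<close>
  for \<open>x > 0\<close>; there is none when \<open>s_hat H S 0 > 1 / lam\<close> but the root of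
  \<open>s_hat H S (- x) = 1 / lam\<close> lies below \<open>5 * lam / 12\<close>.\<close>
definition search_output :: "real mat \<Rightarrow> real \<Rightarrow> real mat \<Rightarrow> real \<times> real mat \<Rightarrow> bool" where
  "search_output H lam S = (\<lambda>(l, W).
     (if s_hat H S 0 \<le> ereal (1 / lam) then l = 5 * lam / 12
      else 5 * lam / 12 \<le> l \<and> l \<le> lam \<and> s_hat H S (- l) = ereal (1 / lam)) \<and>
     W = transpose_mat S * mat_inv (sketched H S + l \<cdot>\<^sub>m 1\<^sub>m (dim_row S)) * S)"

text \<open>The joint law of \<open>m * d\<close> independent centred Gaussians of variance \<open>1 / m\<close>
  (\<^const>\<open>normal_density\<close> takes the standard deviation).\<close>
definition gaussian_entries :: "nat \<Rightarrow> nat \<Rightarrow> (nat \<times> nat \<Rightarrow> real) measure" where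
  "gaussian_entries m d =
     (\<Pi>\<^sub>M ij \<in> {..<m} \<times> {..<d}. density lborel (normal_density 0 (1 / sqrt (real m))))"

definition sketch_of :: "nat \<Rightarrow> nat \<Rightarrow> (nat \<times> nat \<Rightarrow> real) \<Rightarrow> real mat" where
  "sketch_of m d \<omega> = Matrix.mat m d \<omega>"

definition lam_tilde :: "real mat \<Rightarrow> real \<Rightarrow> nat \<Rightarrow> real" where
  "lam_tilde H lam m = lam * (1 - 1 / real m * eff_dim H lam)"

end

(* Let A = S H S^T and let s be the mean of the normalised trace of (A + x)^-1. Rotation
invariance of the Gaussian makes H diagonal, A = sum_j h_j c_j c_j^T with c_j the columns of S.
Leaving out the j-th column turns c_j^T (A + x)^-1 c_j into q_j / (1 + h_j q_j), where q_j is a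
quadratic form in c_j whose matrix is independent of c_j, so that
  1 = x s + (1/m) sum_j E[h_j q_j / (1 + h_j q_j)]   and   E q_j lies in [s, s + 1/(m x)].
Replacing q_j by s gives the deterministic equation 1 = x s + (1/m) sum_j h_j s / (1 + h_j s), which
s = 1/lam solves exactly for x = lam_tilde. In one direction the replacement is Jensen's inequality;
in the other it costs the standard deviations of q_j and of the trace, which are O(1 / (x sqrt m)).
The trace changes by at most 1/x when a row of S changes, since such a change has rank one for the
d x d companion matrix; bounded differences then give dimension-free concentration. Hence with
probability 1 - delta the decreasing function x -> tr (A + x)^-1 / m crosses the level 1/lam between
(1 - eps) lam_tilde and (1 + eps) lam_tilde. *)
theory Submission
  imports Defs "Jordan_Normal_Form.Spectral_Radius"
begin

text \<open>The dimension \<open>d\<close> must not enter the error. Replacing q_j by s costs its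
  deviation times \<open>h_j / (1 + h_j s)\<close>, not times \<open>h_j\<close>; near s = 1/lam
  these weights sum to about \<open>lam * eff_dim H lam\<close>, hence to O(lam m), so the relative
  loss is O(1 / sqrt m). The bound \<open>m >= 1.5 eff_dim H lam\<close> enters as
  \<open>lam_tilde >= lam / 3\<close>, which keeps 1/x comparable to 1/lam at both ends of the
  bracket. Stability of the deterministic equation is made scalar by writing s = rho / lam: each
  summand lies between \<open>min 1 rho\<close> and \<open>max 1 rho\<close> times
  \<open>h_j / (h_j + lam)\<close>. Invariance is proved only for plane rotations. Each touches two
  entries per row, so a two-dimensional change of variables suffices, and \<open>H\<close> is made
  diagonal by a finite chain of them, packaged as an induction rule. The final event quantifies over
  all admissible outputs. Monotonicity and the intermediate value theorem turn it into inequalities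
  at fixed shifts, which makes it measurable.\<close>

section \<open>Resolvents of positive semidefinite matrices\<close>

lemma mat_inv_nonsing:
  assumes A: "A \<in> carrier_mat n n" and d: "det A \<noteq> 0"
  shows "mat_inv A \<in> carrier_mat n n" "A * mat_inv A = 1\<^sub>m n" "mat_inv A * A = 1\<^sub>m n"
proof -
  obtain B where B: "mat_inverse A = Some B"
    using mat_inverse(1)[OF A, where b = "()"] det_non_zero_imp_unit[OF A d, where b = "()"] by (cases "mat_inverse A") auto
  with mat_inverse(2)[OF A B]
  show "mat_inv A \<in> carrier_mat n n" "A * mat_inv A = 1\<^sub>m n" "mat_inv A * A = 1\<^sub>m n"
    by (auto simp: mat_inv_def)
qed

lemma mat_inv_eqI:
  assumes A: "A \<in> carrier_mat n n" and B: "B \<in> carrier_mat n n" and AB: "A * B = 1\<^sub>m n"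
  shows "mat_inv A = B"
proof -
  have "det A * det B = 1" using det_mult[OF A B] AB by simp
  then have d: "det A \<noteq> 0" by auto
  note M = mat_inv_nonsing[OF A d]
  have "mat_inv A = mat_inv A * (A * B)" using AB M by simp
  also have "\<dots> = (mat_inv A * A) * B" using assoc_mult_mat[OF M(1) A B] by simp
  also have "\<dots> = B" using M(3) B by simp
  finally show ?thesis .
qed

text \<open>Cramer's rule presents the entries of the inverse as rational functions of the entries
  of the matrix; measurability of resolvents rests on this.\<close>

lemma mat_inv_adj:
  assumes A: "A \<in> carrier_mat n n" and d: "det A \<noteq> 0"
  shows "mat_inv A = (1 / det A) \<cdot>\<^sub>m adj_mat A"
proof (rule mat_inv_eqI[OF A])
  show "(1 / det A) \<cdot>\<^sub>m adj_mat A \<in> carrier_mat n n" using adj_mat(1)[OF A] by simp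
  have "A * ((1 / det A) \<cdot>\<^sub>m adj_mat A) = (1 / det A) \<cdot>\<^sub>m (A * adj_mat A)"
    by (rule mult_smult_distrib[OF A adj_mat(1)[OF A]])
  also have "\<dots> = 1\<^sub>m n" unfolding adj_mat(2)[OF A] using d by (intro eq_matI) auto
  finally show "A * ((1 / det A) \<cdot>\<^sub>m adj_mat A) = 1\<^sub>m n" .
qed

lemma mat_tr_mult_comm:
  assumes "A \<in> carrier_mat n m" "B \<in> carrier_mat m n"
  shows "mat_tr (A * B) = mat_tr (B * A)"
proof -
  have "mat_tr (A * B) = (\<Sum>i<n. \<Sum>j<m. A $$ (i,j) * B $$ (j,i))"
    using assms by (auto simp: mat_tr_def scalar_prod_def atLeast0LessThan intro!: sum.cong)
  also have "\<dots> = (\<Sum>j<m. \<Sum>i<n. A $$ (i,j) * B $$ (j,i))" by (rule sum.swap)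
  also have "\<dots> = mat_tr (B * A)"
    using assms by (auto simp: mat_tr_def scalar_prod_def atLeast0LessThan mult.commute intro!: sum.cong)
  finally show ?thesis .
qed

lemma shift_mult_vec:
  assumes "A \<in> carrier_mat n n" "v \<in> carrier_vec n"
  shows "(A + (x::real) \<cdot>\<^sub>m 1\<^sub>m n) *\<^sub>v v = A *\<^sub>v v + x \<cdot>\<^sub>v v"
  using assms by (subst add_mult_distrib_mat_vec[of _ n n]) (auto intro!: eq_vecI)

lemma sym_scalar_prod:
  assumes "A \<in> carrier_mat n n" "transpose_mat A = A" "u \<in> carrier_vec n" "v \<in> carrier_vec n"
  shows "(A *\<^sub>v u) \<bullet> v = u \<bullet> (A *\<^sub>v (v :: real vec))"
  using transpose_vec_mult_scalar[of A n n v u] assms by simp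

definition psd_reg :: "nat \<Rightarrow> real mat \<Rightarrow> real \<Rightarrow> bool" where
  "psd_reg n A x \<longleftrightarrow> sym_psd_mat n A \<and> 0 \<le> x \<and> det (A + x \<cdot>\<^sub>m 1\<^sub>m n) \<noteq> 0"

definition resolvent :: "nat \<Rightarrow> real mat \<Rightarrow> real \<Rightarrow> real mat" where
  "resolvent n A x = mat_inv (A + x \<cdot>\<^sub>m 1\<^sub>m n)"

lemma sym_psd_matD:
  assumes "sym_psd_mat n A"
  shows "A \<in> carrier_mat n n" "transpose_mat A = A"
   "v \<in> carrier_vec n \<Longrightarrow> 0 \<le> v \<bullet> (A *\<^sub>v v)"
  using assms by (auto simp: sym_psd_mat_def)

lemma scalar_prod_self_pos:
  assumes "v \<in> carrier_vec n" "v \<noteq> 0\<^sub>v n"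
  shows "0 < v \<bullet> (v::real vec)"
proof -
  obtain i where i: "i < n" "v $ i \<noteq> 0" using assms by (auto simp: vec_eq_iff)
  have "0 < v $ i * v $ i" using i(2) by (simp add: zero_less_mult_iff) linarith
  also have "\<dots> \<le> (\<Sum>j\<in>{0..<n}. v $ j * v $ j)" by (rule member_le_sum) (use i in auto)
  finally show ?thesis using assms by (simp add: scalar_prod_def)
qed

lemma scalar_prod_self_nonneg: "0 \<le> v \<bullet> (v::real vec)"
  by (simp add: scalar_prod_def sum_nonneg)

lemma mat_mult_unit_vec:
  "A \<in> carrier_mat m n \<Longrightarrow> j < n \<Longrightarrow> A *\<^sub>v unit_vec n j = (col A j :: 'a :: semiring_1 vec)"
  by (intro eq_vecI) (auto)

lemma psd_reg_pos:
  assumes A: "sym_psd_mat n A" and x: "0 < x"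
  shows "psd_reg n A x"
proof -
  note AD = sym_psd_matD[OF A]
  have "det (A + x \<cdot>\<^sub>m 1\<^sub>m n) \<noteq> 0"
  proof
    assume "det (A + x \<cdot>\<^sub>m 1\<^sub>m n) = 0"
    then obtain v where v: "v \<in> carrier_vec n" "v \<noteq> 0\<^sub>v n" "(A + x \<cdot>\<^sub>m 1\<^sub>m n) *\<^sub>v v = 0\<^sub>v n"
      using det_0_iff_vec_prod_zero[of "A + x \<cdot>\<^sub>m 1\<^sub>m n" n] AD by auto
    have "A *\<^sub>v v + x \<cdot>\<^sub>v v = 0\<^sub>v n" using v shift_mult_vec[OF AD(1) v(1)] by simp
    then have "v \<bullet> (A *\<^sub>v v + x \<cdot>\<^sub>v v) = 0" using v by simp
    then have "v \<bullet> (A *\<^sub>v v) + x * (v \<bullet> v) = 0"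
      using v AD(1) by (simp add: scalar_prod_add_distrib[of _ n])
    moreover have "0 < x * (v \<bullet> v)" using x scalar_prod_self_pos[OF v(1,2)] by simp
    ultimately show False using AD(3)[OF v(1)] by linarith
  qed
  with A x show ?thesis by (simp add: psd_reg_def)
qed

section \<open>Symmetry and quadratic-form bounds of a single resolvent\<close>

context
  fixes n A x
  assumes reg: "psd_reg n A x"
begin

lemma reg_A: "A \<in> carrier_mat n n" "transpose_mat A = A"
   "v \<in> carrier_vec n \<Longrightarrow> 0 \<le> v \<bullet> (A *\<^sub>v v)" and reg_x: "0 \<le> x"
  using reg sym_psd_matD[of n A] by (auto simp: psd_reg_def)

lemma resolvent_inv:
  "resolvent n A x \<in> carrier_mat n n"
  "(A + x \<cdot>\<^sub>m 1\<^sub>m n) * resolvent n A x = 1\<^sub>m n"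
  "resolvent n A x * (A + x \<cdot>\<^sub>m 1\<^sub>m n) = 1\<^sub>m n"
  using mat_inv_nonsing[of "A + x \<cdot>\<^sub>m 1\<^sub>m n" n] reg_A reg by (auto simp: resolvent_def psd_reg_def)

lemma resolvent_vec:
  assumes v: "v \<in> carrier_vec n"
  shows "resolvent n A x *\<^sub>v v \<in> carrier_vec n"
    "A *\<^sub>v (resolvent n A x *\<^sub>v v) + x \<cdot>\<^sub>v (resolvent n A x *\<^sub>v v) = v"
proof -
  show c: "resolvent n A x *\<^sub>v v \<in> carrier_vec n" using resolvent_inv v by auto
  show "A *\<^sub>v (resolvent n A x *\<^sub>v v) + x \<cdot>\<^sub>v (resolvent n A x *\<^sub>v v) = v"
    unfolding shift_mult_vec[OF reg_A(1) c, symmetric]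
    using assoc_mult_mat_vec[of "A + x \<cdot>\<^sub>m 1\<^sub>m n" n n "resolvent n A x" n v] resolvent_inv reg_A v by simp
qed

lemma resolvent_vec_eqI:
  assumes v: "w \<in> carrier_vec n" and "A *\<^sub>v w + x \<cdot>\<^sub>v w = v"
  shows "w = resolvent n A x *\<^sub>v v"
proof -
  have "v = (A + x \<cdot>\<^sub>m 1\<^sub>m n) *\<^sub>v w" using shift_mult_vec[OF reg_A(1) v] assms by simp
  then show ?thesis
    using assoc_mult_mat_vec[of "resolvent n A x" n n "A + x \<cdot>\<^sub>m 1\<^sub>m n" n w] resolvent_inv reg_A v by simp
qed

lemma resolvent_sym:
  assumes u: "u \<in> carrier_vec n" and v: "v \<in> carrier_vec n"
  shows "u \<bullet> (resolvent n A x *\<^sub>v v) = v \<bullet> (resolvent n A x *\<^sub>v u)"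
proof -
  define a where "a = resolvent n A x *\<^sub>v u"
  define b where "b = resolvent n A x *\<^sub>v v"
  have a: "a \<in> carrier_vec n" "A *\<^sub>v a + x \<cdot>\<^sub>v a = u" using resolvent_vec[OF u] by (auto simp: a_def)
  have b: "b \<in> carrier_vec n" "A *\<^sub>v b + x \<cdot>\<^sub>v b = v" using resolvent_vec[OF v] by (auto simp: b_def)
  have Aa: "A *\<^sub>v a \<in> carrier_vec n" "A *\<^sub>v b \<in> carrier_vec n" using reg_A a b by auto
  have "u \<bullet> b = (A *\<^sub>v a) \<bullet> b + x * (a \<bullet> b)"
    using add_scalar_prod_distrib[of "A *\<^sub>v a" n "x \<cdot>\<^sub>v a" b] a b Aa by simp
  moreover have "v \<bullet> a = (A *\<^sub>v b) \<bullet> a + x * (b \<bullet> a)"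
    using add_scalar_prod_distrib[of "A *\<^sub>v b" n "x \<cdot>\<^sub>v b" a] a b Aa by simp
  moreover have "(A *\<^sub>v b) \<bullet> a = (A *\<^sub>v a) \<bullet> b"
    using sym_scalar_prod[OF reg_A(1,2) a(1) b(1)] comm_scalar_prod[of a n "A *\<^sub>v b"] a Aa by simp
  moreover have "b \<bullet> a = a \<bullet> b" using comm_scalar_prod a b by blast
  ultimately show ?thesis by (simp add: a_def b_def)
qed

text \<open>With \<open>a\<close> the resolvent applied to \<open>v\<close>, so that
  \<open>v = (A + x) a\<close>, the product of \<open>v\<close> and \<open>a\<close> splits into the
  form of \<open>A\<close> at \<open>a\<close> plus \<open>x\<close> times the squared norm of
  \<open>a\<close>, and both parts are nonnegative.\<close>

lemma resolvent_quad:
  assumes v: "v \<in> carrier_vec n"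
  shows "x * ((resolvent n A x *\<^sub>v v) \<bullet> (resolvent n A x *\<^sub>v v)) \<le> v \<bullet> (resolvent n A x *\<^sub>v v)"
    and "0 \<le> v \<bullet> (resolvent n A x *\<^sub>v v)"
proof -
  define a where "a = resolvent n A x *\<^sub>v v"
  have a: "a \<in> carrier_vec n" "A *\<^sub>v a + x \<cdot>\<^sub>v a = v" using resolvent_vec[OF v] by (auto simp: a_def)
  have Aa: "A *\<^sub>v a \<in> carrier_vec n" using reg_A a by auto
  have "v \<bullet> a = (A *\<^sub>v a) \<bullet> a + x * (a \<bullet> a)"
    using add_scalar_prod_distrib[of "A *\<^sub>v a" n "x \<cdot>\<^sub>v a" a] a Aa by simp
  moreover have "0 \<le> (A *\<^sub>v a) \<bullet> a"
    using reg_A(3)[OF a(1)] sym_scalar_prod[OF reg_A(1,2) a(1) a(1)] by simp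
  ultimately show "x * ((resolvent n A x *\<^sub>v v) \<bullet> (resolvent n A x *\<^sub>v v)) \<le> v \<bullet> (resolvent n A x *\<^sub>v v)"
    unfolding a_def[symmetric] by simp
  moreover have "0 \<le> x * (a \<bullet> a)" using reg_x scalar_prod_self_nonneg by simp
  ultimately show "0 \<le> v \<bullet> (resolvent n A x *\<^sub>v v)" unfolding a_def[symmetric] by linarith
qed

lemma resolvent_entry:
  assumes "i < n" "j < n"
  shows "resolvent n A x $$ (i,j) = (resolvent n A x *\<^sub>v unit_vec n j) $ i"
    "resolvent n A x $$ (i,j) = unit_vec n i \<bullet> (resolvent n A x *\<^sub>v unit_vec n j)"
  using assms resolvent_inv(1) by (auto simp: mat_mult_unit_vec[OF resolvent_inv(1)] scalar_prod_left_unit[of _ n])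

lemma resolvent_entry_sym:
  assumes "i < n" "j < n"
  shows "resolvent n A x $$ (i,j) = resolvent n A x $$ (j,i)"
  using assms resolvent_sym by (simp add: resolvent_entry(2))

lemma resolvent_diag_nonneg: "i < n \<Longrightarrow> 0 \<le> resolvent n A x $$ (i,i)"
  by (simp add: resolvent_entry(2) resolvent_quad(2))

lemma resolvent_tr: "mat_tr (resolvent n A x) = (\<Sum>i<n. resolvent n A x $$ (i,i))"
  using resolvent_inv(1) by (simp add: mat_tr_def)

lemma resolvent_tr_nonneg: "0 \<le> mat_tr (resolvent n A x)"
  unfolding resolvent_tr by (intro sum_nonneg resolvent_diag_nonneg) auto

text \<open>By symmetry row \<open>i\<close> is the image of the unit vector \<open>i\<close>, so
  this is \<open>resolvent_quad\<close> there. It controls the Frobenius norm that governs the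
  variance of the quadratic forms.\<close>

lemma resolvent_row_sq:
  assumes i: "i < n"
  shows "x * (\<Sum>j<n. (resolvent n A x $$ (i,j))\<^sup>2) \<le> resolvent n A x $$ (i,i)"
proof -
  let ?w = "resolvent n A x *\<^sub>v unit_vec n i"
  have "?w \<bullet> ?w = (\<Sum>j<n. (resolvent n A x $$ (i,j))\<^sup>2)"
    using resolvent_inv(1) i resolvent_vec(1)[of "unit_vec n i"]
    by (auto simp: scalar_prod_def power2_eq_square atLeast0LessThan mat_mult_unit_vec[OF resolvent_inv(1)]
        resolvent_entry_sym[of i] intro!: sum.cong)
  with resolvent_quad(1)[of "unit_vec n i"] show ?thesis
    using i resolvent_entry(2)[OF i i] by simp
qed

end

text \<open>Sherman-Morrison. The update is given by its action on vectors, so that the lemma serves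
  both column removal in the m x m Gram matrix and row replacement in the d x d one. The trace drops
  by \<open>h * (a \<bullet> a) / (1 + h * q)\<close>, and
  \<open>x * (a \<bullet> a) \<le> q\<close> bounds x times the drop by 1 whatever the size of
  \<open>c\<close>.\<close>

lemma resolvent_tr_rank_one:
  assumes A: "psd_reg n A x" and A': "psd_reg n A' x" and c: "c \<in> carrier_vec n" and h: "0 \<le> h"
    and upd: "\<And>v. v \<in> carrier_vec n \<Longrightarrow> A' *\<^sub>v v = A *\<^sub>v v + (h * (c \<bullet> v)) \<cdot>\<^sub>v c"
  defines "q \<equiv> c \<bullet> (resolvent n A x *\<^sub>v c)"
  shows "c \<bullet> (resolvent n A' x *\<^sub>v c) = q / (1 + h * q)"
    and "x * (mat_tr (resolvent n A x) - mat_tr (resolvent n A' x)) \<le> 1"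
    and "mat_tr (resolvent n A' x) \<le> mat_tr (resolvent n A x)"
proof -
  let ?R = "resolvent n A x" and ?R' = "resolvent n A' x"
  have q0: "0 \<le> q" unfolding q_def by (rule resolvent_quad(2)[OF A c])
  then have pos: "0 < 1 + h * q" using h by (simp add: add_pos_nonneg)
  define a where "a = ?R *\<^sub>v c"
  have a: "a \<in> carrier_vec n" "A *\<^sub>v a + x \<cdot>\<^sub>v a = c"
    using resolvent_vec[OF A c] by (auto simp: a_def)
  have qa: "c \<bullet> a = q" by (simp add: a_def q_def)
  \<comment> \<open>The right-hand side is verified to solve the updated system; uniqueness of the
    solution then identifies it.\<close>
  have key: "?R' *\<^sub>v v = ?R *\<^sub>v v - (h * (c \<bullet> (?R *\<^sub>v v)) / (1 + h * q)) \<cdot>\<^sub>v a" if v: "v \<in> carrier_vec n" for v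
  proof -
    define b where "b = ?R *\<^sub>v v"
    define beta where "beta = h * (c \<bullet> b) / (1 + h * q)"
    have b: "b \<in> carrier_vec n" "A *\<^sub>v b + x \<cdot>\<^sub>v b = v"
      using resolvent_vec[OF A v] by (auto simp: b_def)
    have w: "b - beta \<cdot>\<^sub>v a \<in> carrier_vec n" using a b by auto
    have Aab: "A *\<^sub>v a \<in> carrier_vec n" "A *\<^sub>v b \<in> carrier_vec n" using reg_A[OF A] a b by auto
    have 1: "A *\<^sub>v (b - beta \<cdot>\<^sub>v a) = A *\<^sub>v b - beta \<cdot>\<^sub>v (A *\<^sub>v a)"
      using reg_A(1)[OF A] a b by (simp add: mult_minus_distrib_mat_vec mult_mat_vec)
    have 2: "c \<bullet> (b - beta \<cdot>\<^sub>v a) = c \<bullet> b - beta * q"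
      using a b c qa by (simp add: scalar_prod_minus_distrib[of _ n])
    have 3: "h * (c \<bullet> b - beta * q) = beta"
      using pos by (simp add: beta_def field_simps)
    have "A' *\<^sub>v (b - beta \<cdot>\<^sub>v a) + x \<cdot>\<^sub>v (b - beta \<cdot>\<^sub>v a) = v"
    proof (rule eq_vecI)
      show "dim_vec (A' *\<^sub>v (b - beta \<cdot>\<^sub>v a) + x \<cdot>\<^sub>v (b - beta \<cdot>\<^sub>v a)) = dim_vec v"
        using a b v by simp
      fix i assume "i < dim_vec v"
      then have i: "i < n" using v by simp
      have "(A *\<^sub>v a + x \<cdot>\<^sub>v a) $ i = c $ i" "(A *\<^sub>v b + x \<cdot>\<^sub>v b) $ i = v $ i" using a b by auto
      then have ci: "c $ i = (A *\<^sub>v a) $ i + x * a $ i" "v $ i = (A *\<^sub>v b) $ i + x * b $ i"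
        using i a b Aab by auto
      then show "(A' *\<^sub>v (b - beta \<cdot>\<^sub>v a) + x \<cdot>\<^sub>v (b - beta \<cdot>\<^sub>v a)) $ i = v $ i"
        unfolding upd[OF w] 1 2 3 using i a(1) b(1) reg_A(1)[OF A] c by (simp add: ci algebra_simps)
    qed
    from resolvent_vec_eqI[OF A' w this] show ?thesis by (simp add: b_def beta_def)
  qed
  have "c \<bullet> (?R' *\<^sub>v c) = q - (h * q / (1 + h * q)) * q"
    using scalar_prod_minus_distrib[of c n a "(h * q / (1 + h * q)) \<cdot>\<^sub>v a"] a c qa key[OF c, folded a_def, unfolded qa]
    by simp
  also have "\<dots> = q / (1 + h * q)" using pos by (simp add: field_simps)
  finally show "c \<bullet> (?R' *\<^sub>v c) = q / (1 + h * q)" .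
  have diag: "?R' $$ (i,i) = ?R $$ (i,i) - h * (a $ i)\<^sup>2 / (1 + h * q)" if i: "i < n" for i
  proof -
    have "c \<bullet> (?R *\<^sub>v unit_vec n i) = a $ i"
      using resolvent_sym[OF A c, of "unit_vec n i"] a i by (simp add: a_def)
    then have "?R' $$ (i,i) = (?R *\<^sub>v unit_vec n i - (h * a $ i / (1 + h * q)) \<cdot>\<^sub>v a) $ i"
      using resolvent_entry(1)[OF A' i i] key[of "unit_vec n i"] i by simp
    then show ?thesis
      using i a resolvent_entry(1)[OF A i i] by (simp add: power2_eq_square)
  qed
  have aa: "(\<Sum>i<n. (a $ i)\<^sup>2) = a \<bullet> a" using a by (simp add: scalar_prod_def power2_eq_square atLeast0LessThan)
  have tr: "mat_tr ?R - mat_tr ?R' = h * (a \<bullet> a) / (1 + h * q)"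
    unfolding resolvent_tr[OF A] resolvent_tr[OF A'] aa[symmetric]
    by (simp add: diag sum_subtractf sum_distrib_left sum_divide_distrib)
  have xa: "x * (a \<bullet> a) \<le> q" using resolvent_quad(1)[OF A c] by (simp add: a_def q_def)
  then have "h * (x * (a \<bullet> a)) \<le> h * q" using h mult_left_mono by blast
  then have "x * (h * (a \<bullet> a)) \<le> 1 + h * q" by (simp add: algebra_simps)
  then show "x * (mat_tr ?R - mat_tr ?R') \<le> 1" unfolding tr using pos by (simp add: field_simps)
  have "0 \<le> h * (a \<bullet> a) / (1 + h * q)"
    using h pos scalar_prod_self_nonneg[of a] by (intro divide_nonneg_pos mult_nonneg_nonneg) auto
  then show "mat_tr ?R' \<le> mat_tr ?R" using tr by linarith
qed

text \<open>Resolvent identity: the difference at shifts \<open>x\<close> and \<open>y\<close> is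
  \<open>y - x\<close> times the product of the two resolvents. Strict decrease makes the root
  unique; the upper bound gives continuity of the trace in the shift.\<close>

lemma resolvent_diag_less:
  assumes X: "psd_reg n A x" and Y: "psd_reg n A y" and xy: "x < y" and i: "i < n"
  shows "resolvent n A y $$ (i,i) < resolvent n A x $$ (i,i)"
    and "0 < x \<Longrightarrow> resolvent n A x $$ (i,i) - resolvent n A y $$ (i,i) \<le> (y - x) / (x * y)"
proof -
  let ?R = "resolvent n A x" and ?Q = "resolvent n A y"
  define e where "e = (unit_vec n i :: real vec)"
  have e: "e \<in> carrier_vec n" by (simp add: e_def)
  define w where "w = ?Q *\<^sub>v e"
  define u where "u = ?R *\<^sub>v e"
  define z where "z = ?R *\<^sub>v w"
  have w: "w \<in> carrier_vec n" "A *\<^sub>v w + y \<cdot>\<^sub>v w = e" using resolvent_vec[OF Y e] by (auto simp: w_def)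
  have u: "u \<in> carrier_vec n" "A *\<^sub>v u + x \<cdot>\<^sub>v u = e" using resolvent_vec[OF X e] by (auto simp: u_def)
  have z: "z \<in> carrier_vec n" "A *\<^sub>v z + x \<cdot>\<^sub>v z = w" using resolvent_vec[OF X w(1)] by (auto simp: z_def)
  have A: "A \<in> carrier_mat n n" by (rule reg_A(1)[OF X])
  have uz: "w + (y - x) \<cdot>\<^sub>v z = u"
    unfolding u_def
  proof (rule resolvent_vec_eqI[OF X])
    show "w + (y - x) \<cdot>\<^sub>v z \<in> carrier_vec n" using w z by simp
    have 1: "A *\<^sub>v (w + (y - x) \<cdot>\<^sub>v z) = A *\<^sub>v w + (y - x) \<cdot>\<^sub>v (A *\<^sub>v z)"
      using A w z by (simp add: mult_add_distrib_mat_vec mult_mat_vec)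
    show "A *\<^sub>v (w + (y - x) \<cdot>\<^sub>v z) + x \<cdot>\<^sub>v (w + (y - x) \<cdot>\<^sub>v z) = e"
    proof (rule eq_vecI)
      show "dim_vec (A *\<^sub>v (w + (y - x) \<cdot>\<^sub>v z) + x \<cdot>\<^sub>v (w + (y - x) \<cdot>\<^sub>v z)) = dim_vec e"
        using A w z e by simp
      fix j assume "j < dim_vec e"
      then have j: "j < n" using e by simp
      have Aw: "A *\<^sub>v w \<in> carrier_vec n" "A *\<^sub>v z \<in> carrier_vec n" using A w z by auto
      have "(A *\<^sub>v w + y \<cdot>\<^sub>v w) $ j = e $ j" "(A *\<^sub>v z + x \<cdot>\<^sub>v z) $ j = w $ j" using w z by auto
      then have 2: "(A *\<^sub>v w) $ j + y * w $ j = e $ j" "(A *\<^sub>v z) $ j = w $ j - x * z $ j"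
        using j w z Aw by auto
      show "(A *\<^sub>v (w + (y - x) \<cdot>\<^sub>v z) + x \<cdot>\<^sub>v (w + (y - x) \<cdot>\<^sub>v z)) $ j = e $ j"
      proof -
        have "(A *\<^sub>v (w + (y - x) \<cdot>\<^sub>v z) + x \<cdot>\<^sub>v (w + (y - x) \<cdot>\<^sub>v z)) $ j
          = ((A *\<^sub>v w) $ j + (y - x) * (A *\<^sub>v z) $ j) + x * (w $ j + (y - x) * z $ j)"
          unfolding 1 using j w(1) z(1) A by simp
        also have "\<dots> = e $ j" unfolding 2(1)[symmetric] 2(2) by (simp add: algebra_simps)
        finally show ?thesis .
      qed
    qed
  qed
  have diff: "?R $$ (i,i) - ?Q $$ (i,i) = (y - x) * (u \<bullet> w)"
  proof -
    have "e \<bullet> z = w \<bullet> u" using resolvent_sym[OF X e w(1)] by (simp add: z_def u_def)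
    moreover have "e \<bullet> u = e \<bullet> w + (y - x) * (e \<bullet> z)"
      unfolding uz[symmetric] using e w z by (simp add: scalar_prod_add_distrib[of _ n])
    moreover have "e \<bullet> u = ?R $$ (i,i)" "e \<bullet> w = ?Q $$ (i,i)"
      using resolvent_entry(2)[OF X i i] resolvent_entry(2)[OF Y i i] by (auto simp: e_def u_def w_def)
    ultimately show ?thesis using comm_scalar_prod[OF u(1) w(1)] by simp
  qed
  have uw: "u \<bullet> w = w \<bullet> w + (y - x) * (w \<bullet> z)"
  proof -
    have "u \<bullet> w = w \<bullet> w + (y - x) * (z \<bullet> w)"
      unfolding uz[symmetric] using w z by (simp add: add_scalar_prod_distrib[of _ n])
    then show ?thesis using comm_scalar_prod[OF z(1) w(1)] by simp
  qed
  have "w \<noteq> 0\<^sub>v n"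
  proof
    assume "w = 0\<^sub>v n"
    then have "e = 0\<^sub>v n" using w A by auto
    then have "e $ i = 0" using i by simp
    then show False using i by (simp add: e_def)
  qed
  then have ww: "0 < w \<bullet> w" using scalar_prod_self_pos[OF w(1)] by simp
  have wz: "0 \<le> w \<bullet> z" using resolvent_quad(2)[OF X w(1), folded z_def] .
  have "0 \<le> (y - x) * (w \<bullet> z)" using wz xy by simp
  then have "0 < u \<bullet> w" unfolding uw using ww by linarith
  moreover have "u \<bullet> w \<le> 1 / (x * y)" if x: "0 < x"
  proof -
    have y: "0 < y" using x xy by simp
    have zz: "x * (z \<bullet> z) \<le> w \<bullet> z" using resolvent_quad(1)[OF X w(1)] by (simp add: z_def)
    \<comment> \<open>Expanding this square and using \<open>zz\<close> gives
      \<open>x * (w \<bullet> z) \<le> w \<bullet> w\<close>, which expresses that \<open>x\<close>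
      times the resolvent is at most the identity.\<close>
    have "0 \<le> (w - x \<cdot>\<^sub>v z) \<bullet> (w - x \<cdot>\<^sub>v z)" by (rule scalar_prod_self_nonneg)
    also have "\<dots> = w \<bullet> w - 2 * x * (w \<bullet> z) + x * (x * (z \<bullet> z))"
      using w z comm_scalar_prod[OF z(1) w(1)]
      by (simp add: minus_scalar_prod_distrib[of _ n] scalar_prod_minus_distrib[of _ n] algebra_simps)
    also have "\<dots> \<le> w \<bullet> w - 2 * x * (w \<bullet> z) + x * (w \<bullet> z)"
      using zz x by (intro add_left_mono mult_left_mono) auto
    finally have "x * (w \<bullet> z) \<le> w \<bullet> w" by simp
    then have "w \<bullet> z \<le> (w \<bullet> w) / x" using x by (simp add: field_simps)
    then have "u \<bullet> w \<le> w \<bullet> w + (y - x) * ((w \<bullet> w) / x)" unfolding uw using xy by (intro add_left_mono mult_left_mono) auto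
    also have "\<dots> = y * (w \<bullet> w) / x" using x by (simp add: field_simps)
    finally have 1: "u \<bullet> w \<le> y * (w \<bullet> w) / x" .
    have Qii: "e \<bullet> w = ?Q $$ (i,i)" "?Q $$ (i,i) = w $ i"
      using resolvent_entry[OF Y i i] by (auto simp: e_def w_def)
    have yw: "y * (w \<bullet> w) \<le> w $ i" using resolvent_quad(1)[OF Y e] Qii by (simp add: w_def)
    have "w $ i * w $ i \<le> (\<Sum>j\<in>{0..<n}. w $ j * w $ j)" by (rule member_le_sum) (use i in auto)
    then have "w $ i * w $ i \<le> w \<bullet> w" using w by (simp add: scalar_prod_def)
    then have "y * (w $ i * w $ i) \<le> w $ i" using yw y by (meson mult_left_mono order.trans less_imp_le)
    moreover have "0 < w $ i" using yw ww y by (smt (verit) mult_pos_pos)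
    ultimately have "w $ i \<le> 1 / y" using y by (simp add: field_simps)
    then have "y * (w \<bullet> w) / x \<le> (1 / y) / x" using yw x by (intro divide_right_mono) auto
    with 1 show ?thesis by (simp add: mult.commute)
  qed
  moreover have "(y - x) * (u \<bullet> w) \<le> (y - x) * (1 / (x * y))" if "u \<bullet> w \<le> 1 / (x * y)"
    using that xy by (intro mult_left_mono) auto
  moreover have "0 < (y - x) * (u \<bullet> w)" if "0 < u \<bullet> w" using that xy by simp
  ultimately have "?Q $$ (i,i) < ?R $$ (i,i) \<and> (0 < x \<longrightarrow> ?R $$ (i,i) - ?Q $$ (i,i) \<le> (y - x) / (x * y))"
    unfolding diff[symmetric] by simp
  then show "?Q $$ (i,i) < ?R $$ (i,i)" "0 < x \<Longrightarrow> ?R $$ (i,i) - ?Q $$ (i,i) \<le> (y - x) / (x * y)"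
    by auto
qed

lemma resolvent_tr_less:
  assumes n: "0 < n" and X: "psd_reg n A x" and Y: "psd_reg n A y" and xy: "x < y"
  shows "mat_tr (resolvent n A y) < mat_tr (resolvent n A x)"
  unfolding resolvent_tr[OF X] resolvent_tr[OF Y]
  by (rule sum_strict_mono) (use n resolvent_diag_less(1)[OF X Y xy] in auto)

lemma resolvent_tr_diff_le:
  assumes X: "psd_reg n A x" and Y: "psd_reg n A y" and x: "0 < x" and xy: "x < y"
  shows "mat_tr (resolvent n A x) - mat_tr (resolvent n A y) \<le> real n * ((y - x) / (x * y))"
  unfolding resolvent_tr[OF X] resolvent_tr[OF Y] sum_subtractf[symmetric]
  using sum_bounded_above[of "{..<n}", OF resolvent_diag_less(2)[OF X Y xy _ x]] by simp

section \<open>Gram matrices and trace identities\<close>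

lemma sym_psd_mat_gram:
  assumes B: "B \<in> carrier_mat m d"
  shows "sym_psd_mat m (B * transpose_mat B)"
proof -
  have "0 \<le> v \<bullet> (B * transpose_mat B *\<^sub>v v)" if v: "v \<in> carrier_vec m" for v
  proof -
    have "(transpose_mat B *\<^sub>v v) \<bullet> (transpose_mat B *\<^sub>v v) = v \<bullet> (B *\<^sub>v (transpose_mat B *\<^sub>v v))"
      using transpose_vec_mult_scalar[of B m d "transpose_mat B *\<^sub>v v" v] B v by simp
    then show ?thesis
      using B v scalar_prod_self_nonneg[of "transpose_mat B *\<^sub>v v"]
      by (simp add: assoc_mult_mat_vec[of _ m d])
  qed
  then show ?thesis using B by (simp add: sym_psd_mat_def transpose_mult)
qed

lemma mat_tr_add: "A \<in> carrier_mat n n \<Longrightarrow> B \<in> carrier_mat n n \<Longrightarrow> mat_tr (A + B) = mat_tr A + mat_tr B"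
  by (simp add: mat_tr_def sum.distrib)

lemma mat_tr_smult: "A \<in> carrier_mat n n \<Longrightarrow> mat_tr (c \<cdot>\<^sub>m A) = c * mat_tr A"
  by (simp add: mat_tr_def sum_distrib_left)

lemma mat_tr_one: "mat_tr (1\<^sub>m n) = real n"
  by (simp add: mat_tr_def)

lemma resolvent_tr_identity:
  assumes A: "psd_reg n A x"
  shows "mat_tr (A * resolvent n A x) + x * mat_tr (resolvent n A x) = real n"
proof -
  note R = resolvent_inv[OF A] and A1 = reg_A(1)[OF A]
  have "(A + x \<cdot>\<^sub>m 1\<^sub>m n) * resolvent n A x = A * resolvent n A x + x \<cdot>\<^sub>m resolvent n A x"
    using R(1) A1 by (subst add_mult_distrib_mat[of _ n n]) (auto simp: mult_smult_assoc_mat[of _ n n])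
  then have "mat_tr (A * resolvent n A x + x \<cdot>\<^sub>m resolvent n A x) = real n"
    using R mat_tr_one[of n] by simp
  then show ?thesis
    using R A1 mat_tr_add[of "A * resolvent n A x" n "x \<cdot>\<^sub>m resolvent n A x"] mat_tr_smult[OF R(1)] by simp
qed

text \<open>Push-through: \<open>(B B\<^sup>T + x)\<^sup>-\<^sup>1 B = B (B\<^sup>T B + x)\<^sup>-\<^sup>1\<close>.\<close>

lemma resolvent_tr_push_through:
  assumes B: "B \<in> carrier_mat m d" and x: "0 < x"
  shows "x * mat_tr (resolvent m (B * transpose_mat B) x) - real m
       = x * mat_tr (resolvent d (transpose_mat B * B) x) - real d"
proof -
  let ?T = "transpose_mat B"
  have T: "?T \<in> carrier_mat d m" using B by simp
  have P: "psd_reg m (B * ?T) x" by (rule psd_reg_pos[OF sym_psd_mat_gram[OF B] x])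
  have Q: "psd_reg d (?T * B) x" using psd_reg_pos[OF sym_psd_mat_gram[OF T] x] by simp
  let ?R = "resolvent m (B * ?T) x" and ?Q = "resolvent d (?T * B) x"
  note R = resolvent_inv[OF P] and Q' = resolvent_inv[OF Q]
  have shift: "(B * ?T + x \<cdot>\<^sub>m 1\<^sub>m m) * B = B * (?T * B + x \<cdot>\<^sub>m 1\<^sub>m d)"
  proof -
    have "(B * ?T + x \<cdot>\<^sub>m 1\<^sub>m m) * B = B * ?T * B + x \<cdot>\<^sub>m B"
      using B T by (subst add_mult_distrib_mat[of _ m m]) (auto simp: mult_smult_assoc_mat[of _ m m])
    also have "\<dots> = B * (?T * B) + B * (x \<cdot>\<^sub>m 1\<^sub>m d)"
      using B T assoc_mult_mat[OF B T B] by (auto simp: mult_smult_distrib[of _ m d])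
    also have "\<dots> = B * (?T * B + x \<cdot>\<^sub>m 1\<^sub>m d)"
      using B T by (subst mult_add_distrib_mat[of B m d]) auto
    finally show ?thesis .
  qed
  define M where "M = B * ?T + x \<cdot>\<^sub>m 1\<^sub>m m"
  define N where "N = ?T * B + x \<cdot>\<^sub>m 1\<^sub>m d"
  have MN: "M \<in> carrier_mat m m" "N \<in> carrier_mat d d" using B by (auto simp: M_def N_def)
  note shift' = shift[folded M_def N_def] and RM = R(3)[folded M_def] and NQ = Q'(2)[folded N_def]
  have "?R * B = ?R * (B * (N * ?Q))" unfolding NQ using B by simp
  also have "B * (N * ?Q) = (B * N) * ?Q" using assoc_mult_mat[OF B MN(2) Q'(1)] by simp
  also have "\<dots> = M * (B * ?Q)" unfolding shift'[symmetric] by (rule assoc_mult_mat[OF MN(1) B Q'(1)])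
  also have "?R * (M * (B * ?Q)) = (?R * M) * (B * ?Q)"
    by (rule assoc_mult_mat[OF R(1) MN(1) mult_carrier_mat[OF B Q'(1)], symmetric])
  also have "\<dots> = B * ?Q" unfolding RM by (rule left_mult_one_mat[OF mult_carrier_mat[OF B Q'(1)]])
  finally have push: "?R * B = B * ?Q" .
  have 1: "mat_tr (B * ?T * ?R) = mat_tr (?R * (B * ?T))"
    by (rule mat_tr_mult_comm[OF mult_carrier_mat[OF B T] R(1)])
  have 2: "?R * (B * ?T) = (B * ?Q) * ?T"
    unfolding push[symmetric] by (rule assoc_mult_mat[OF R(1) B T, symmetric])
  have 3: "mat_tr ((B * ?Q) * ?T) = mat_tr (?T * (B * ?Q))"
    by (rule mat_tr_mult_comm[OF mult_carrier_mat[OF B Q'(1)] T])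
  have 4: "?T * (B * ?Q) = ?T * B * ?Q" by (rule assoc_mult_mat[OF T B Q'(1), symmetric])
  have "mat_tr (B * ?T * ?R) = mat_tr (?T * B * ?Q)" using 1 3 unfolding 2 4 by (rule trans)
  then show ?thesis using resolvent_tr_identity[OF P] resolvent_tr_identity[OF Q] by linarith
qed

section \<open>Diagonalisation by plane rotations\<close>

lemma mat_eqI_mult_vec:
  assumes A: "(A :: real mat) \<in> carrier_mat n m" and B: "B \<in> carrier_mat n m"
    and eq: "\<And>v. v \<in> carrier_vec m \<Longrightarrow> A *\<^sub>v v = B *\<^sub>v v"
  shows "A = B"
proof (rule eq_matI)
  fix i j assume "i < dim_row B" "j < dim_col B"
  then have ij: "i < n" "j < m" using B by auto
  have "col A j = col B j"
    using eq[of "unit_vec m j"] mat_mult_unit_vec[OF A ij(2)] mat_mult_unit_vec[OF B ij(2)] by simp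
  then have "col A j $ i = col B j $ i" by simp
  then show "A $$ (i,j) = B $$ (i,j)" using A B ij by simp
qed (use A B in auto)

text \<open>Applied to a row of the sketch, such a matrix rotates one pair of independent Gaussians
  and leaves the other entries alone.\<close>

definition givens :: "nat \<Rightarrow> nat \<Rightarrow> nat \<Rightarrow> real \<Rightarrow> real \<Rightarrow> real mat" where
  "givens n p q c s = Matrix.mat n n (\<lambda>(i,j).
     if i = p then c * of_bool (j = p) - s * of_bool (j = q)
     else if i = q then s * of_bool (j = p) + c * of_bool (j = q)
     else of_bool (i = j))"

lemma givens_carrier [simp]: "givens n p q c s \<in> carrier_mat n n"
  by (simp add: givens_def)

lemma givens_transpose:
  assumes "p \<noteq> q"
  shows "transpose_mat (givens n p q c s) = givens n p q c (- s)"
  using assms by (intro eq_matI) (auto simp: givens_def)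

lemma givens_mult_vec:
  assumes pq: "p < n" "q < n" "p \<noteq> q" and v: "v \<in> carrier_vec n" and i: "i < n"
  shows "(givens n p q c s *\<^sub>v v) $ i =
    (if i = p then c * v $ p - s * v $ q else if i = q then s * v $ p + c * v $ q else v $ i)"
proof -
  have row: "Matrix.row (givens n p q c s) i =
    (if i = p then c \<cdot>\<^sub>v unit_vec n p - s \<cdot>\<^sub>v unit_vec n q
     else if i = q then s \<cdot>\<^sub>v unit_vec n p + c \<cdot>\<^sub>v unit_vec n q else unit_vec n i)"
    using pq i by (auto simp: givens_def unit_vec_def intro!: eq_vecI)
  have "(givens n p q c s *\<^sub>v v) $ i = Matrix.row (givens n p q c s) i \<bullet> v"
    using i by (simp add: givens_def)
  also have "\<dots> = (if i = p then c * v $ p - s * v $ q else if i = q then s * v $ p + c * v $ q else v $ i)"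
    unfolding row using pq v i
    by (auto simp: minus_scalar_prod_distrib[of _ n] add_scalar_prod_distrib[of _ n])
  finally show ?thesis .
qed

lemma givens_orthogonal:
  assumes pq: "p < n" "q < n" "p \<noteq> q" and cs: "c\<^sup>2 + s\<^sup>2 = 1"
  shows "transpose_mat (givens n p q c s) * givens n p q c s = 1\<^sub>m n"
    and "givens n p q c s * transpose_mat (givens n p q c s) = 1\<^sub>m n"
proof -
  have *: "givens n p q c (- s) * givens n p q c s = 1\<^sub>m n" if cs: "c\<^sup>2 + s\<^sup>2 = 1" for s
  proof (rule mat_eqI_mult_vec)
    fix v :: "real vec" assume v: "v \<in> carrier_vec n"
    have Gv: "givens n p q c s *\<^sub>v v \<in> carrier_vec n" using v by (rule mult_mat_vec_carrier[OF givens_carrier])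
    have "c * (c * v $ p - s * v $ q) + s * (s * v $ p + c * v $ q) = (c\<^sup>2 + s\<^sup>2) * v $ p"
         "- s * (c * v $ p - s * v $ q) + c * (s * v $ p + c * v $ q) = (c\<^sup>2 + s\<^sup>2) * v $ q"
      by (simp_all add: algebra_simps power2_eq_square)
    note e = this[unfolded cs]
    show "givens n p q c (- s) * givens n p q c s *\<^sub>v v = 1\<^sub>m n *\<^sub>v v"
    proof (rule eq_vecI)
      fix i assume "i < dim_vec (1\<^sub>m n *\<^sub>v v)"
      then have i: "i < n" using v by simp
      have "(givens n p q c (- s) * givens n p q c s *\<^sub>v v) $ i = (givens n p q c (- s) *\<^sub>v (givens n p q c s *\<^sub>v v)) $ i"
        using v by (simp only: assoc_mult_mat_vec[OF givens_carrier givens_carrier])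
      also have "\<dots> = v $ i"
        using e pq i by (simp add: givens_mult_vec[OF pq Gv i] givens_mult_vec[OF pq v] del: index_mult_mat_vec)
      finally show "(givens n p q c (- s) * givens n p q c s *\<^sub>v v) $ i = (1\<^sub>m n *\<^sub>v v) $ i" using v by simp
    qed (use v in \<open>simp add: givens_def\<close>)
  qed (auto intro!: mult_carrier_mat[of _ n n])
  show "transpose_mat (givens n p q c s) * givens n p q c s = 1\<^sub>m n"
    unfolding givens_transpose[OF pq(3)] using *[OF cs] .
  show "givens n p q c s * transpose_mat (givens n p q c s) = 1\<^sub>m n"
    unfolding givens_transpose[OF pq(3)] using *[of "- s"] cs by simp
qed

text \<open>A complex eigenvector \<open>u = a + i b\<close> always exists. Computing the product of
  \<open>M a\<close> and \<open>b\<close> in two ways by symmetry gives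
  \<open>Im z * (a \<bullet> a + b \<bullet> b) = 0\<close>; hence \<open>z\<close> is real, and
  whichever of \<open>a\<close> and \<open>b\<close> is nonzero is a real eigenvector.\<close>

lemma symmetric_mat_real_eigenvector:
  assumes M: "(M :: real mat) \<in> carrier_mat n n" and sym: "transpose_mat M = M" and n: "0 < n"
  obtains h w where "w \<in> carrier_vec n" "w \<noteq> 0\<^sub>v n" "M *\<^sub>v w = h \<cdot>\<^sub>v w"
proof -
  let ?C = "map_mat complex_of_real M"
  have C: "?C \<in> carrier_mat n n" using M by simp
  obtain z where "eigenvalue ?C z" using spectrum_non_empty[OF C n] by (auto simp: spectrum_def)
  then obtain u where u: "u \<in> carrier_vec n" "u \<noteq> 0\<^sub>v n" "?C *\<^sub>v u = z \<cdot>\<^sub>v u"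
    using C by (auto simp: eigenvalue_def eigenvector_def)
  define a where "a = map_vec Re u"
  define b where "b = map_vec Im u"
  have ab: "a \<in> carrier_vec n" "b \<in> carrier_vec n" using u by (auto simp: a_def b_def)
  have comp: "(\<Sum>j\<in>{0..<n}. complex_of_real (M $$ (i,j)) * u $ j) = z * u $ i" if "i < n" for i
  proof -
    have "(?C *\<^sub>v u) $ i = (z \<cdot>\<^sub>v u) $ i" using u by simp
    then show ?thesis using that M u(1) by (simp add: scalar_prod_def)
  qed
  have Ma: "M *\<^sub>v a = Re z \<cdot>\<^sub>v a - Im z \<cdot>\<^sub>v b"
  proof (rule eq_vecI)
    fix i assume "i < dim_vec (Re z \<cdot>\<^sub>v a - Im z \<cdot>\<^sub>v b)"
    then have i: "i < n" using ab by simp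
    have "(M *\<^sub>v a) $ i = (\<Sum>j\<in>{0..<n}. M $$ (i,j) * Re (u $ j))"
      using i M u(1) by (simp add: scalar_prod_def a_def)
    also have "\<dots> = Re (\<Sum>j\<in>{0..<n}. complex_of_real (M $$ (i,j)) * u $ j)" by simp
    finally show "(M *\<^sub>v a) $ i = (Re z \<cdot>\<^sub>v a - Im z \<cdot>\<^sub>v b) $ i"
      unfolding comp[OF i] using i u(1) by (simp add: a_def b_def)
  qed (use M ab in simp)
  have Mb: "M *\<^sub>v b = Im z \<cdot>\<^sub>v a + Re z \<cdot>\<^sub>v b"
  proof (rule eq_vecI)
    fix i assume "i < dim_vec (Im z \<cdot>\<^sub>v a + Re z \<cdot>\<^sub>v b)"
    then have i: "i < n" using ab by simp
    have "(M *\<^sub>v b) $ i = (\<Sum>j\<in>{0..<n}. M $$ (i,j) * Im (u $ j))"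
      using i M u(1) by (simp add: scalar_prod_def b_def)
    also have "\<dots> = Im (\<Sum>j\<in>{0..<n}. complex_of_real (M $$ (i,j)) * u $ j)" by simp
    finally show "(M *\<^sub>v b) $ i = (Im z \<cdot>\<^sub>v a + Re z \<cdot>\<^sub>v b) $ i"
      unfolding comp[OF i] using i u(1) by (simp add: a_def b_def)
  qed (use M ab in simp)
  have "(M *\<^sub>v a) \<bullet> b = a \<bullet> (M *\<^sub>v b)" by (rule sym_scalar_prod[OF M sym ab])
  moreover have "(M *\<^sub>v a) \<bullet> b = Re z * (a \<bullet> b) - Im z * (b \<bullet> b)"
    unfolding Ma using ab by (simp add: minus_scalar_prod_distrib[of _ n])
  moreover have "a \<bullet> (M *\<^sub>v b) = Im z * (a \<bullet> a) + Re z * (a \<bullet> b)"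
    unfolding Mb using ab by (simp add: scalar_prod_add_distrib[of _ n])
  ultimately have "Im z * (a \<bullet> a + b \<bullet> b) = 0" by (simp add: algebra_simps)
  moreover have nz: "a \<noteq> 0\<^sub>v n \<or> b \<noteq> 0\<^sub>v n"
  proof (rule ccontr)
    assume "\<not> ?thesis"
    then have 0: "a = 0\<^sub>v n" "b = 0\<^sub>v n" by auto
    have "u = 0\<^sub>v n"
    proof (rule eq_vecI)
      fix i assume "i < dim_vec (0\<^sub>v n :: complex vec)"
      then have i: "i < n" by simp
      have "a $ i = 0" "b $ i = 0" using 0 i by auto
      then show "u $ i = 0\<^sub>v n $ i" using i u(1) by (simp add: a_def b_def complex_eq_iff)
    qed (use u in simp)
    with u(2) show False by simp
  qed
  have "0 < a \<bullet> a + b \<bullet> b"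
    using nz scalar_prod_self_pos[OF ab(1)] scalar_prod_self_pos[OF ab(2)]
      scalar_prod_self_nonneg[of a] scalar_prod_self_nonneg[of b] by (auto intro: add_pos_nonneg add_nonneg_pos)
  ultimately have Im0: "Im z = 0" by simp
  have "M *\<^sub>v a = Re z \<cdot>\<^sub>v a" "M *\<^sub>v b = Re z \<cdot>\<^sub>v b"
    unfolding Ma Mb Im0 using ab by (auto intro!: eq_vecI)
  with nz ab that show ?thesis by blast
qed

text \<open>By symmetry the first \<open>k\<close> rows are diagonal along with the first
  \<open>k\<close> columns, so an eigenvector of the trailing block, padded with \<open>k\<close>
  zeros, is an eigenvector of the whole matrix.\<close>

lemma symmetric_mat_block_eigenvector:
  assumes H: "(H :: real mat) \<in> carrier_mat n n" and sym: "transpose_mat H = H" and k: "k < n"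
    and diag: "\<And>i j. i < k \<Longrightarrow> j < n \<Longrightarrow> i \<noteq> j \<Longrightarrow> H $$ (j,i) = 0"
  obtains h and v :: "real vec" where "v \<in> carrier_vec n" "v \<noteq> 0\<^sub>v n" "\<And>i. i < k \<Longrightarrow> v $ i = 0" "H *\<^sub>v v = h \<cdot>\<^sub>v v"
proof -
  define M where "M = Matrix.mat (n - k) (n - k) (\<lambda>(i,j). H $$ (i + k, j + k))"
  have Hs: "H $$ (i,j) = H $$ (j,i)" if "i < n" "j < n" for i j
    using arg_cong[OF sym, of "\<lambda>A. A $$ (i,j)"] H that by simp
  have M: "M \<in> carrier_mat (n - k) (n - k)" by (simp add: M_def)
  have symM: "transpose_mat M = M" by (rule eq_matI) (auto simp: M_def Hs)
  obtain h w where w: "w \<in> carrier_vec (n - k)" "w \<noteq> 0\<^sub>v (n - k)" "M *\<^sub>v w = h \<cdot>\<^sub>v w"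
    by (rule symmetric_mat_real_eigenvector[OF M symM]) (use k in auto)
  define v where "v = vec n (\<lambda>i. if i < k then 0 else w $ (i - k))"
  have v: "v \<in> carrier_vec n" by (simp add: v_def)
  have Hv: "(\<Sum>j\<in>{0..<n}. H $$ (i,j) * v $ j) = (\<Sum>j\<in>{0..<n-k}. H $$ (i,j+k) * w $ j)" if i: "i < n" for i
  proof -
    have "(\<Sum>j\<in>{0..<n}. H $$ (i,j) * v $ j) = (\<Sum>j\<in>{k..<n}. H $$ (i,j) * v $ j)"
      by (rule sum.mono_neutral_right) (auto simp: v_def)
    also have "\<dots> = (\<Sum>j\<in>{0+k..<(n-k)+k}. H $$ (i,j) * v $ j)" using k by simp
    also have "\<dots> = (\<Sum>j\<in>{0..<n-k}. H $$ (i,j+k) * v $ (j+k))" by (rule sum.shift_bounds_nat_ivl)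
    also have "\<dots> = (\<Sum>j\<in>{0..<n-k}. H $$ (i,j+k) * w $ j)" by (rule sum.cong) (auto simp: v_def)
    finally show ?thesis .
  qed
  have "H *\<^sub>v v = h \<cdot>\<^sub>v v"
  proof (rule eq_vecI)
    fix i assume "i < dim_vec (h \<cdot>\<^sub>v v)"
    then have i: "i < n" using v by simp
    have 1: "(H *\<^sub>v v) $ i = (\<Sum>j\<in>{0..<n-k}. H $$ (i,j+k) * w $ j)"
      using Hv[OF i] i H v by (simp add: scalar_prod_def)
    show "(H *\<^sub>v v) $ i = (h \<cdot>\<^sub>v v) $ i"
    proof (cases "i < k")
      case True
      have "(\<Sum>j\<in>{0..<n-k}. H $$ (i,j+k) * w $ j) = 0"
      proof (rule sum.neutral, safe)
        fix j assume "j \<in> {0..<n-k}"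
        then have "H $$ (j+k, i) = 0" "j + k < n" using diag[of i "j+k"] True k by auto
        then show "H $$ (i,j+k) * w $ j = 0" using Hs[OF i, of "j+k"] by simp
      qed
      then show ?thesis using 1 True i by (simp add: v_def)
    next
      case False
      then have ik: "i - k < n - k" "i - k + k = i" using i by auto
      have "(M *\<^sub>v w) $ (i - k) = (h \<cdot>\<^sub>v w) $ (i - k)" using w by simp
      then have "(\<Sum>j\<in>{0..<n-k}. H $$ (i,j+k) * w $ j) = h * w $ (i - k)"
        using ik w(1) by (simp add: M_def scalar_prod_def)
      then show ?thesis using 1 False i by (simp add: v_def)
    qed
  qed (use H v in simp)
  moreover have "v \<noteq> 0\<^sub>v n"
  proof
    assume v0: "v = 0\<^sub>v n"
    have "w = 0\<^sub>v (n - k)"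
    proof (rule eq_vecI)
      fix i assume "i < dim_vec (0\<^sub>v (n - k) :: real vec)"
      then have i: "i < n - k" by simp
      then have "v $ (i + k) = 0" using v0 by simp
      then show "w $ i = 0\<^sub>v (n - k) $ i" using i by (simp add: v_def)
    qed (use w in simp)
    with w(2) show False by simp
  qed
  moreover have "\<And>i. i < k \<Longrightarrow> v $ i = 0" using k by (simp add: v_def)
  ultimately show ?thesis using that v by blast
qed

text \<open>Each column is cleared by rotating an eigenvector of the trailing block onto a coordinate axis.\<close>

lemma symmetric_mat_givens_induct [consumes 2, case_names diagonal rotate]:
  assumes H: "(H :: real mat) \<in> carrier_mat n n" and sym: "transpose_mat H = H"
    and diagonal: "\<And>H. H \<in> carrier_mat n n \<Longrightarrow> (\<And>i j. i < n \<Longrightarrow> j < n \<Longrightarrow> i \<noteq> j \<Longrightarrow> H $$ (i,j) = 0) \<Longrightarrow> P H"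
    and rotate: "\<And>H p q c s. H \<in> carrier_mat n n \<Longrightarrow> transpose_mat H = H \<Longrightarrow> p < n \<Longrightarrow> q < n \<Longrightarrow> p \<noteq> q
      \<Longrightarrow> c\<^sup>2 + s\<^sup>2 = 1 \<Longrightarrow> P (transpose_mat (givens n p q c s) * H * givens n p q c s) \<Longrightarrow> P H"
  shows "P H"
proof -
  have A: "P H" if "k \<le> n" "H \<in> carrier_mat n n" "transpose_mat H = H"
    "\<And>i j. i < k \<Longrightarrow> j < n \<Longrightarrow> i \<noteq> j \<Longrightarrow> H $$ (j,i) = 0" for k H
    using that
  proof (induction "n - k" arbitrary: k H)
    case 0
    then show ?case by (intro diagonal) auto
  next
    case (Suc l)
    then have k: "k < n" by simp
    \<comment> \<open>Inner induction on the number of nonzero entries of the eigenvector beyond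
      position \<open>k\<close>; each rotation removes one.\<close>
    have B: "P H" if "card {q. k < q \<and> q < n \<and> v $ q \<noteq> 0} = N" "H \<in> carrier_mat n n" "transpose_mat H = H"
      "\<And>i j. i < k \<Longrightarrow> j < n \<Longrightarrow> i \<noteq> j \<Longrightarrow> H $$ (j,i) = 0" "v \<in> carrier_vec n" "v \<noteq> 0\<^sub>v n"
      "\<And>i. i < k \<Longrightarrow> v $ i = 0" "H *\<^sub>v v = h \<cdot>\<^sub>v v" for N H v h
      using that
    proof (induction N arbitrary: H v)
      case 0
      have vq: "v $ q = 0" if "q < n" "q \<noteq> k" for q
        using that "0.prems"(1) "0.prems"(7)[of q] by (cases "q < k") auto
      have vk: "v $ k \<noteq> 0"
      proof
        assume "v $ k = 0"
        then have "v $ q = 0" if "q < n" for q using vq[OF that] by (cases "q = k") auto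
        then have "v = 0\<^sub>v n" using "0.prems"(5) by (intro eq_vecI) auto
        with "0.prems"(6) show False by simp
      qed
      \<comment> \<open>The eigenvector is now a multiple of a unit vector, so column
        \<open>k\<close> of \<open>H\<close> has only its diagonal entry left and the outer
        induction can advance.\<close>
      have veq: "v = v $ k \<cdot>\<^sub>v unit_vec n k" using vq "0.prems"(5) k by (intro eq_vecI) auto
      have col0: "H $$ (j,k) = 0" if "j < n" "j \<noteq> k" for j
      proof -
        have "(H *\<^sub>v v) $ j = h * v $ j" using "0.prems"(5,8) that by simp
        then have "(H *\<^sub>v v) $ j = 0" using vq that by simp
        moreover have "H *\<^sub>v v = v $ k \<cdot>\<^sub>v col H k"
          using mult_mat_vec[OF "0.prems"(2), of "unit_vec n k" "v $ k"] mat_mult_unit_vec[OF "0.prems"(2) k] veq by simp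
        ultimately have "v $ k * H $$ (j,k) = 0" using "0.prems"(2) that k by simp
        then show ?thesis using vk by simp
      qed
      show ?case
      proof (rule Suc.hyps(1)[of "Suc k"])
        show "l = n - Suc k" "Suc k \<le> n" using Suc.hyps(2) k by auto
        show "H \<in> carrier_mat n n" "transpose_mat H = H" by fact+
        show "H $$ (j,i) = 0" if "i < Suc k" "j < n" "i \<noteq> j" for i j
          using that col0 "0.prems"(4) by (cases "i = k") auto
      qed
    next
      case (Suc N)
      note prems = Suc.prems
      have H: "H \<in> carrier_mat n n" "transpose_mat H = H" and v: "v \<in> carrier_vec n" by fact+
      let ?S = "\<lambda>v. {q. k < q \<and> q < n \<and> v $ q \<noteq> 0}"
      have "?S v \<noteq> {}" using prems(1) by force
      then obtain q where q: "k < q" "q < n" "v $ q \<noteq> 0" by auto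
      define r where "r = sqrt ((v $ k)\<^sup>2 + (v $ q)\<^sup>2)"
      have r2: "r\<^sup>2 = (v $ k)\<^sup>2 + (v $ q)\<^sup>2" by (simp add: r_def)
      have r: "0 < r" using q by (simp add: r_def add_nonneg_pos)
      \<comment> \<open>The angle for which the transposed rotation sends the pair
        \<open>(v $ k, v $ q)\<close> to \<open>(r, 0)\<close>.\<close>
      define c where "c = v $ k / r"
      define s where "s = v $ q / r"
      have cs: "c\<^sup>2 + s\<^sup>2 = 1"
        using r by (simp add: c_def s_def power_divide r2 flip: add_divide_distrib) (use r2 in auto)
      have kq: "k < n" "q < n" "k \<noteq> q" using q by auto
      let ?G = "givens n k q c s"
      let ?T = "transpose_mat ?G"
      have G: "?G \<in> carrier_mat n n" by simp
      have T: "?T \<in> carrier_mat n n" by simp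
      define H' where "H' = ?T * H * ?G"
      define v' where "v' = ?T *\<^sub>v v"
      have H': "H' \<in> carrier_mat n n" using H by (auto simp: H'_def intro!: mult_carrier_mat[of _ n n])
      have act: "H' *\<^sub>v x = ?T *\<^sub>v (H *\<^sub>v (?G *\<^sub>v x))" if x: "x \<in> carrier_vec n" for x
        unfolding H'_def
        by (simp only: assoc_mult_mat_vec[OF mult_carrier_mat[OF T H(1)] G x]
          assoc_mult_mat_vec[OF T H(1) mult_mat_vec_carrier[OF G x]])
      have symH': "transpose_mat H' = H'"
        unfolding H'_def using H assoc_mult_mat[OF T H(1) G]
        by (simp only: transpose_mult[OF T mult_carrier_mat[OF H(1) G]] transpose_mult[OF H(1) G] Matrix.transpose_transpose)
      have v': "v' \<in> carrier_vec n" unfolding v'_def by (rule mult_mat_vec_carrier[OF T v])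
      have v'i: "v' $ i = (if i = k then r else if i = q then 0 else v $ i)" if i: "i < n" for i
      proof -
        have "c * v $ k + s * v $ q = r" "c * v $ q - s * v $ k = 0"
          using r r2 by (auto simp: c_def s_def power2_eq_square field_simps)
        then show ?thesis
          unfolding v'_def givens_transpose[OF kq(3)] givens_mult_vec[OF kq v i] by auto
      qed
      have GT: "?G *\<^sub>v v' = v"
        unfolding v'_def assoc_mult_mat_vec[OF G T v, symmetric] givens_orthogonal(2)[OF kq cs] using v by simp
      have eig: "H' *\<^sub>v v' = h \<cdot>\<^sub>v v'"
        unfolding act[OF v'] GT prems(8) unfolding v'_def by (rule mult_mat_vec[OF T v])
      \<comment> \<open>The rotation fixes the unit vectors below \<open>k\<close>, so the columns
        already cleared stay clear.\<close>
      have diag': "H' $$ (j,i) = 0" if "i < k" "j < n" "i \<noteq> j" for i j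
      proof -
        note ij = that
        have i: "i < n" using ij k by simp
        have u: "(unit_vec n i :: real vec) \<in> carrier_vec n" by simp
        have Gu: "givens n k q c s' *\<^sub>v unit_vec n i = unit_vec n i" for s'
        proof (rule eq_vecI)
          fix l assume "l < dim_vec (unit_vec n i :: real vec)"
          then have l: "l < n" by simp
          show "(givens n k q c s' *\<^sub>v unit_vec n i) $ l = unit_vec n i $ l"
            unfolding givens_mult_vec[OF kq u l] using ij q k l by auto
        qed (simp add: givens_def)
        have "H *\<^sub>v unit_vec n i = H $$ (i,i) \<cdot>\<^sub>v unit_vec n i"
          unfolding mat_mult_unit_vec[OF H(1) i] using H(1) i prems(4)[OF ij(1)] by (intro eq_vecI) auto
        then have "H' *\<^sub>v unit_vec n i = H $$ (i,i) \<cdot>\<^sub>v unit_vec n i"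
          unfolding act[OF u] Gu using mult_mat_vec[OF T u] Gu[of "- s"] by (simp add: givens_transpose[OF kq(3)])
        then have "col H' i $ j = (H $$ (i,i) \<cdot>\<^sub>v unit_vec n i) $ j" unfolding mat_mult_unit_vec[OF H' i] by simp
        then show ?thesis using ij i H' by simp
      qed
      have S': "?S v' = ?S v - {q}"
      proof (rule Set.set_eqI)
        fix x show "x \<in> ?S v' \<longleftrightarrow> x \<in> ?S v - {q}" using v'i[of x] q by (cases "x = q") auto
      qed
      have "card (?S v') = N" unfolding S' using prems(1) q by (subst card_Diff_singleton) auto
      moreover have "v' \<noteq> 0\<^sub>v n" using v'i[of k] r k by auto
      moreover have "\<And>i. i < k \<Longrightarrow> v' $ i = 0" using v'i prems(7) q k by auto
      ultimately have "P H'" using Suc.IH[of v' H'] H' symH' diag' v' eig by blast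
      then show ?case using rotate[OF H kq cs] by (simp add: H'_def)
    qed
    show ?case
    proof (rule symmetric_mat_block_eigenvector[OF Suc.prems(2,3) k])
      show "H $$ (j,i) = 0" if "i < k" "j < n" "i \<noteq> j" for i j using that by (rule Suc.prems(4))
    next
      fix h and v :: "real vec"
      assume "v \<in> carrier_vec n" "v \<noteq> 0\<^sub>v n" "\<And>i. i < k \<Longrightarrow> v $ i = 0" "H *\<^sub>v v = h \<cdot>\<^sub>v v"
      with Suc.prems(4) show "P H" by (intro B[OF refl Suc.prems(2,3)]) auto
    qed
  qed
  show ?thesis by (rule A[of 0]) (use H sym in auto)
qed

section \<open>Rotation invariance of Gaussian entries\<close>

text \<open>For \<open>c \<noteq> 0\<close> a rotation is two successive one-dimensional affine
  substitutions, in \<open>y\<close> and then in \<open>x\<close>, whose Jacobians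
  \<open>1 / |c|\<close> and \<open>|c|\<close> cancel. For \<open>c = 0\<close> it exchanges the
  axes up to signs.\<close>

lemma nn_integral_lborel_rotate:
  fixes K :: "real \<times> real \<Rightarrow> ennreal"
  assumes [measurable]: "K \<in> borel_measurable borel" and cs: "c\<^sup>2 + s\<^sup>2 = 1"
  shows "(\<integral>\<^sup>+y. \<integral>\<^sup>+x. K (c * x - s * y, s * x + c * y) \<partial>lborel \<partial>lborel) = (\<integral>\<^sup>+y. \<integral>\<^sup>+x. K (x, y) \<partial>lborel \<partial>lborel)"
proof (cases "c = 0")
  case True
  with cs have s: "s = 1 \<or> s = -1" by (auto simp: power2_eq_1_iff)
  then have s0: "s \<noteq> 0" "\<bar>s\<bar> = 1" "\<bar>- s\<bar> = 1" by auto
  have [measurable]: "K \<in> borel_measurable (borel \<Otimes>\<^sub>M borel)" by (simp add: borel_prod)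
  have "(\<integral>\<^sup>+y. \<integral>\<^sup>+x. K (c * x - s * y, s * x + c * y) \<partial>lborel \<partial>lborel)
    = (\<integral>\<^sup>+y. \<integral>\<^sup>+x. K (- s * y, 0 + s * x) \<partial>lborel \<partial>lborel)" using True by simp
  also have "\<dots> = (\<integral>\<^sup>+y. \<integral>\<^sup>+x. K (- s * y, x) \<partial>lborel \<partial>lborel)"
  proof (rule nn_integral_cong)
    fix y :: real
    have "(\<lambda>x. K (- s * y, x)) \<in> borel_measurable borel" by measurable
    from nn_integral_real_affine[OF this s0(1), of 0] s0
    show "(\<integral>\<^sup>+x. K (- s * y, 0 + s * x) \<partial>lborel) = (\<integral>\<^sup>+x. K (- s * y, x) \<partial>lborel)" by simp
  qed
  also have "\<dots> = (\<integral>\<^sup>+x. \<integral>\<^sup>+y. K (0 + (- s) * y, x) \<partial>lborel \<partial>lborel)"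
    by (subst lborel_pair.Fubini') auto
  also have "\<dots> = (\<integral>\<^sup>+x. \<integral>\<^sup>+y. K (y, x) \<partial>lborel \<partial>lborel)"
  proof (rule nn_integral_cong)
    fix x :: real
    have "(\<lambda>y. K (y, x)) \<in> borel_measurable borel" by measurable
    from nn_integral_real_affine[OF this, of "- s" 0] s0
    show "(\<integral>\<^sup>+y. K (0 + (- s) * y, x) \<partial>lborel) = (\<integral>\<^sup>+y. K (y, x) \<partial>lborel)" by simp
  qed
  finally show ?thesis .
next
  case False
  have [measurable]: "K \<in> borel_measurable (borel \<Otimes>\<^sub>M borel)" by (simp add: borel_prod)
  have s2: "1 - s\<^sup>2 = c\<^sup>2" using cs by simp
  \<comment> \<open>After \<open>x\<close> has been replaced by \<open>c * x - s * y\<close>, the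
    sheared second coordinate collapses to that of the rotation because
    \<open>1 - s^2 = c^2\<close>.\<close>
  have key: "s / c * (- s * y + c * x) + y / c = s * x + c * y" for x y
  proof -
    have "s / c * (- s * y + c * x) + y / c = ((1 - s\<^sup>2) * y) / c + s * x"
      using False by (simp add: field_simps power2_eq_square)
    also have "\<dots> = s * x + c * y" unfolding s2 using False by (simp add: power2_eq_square)
    finally show ?thesis .
  qed
  have "(\<integral>\<^sup>+y. \<integral>\<^sup>+x. K (x, y) \<partial>lborel \<partial>lborel) = (\<integral>\<^sup>+x. \<integral>\<^sup>+y. K (x, y) \<partial>lborel \<partial>lborel)"
    by (rule lborel_pair.Fubini') auto
  also have "\<dots> = (\<integral>\<^sup>+x. \<bar>1 / c\<bar> * (\<integral>\<^sup>+y. K (x, s / c * x + 1 / c * y) \<partial>lborel) \<partial>lborel)"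
    using False by (intro nn_integral_cong nn_integral_real_affine) auto
  also have "\<dots> = \<bar>1 / c\<bar> * (\<integral>\<^sup>+x. (\<integral>\<^sup>+y. K (x, s / c * x + 1 / c * y) \<partial>lborel) \<partial>lborel)"
    by (rule nn_integral_cmult) measurable
  also have "(\<integral>\<^sup>+x. (\<integral>\<^sup>+y. K (x, s / c * x + 1 / c * y) \<partial>lborel) \<partial>lborel) = (\<integral>\<^sup>+y. (\<integral>\<^sup>+x. K (x, s / c * x + 1 / c * y) \<partial>lborel) \<partial>lborel)"
    by (rule lborel_pair.Fubini'[symmetric]) auto
  also have "\<dots> = (\<integral>\<^sup>+y. \<bar>c\<bar> * (\<integral>\<^sup>+x. K (- s * y + c * x, s / c * (- s * y + c * x) + 1 / c * y) \<partial>lborel) \<partial>lborel)"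
    using False by (intro nn_integral_cong nn_integral_real_affine) auto
  also have "\<dots> = (\<integral>\<^sup>+y. \<bar>c\<bar> * (\<integral>\<^sup>+x. K (c * x - s * y, s * x + c * y) \<partial>lborel) \<partial>lborel)"
    using key by simp
  also have "\<dots> = \<bar>c\<bar> * (\<integral>\<^sup>+y. (\<integral>\<^sup>+x. K (c * x - s * y, s * x + c * y) \<partial>lborel) \<partial>lborel)"
    by (rule nn_integral_cmult) measurable
  also have "ennreal \<bar>1 / c\<bar> * (ennreal \<bar>c\<bar> * (\<integral>\<^sup>+y. (\<integral>\<^sup>+x. K (c * x - s * y, s * x + c * y) \<partial>lborel) \<partial>lborel)) = (\<integral>\<^sup>+y. (\<integral>\<^sup>+x. K (c * x - s * y, s * x + c * y) \<partial>lborel) \<partial>lborel)"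
    using False by (simp add: ennreal_mult[symmetric] mult.assoc[symmetric])
  finally show ?thesis by simp
qed

abbreviation gauss :: "real \<Rightarrow> real measure" where
  "gauss sd \<equiv> density lborel (normal_density 0 sd)"

text \<open>The product of the two densities depends only on \<open>x^2 + y^2\<close>, so it can be
  absorbed into the integrand before Lebesgue measure is rotated.\<close>

lemma nn_integral_gauss_rotate:
  assumes [measurable]: "F \<in> borel_measurable borel" and cs: "c\<^sup>2 + s\<^sup>2 = 1"
  shows "(\<integral>\<^sup>+y. \<integral>\<^sup>+x. F (c * x - s * y, s * x + c * y) \<partial>gauss sd \<partial>gauss sd) = (\<integral>\<^sup>+y. \<integral>\<^sup>+x. F (x, y) \<partial>gauss sd \<partial>gauss sd)"
proof -
  have [measurable]: "F \<in> borel_measurable (borel \<Otimes>\<^sub>M borel)" by (simp add: borel_prod)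
  define K where "K = (\<lambda>(x, y). ennreal (normal_density 0 sd x * normal_density 0 sd y) * F (x, y))"
  have "K \<in> borel_measurable (borel \<Otimes>\<^sub>M borel)" unfolding K_def by measurable
  then have K [measurable]: "K \<in> borel_measurable borel" by (simp add: borel_prod)
  have nd: "normal_density 0 sd (c * x - s * y) * normal_density 0 sd (s * x + c * y)
    = normal_density 0 sd x * normal_density 0 sd y" for x y
  proof -
    have "(c * x - s * y)\<^sup>2 + (s * x + c * y)\<^sup>2 = (c\<^sup>2 + s\<^sup>2) * (x\<^sup>2 + y\<^sup>2)"
      by (simp add: power2_eq_square algebra_simps)
    then have "- (c * x - s * y)\<^sup>2 / (2 * sd\<^sup>2) + - (s * x + c * y)\<^sup>2 / (2 * sd\<^sup>2) = - x\<^sup>2 / (2 * sd\<^sup>2) + - y\<^sup>2 / (2 * sd\<^sup>2)"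
      unfolding cs by (simp add: add_divide_distrib[symmetric] diff_divide_distrib[symmetric] field_simps)
    then show ?thesis by (simp add: normal_density_def exp_add[symmetric])
  qed
  have dens: "(\<integral>\<^sup>+y. \<integral>\<^sup>+x. G (x, y) \<partial>gauss sd \<partial>gauss sd) =
      (\<integral>\<^sup>+y. \<integral>\<^sup>+x. ennreal (normal_density 0 sd x * normal_density 0 sd y) * G (x, y) \<partial>lborel \<partial>lborel)"
    if [measurable]: "G \<in> borel_measurable (borel \<Otimes>\<^sub>M borel)" for G
  proof -
    have "(\<integral>\<^sup>+y. \<integral>\<^sup>+x. G (x, y) \<partial>gauss sd \<partial>gauss sd) =
      (\<integral>\<^sup>+y. normal_density 0 sd y * (\<integral>\<^sup>+x. normal_density 0 sd x * G (x, y) \<partial>lborel) \<partial>lborel)"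
      by (simp add: nn_integral_density)
    also have "\<dots> = (\<integral>\<^sup>+y. (\<integral>\<^sup>+x. normal_density 0 sd y * (normal_density 0 sd x * G (x, y)) \<partial>lborel) \<partial>lborel)"
      by (intro nn_integral_cong nn_integral_cmult[symmetric]) measurable
    finally show ?thesis by (simp add: ennreal_mult mult_ac)
  qed
  have "(\<integral>\<^sup>+y. \<integral>\<^sup>+x. F (c * x - s * y, s * x + c * y) \<partial>gauss sd \<partial>gauss sd)
    = (\<integral>\<^sup>+y. \<integral>\<^sup>+x. K (c * x - s * y, s * x + c * y) \<partial>lborel \<partial>lborel)"
    using dens[of "\<lambda>(x, y). F (c * x - s * y, s * x + c * y)"] by (simp add: K_def nd)
  also have "\<dots> = (\<integral>\<^sup>+y. \<integral>\<^sup>+x. K (x, y) \<partial>lborel \<partial>lborel)" by (rule nn_integral_lborel_rotate[OF K cs])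
  also have "\<dots> = (\<integral>\<^sup>+y. \<integral>\<^sup>+x. F (x, y) \<partial>gauss sd \<partial>gauss sd)" using dens[of F] by (simp add: K_def)
  finally show ?thesis .
qed

lemma prob_space_gauss: "0 < sd \<Longrightarrow> prob_space (gauss sd)"
  by (rule prob_space_normal_density)

text \<open>Fubini splits off the coordinates \<open>a\<close> and \<open>b\<close>; with the others
  frozen this is the planar case.\<close>

lemma nn_integral_PiM_gauss_rotate:
  assumes sd: "0 < sd" and I: "finite I" "a \<in> I" "b \<in> I" "a \<noteq> b" and cs: "c\<^sup>2 + s\<^sup>2 = 1"
    and F [measurable]: "F \<in> borel_measurable (PiM I (\<lambda>_. gauss sd))"
  shows "(\<integral>\<^sup>+w. F (w(a := c * w a - s * w b, b := s * w a + c * w b)) \<partial>PiM I (\<lambda>_. gauss sd))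
    = (\<integral>\<^sup>+w. F w \<partial>PiM I (\<lambda>_. gauss sd))"
proof -
  let ?N = "\<lambda>_. gauss sd"
  interpret prob_space "gauss sd" by (rule prob_space_gauss[OF sd])
  interpret product_sigma_finite ?N by standard
  define J where "J = I - {a, b}"
  have J: "finite J" "b \<notin> J" "a \<notin> insert b J" "finite (insert b J)" and IJ: "I = insert a (insert b J)"
    using I by (auto simp: J_def)
  have two: "(\<integral>\<^sup>+w. G w \<partial>PiM I ?N) = (\<integral>\<^sup>+z. \<integral>\<^sup>+y. \<integral>\<^sup>+x. G (z(b := y, a := x)) \<partial>gauss sd \<partial>gauss sd \<partial>PiM J ?N)"
    if G: "G \<in> borel_measurable (PiM I ?N)" for G
  proof -
    have G' [measurable]: "G \<in> borel_measurable (PiM (insert a (insert b J)) ?N)" using G IJ by simp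
    have "(\<integral>\<^sup>+w. G w \<partial>PiM I ?N) = (\<integral>\<^sup>+w. \<integral>\<^sup>+x. G (w(a := x)) \<partial>gauss sd \<partial>PiM (insert b J) ?N)"
      unfolding IJ by (rule product_nn_integral_insert[OF J(4,3) G'])
    also have "\<dots> = (\<integral>\<^sup>+z. \<integral>\<^sup>+y. \<integral>\<^sup>+x. G (z(b := y, a := x)) \<partial>gauss sd \<partial>gauss sd \<partial>PiM J ?N)"
      by (rule product_nn_integral_insert[OF J(1,2)]) measurable
    finally show ?thesis .
  qed
  have T: "(\<lambda>w. w(a := c * w a - s * w b, b := s * w a + c * w b)) \<in> PiM I ?N \<rightarrow>\<^sub>M PiM I ?N"
  proof (rule measurable_PiM_single')
    fix i assume i: "i \<in> I"
    show "(\<lambda>w. (w(a := c * w a - s * w b, b := s * w a + c * w b)) i) \<in> PiM I ?N \<rightarrow>\<^sub>M gauss sd"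
      using i I by (cases "i = a"; cases "i = b") auto
  qed (use I in \<open>auto simp: space_PiM PiE_def extensional_def\<close>)
  have FT: "(\<lambda>w. F (w(a := c * w a - s * w b, b := s * w a + c * w b))) \<in> borel_measurable (PiM I ?N)"
    using measurable_compose[OF T F] .
  have "(\<integral>\<^sup>+y. \<integral>\<^sup>+x. F (z(b := s * x + c * y, a := c * x - s * y)) \<partial>gauss sd \<partial>gauss sd)
      = (\<integral>\<^sup>+y. \<integral>\<^sup>+x. F (z(b := y, a := x)) \<partial>gauss sd \<partial>gauss sd)" if z: "z \<in> space (PiM J ?N)" for z
  proof -
    have "(\<lambda>p. z(b := snd p, a := fst p)) \<in> borel \<Otimes>\<^sub>M borel \<rightarrow>\<^sub>M PiM I ?N"
    proof (rule measurable_PiM_single')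
      fix i assume i: "i \<in> I"
      show "(\<lambda>p. (z(b := snd p, a := fst p)) i) \<in> borel \<Otimes>\<^sub>M borel \<rightarrow>\<^sub>M gauss sd"
        by (cases "i = a"; cases "i = b") auto
    qed (use IJ z in \<open>auto simp: space_PiM PiE_def extensional_def\<close>)
    from measurable_compose[OF this F]
    have "(\<lambda>p. F (z(b := snd p, a := fst p))) \<in> borel_measurable borel" by (simp add: borel_prod)
    from nn_integral_gauss_rotate[OF this cs] show ?thesis by simp
  qed
  then show ?thesis
    unfolding two[OF FT] two[OF F] using I(4)
    by (intro nn_integral_cong[of "PiM J ?N"]) (simp add: fun_upd_twist)
qed

text \<open>At \<open>k = m\<close> this is right multiplication of the sketch by a transposed plane
  rotation. Rows use disjoint pairs of coordinates, so they are rotated one at a time,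
  \<open>k\<close> counting those done.\<close>

lemma nn_integral_gaussian_entries_rotate:
  assumes m: "0 < m" and pq: "p < d" "q < d" "p \<noteq> q" and cs: "c\<^sup>2 + s\<^sup>2 = 1"
    and F: "F \<in> borel_measurable (gaussian_entries m d)" and k: "k \<le> m"
  shows "(\<integral>\<^sup>+w. F (\<lambda>(i,j). if i < k \<and> j = p then c * w (i,p) - s * w (i,q)
            else if i < k \<and> j = q then s * w (i,p) + c * w (i,q) else w (i,j)) \<partial>gaussian_entries m d)
    = (\<integral>\<^sup>+w. F w \<partial>gaussian_entries m d)"
  using k F
proof (induction k arbitrary: F)
  case 0
  then show ?case by simp
next
  case (Suc k)
  let ?sd = "1 / sqrt (real m)" and ?I = "{..<m} \<times> {..<d}"
  let ?N = "\<lambda>_. gauss ?sd"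
  have G: "gaussian_entries m d = PiM ?I ?N" by (simp add: gaussian_entries_def)
  let ?T = "\<lambda>w. w((k,p) := c * w (k,p) - s * w (k,q), (k,q) := s * w (k,p) + c * w (k,q))"
  have T: "?T \<in> PiM ?I ?N \<rightarrow>\<^sub>M PiM ?I ?N"
  proof (rule measurable_PiM_single')
    fix i assume i: "i \<in> ?I"
    show "(\<lambda>w. ?T w i) \<in> PiM ?I ?N \<rightarrow>\<^sub>M gauss ?sd"
      using i pq Suc.prems(1) by (cases "i = (k,p)"; cases "i = (k,q)") auto
  qed (use pq Suc.prems(1) in \<open>auto simp: space_PiM PiE_def extensional_def\<close>)
  let ?R = "\<lambda>k w (i,j). if i < k \<and> j = p then c * w (i,p) - s * w (i,q)
            else if i < k \<and> j = q then s * w (i,p) + c * w (i,q) else w (i,j)"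
  have RS: "?R (Suc k) w = ?T (?R k w)" for w :: "nat \<times> nat \<Rightarrow> real"
    using pq by (auto simp: fun_eq_iff)
  have FT: "(\<lambda>w. F (?T w)) \<in> borel_measurable (gaussian_entries m d)"
    using measurable_compose[OF T] Suc.prems(2) unfolding G by blast
  have "(\<integral>\<^sup>+w. F (?R (Suc k) w) \<partial>gaussian_entries m d) = (\<integral>\<^sup>+w. F (?T (?R k w)) \<partial>gaussian_entries m d)"
    unfolding RS ..
  also have "\<dots> = (\<integral>\<^sup>+w. F (?T w) \<partial>gaussian_entries m d)"
    by (rule Suc.IH[OF _ FT]) (use Suc.prems in simp)
  also have "\<dots> = (\<integral>\<^sup>+w. F w \<partial>gaussian_entries m d)"
    unfolding G using m pq Suc.prems(1) cs Suc.prems(2)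
    by (intro nn_integral_PiM_gauss_rotate) (auto simp: G)
  finally show ?case .
qed

section \<open>Bounded differences\<close>

text \<open>Oscillation at most \<open>c\<close> confines the values to an interval of length
  \<open>c\<close> starting at the infimum, the form in which Hoeffding's lemma applies.\<close>

lemma (in prob_space) hoeffding_oscillation:
  assumes f [measurable]: "f \<in> borel_measurable M" and K: "\<And>x. x \<in> space M \<Longrightarrow> \<bar>f x\<bar> \<le> K"
    and osc: "\<And>x y. x \<in> space M \<Longrightarrow> y \<in> space M \<Longrightarrow> \<bar>f x - f y\<bar> \<le> c" and \<theta>: "0 < \<theta>"
  shows "(\<integral>\<^sup>+x. exp (\<theta> * (f x - expectation f)) \<partial>M) \<le> ennreal (exp (\<theta>\<^sup>2 * c\<^sup>2 / 8))"
proof -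
  define a where "a = Inf (f ` space M)"
  have ne: "f ` space M \<noteq> {}" using not_empty by simp
  have bdd: "bdd_below (f ` space M)" using K by (intro bdd_belowI[of _ "- K"]) (force simp: abs_le_iff)
  have lb: "a \<le> f x" if "x \<in> space M" for x
    unfolding a_def using bdd that by (intro cInf_lower) auto
  have ub: "f x \<le> a + c" if x: "x \<in> space M" for x
  proof -
    have "f x - c \<le> a" unfolding a_def
    proof (rule cInf_greatest[OF ne])
      fix z assume "z \<in> f ` space M"
      then show "f x - c \<le> z" using osc[OF x] by (auto simp: abs_le_iff) force
    qed
    then show ?thesis by simp
  qed
  interpret interval_bounded_random_variable M f a "a + c"
    by unfold_locales (use lb ub in auto)
  show ?thesis using Hoeffdings_lemma_nn_integral[OF \<theta>] by simp
qed

text \<open>McDiarmid's argument with blocks \<open>B i\<close> of coordinates in place of single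
  ones; the blocks will be the rows of the sketch. One block is averaged out at a time:
  \<open>F\<close> minus its partial mean \<open>G\<close> oscillates by at most \<open>c\<close>,
  so Hoeffding's lemma applies, and \<open>G\<close> inherits the bounded differences. The bound
  \<open>K\<close> provides integrability.\<close>

lemma (in product_prob_space) bounded_differences_mgf:
  assumes "finite A" "\<And>i. i \<in> A \<Longrightarrow> finite (B i)" "disjoint_family_on B A"
    and "F \<in> borel_measurable (PiM (\<Union>i\<in>A. B i) M)"
    and "\<And>x. x \<in> space (PiM (\<Union>i\<in>A. B i) M) \<Longrightarrow> \<bar>F x\<bar> \<le> (K :: real)"
    and "\<And>i x y. i \<in> A \<Longrightarrow> x \<in> space (PiM (\<Union>i\<in>A. B i) M) \<Longrightarrow> y \<in> space (PiM (\<Union>i\<in>A. B i) M)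
      \<Longrightarrow> (\<And>j. j \<notin> B i \<Longrightarrow> x j = y j) \<Longrightarrow> \<bar>F x - F y\<bar> \<le> c"
    and \<theta>: "0 < \<theta>"
  shows "(\<integral>\<^sup>+x. exp (\<theta> * (F x - (\<integral>x. F x \<partial>PiM (\<Union>i\<in>A. B i) M))) \<partial>PiM (\<Union>i\<in>A. B i) M)
    \<le> ennreal (exp (real (card A) * (\<theta>\<^sup>2 * c\<^sup>2 / 8)))"
  using assms(1-6)
proof (induction A arbitrary: F rule: finite_induct)
  case empty
  then show ?case by (simp add: PiM_empty nn_integral_count_space_finite lebesgue_integral_count_space_finite)
next
  case (insert i A)
  define U where "U = (\<Union>i\<in>A. B i)"
  define V where "V = B i"
  have UV: "(\<Union>i\<in>insert i A. B i) = U \<union> V" by (auto simp: U_def V_def)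
  have fin: "finite U" "finite V" using insert.hyps insert.prems(1) by (auto simp: U_def V_def)
  have disj: "U \<inter> V = {}"
    using insert.prems(2) insert.hyps by (auto simp: U_def V_def disjoint_family_on_def)
  note prems = insert.prems[unfolded UV]
  have F [measurable]: "F \<in> borel_measurable (PiM (U \<union> V) M)" by (rule prems(3))
  interpret PU: prob_space "PiM U M" by (rule prob_space_PiM) (rule prob_space)
  interpret PV: prob_space "PiM V M" by (rule prob_space_PiM) (rule prob_space)
  interpret PUV: prob_space "PiM (U \<union> V) M" by (rule prob_space_PiM) (rule prob_space)
  have mem: "merge U V (x, y) \<in> space (PiM (U \<union> V) M)" if "x \<in> space (PiM U M)" "y \<in> space (PiM V M)" for x y
    using measurable_space[OF measurable_merge, of "(x, y)" U M V] that by (simp add: space_pair_measure)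
  have intF: "integrable (PiM (U \<union> V) M) F"
    by (rule PUV.integrable_const_bound[of _ K]) (use prems(4) in auto)
  have Fxm: "(\<lambda>y. F (merge U V (x, y))) \<in> borel_measurable (PiM V M)" if "x \<in> space (PiM U M)" for x
    using that by measurable
  have intx: "integrable (PiM V M) (\<lambda>y. F (merge U V (x, y)))" if x: "x \<in> space (PiM U M)" for x
    by (rule PV.integrable_const_bound[of _ K]) (use prems(4) mem[OF x] Fxm[OF x] in auto)
  define G where "G = (\<lambda>x. \<integral>y. F (merge U V (x, y)) \<partial>PiM V M)"
  have G [measurable]: "G \<in> borel_measurable (PiM U M)" unfolding G_def by measurable
  have EG: "(\<integral>x. F x \<partial>PiM (U \<union> V) M) = (\<integral>x. G x \<partial>PiM U M)"
    unfolding G_def by (rule product_integral_fold[OF disj fin intF])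
  have GK: "\<bar>G x\<bar> \<le> K" if x: "x \<in> space (PiM U M)" for x
  proof -
    have "\<bar>G x\<bar> \<le> (\<integral>y. \<bar>F (merge U V (x, y))\<bar> \<partial>PiM V M)" unfolding G_def by (rule integral_abs_bound)
    also have "\<dots> \<le> (\<integral>y. K \<partial>PiM V M)"
      using intx[OF x] prems(4) mem[OF x] by (intro integral_mono) auto
    finally show ?thesis by (simp add: PV.prob_space)
  qed
  have Gd: "\<bar>G x - G x'\<bar> \<le> c" if l: "l \<in> A" and x: "x \<in> space (PiM U M)" "x' \<in> space (PiM U M)"
    and e: "\<And>j. j \<notin> B l \<Longrightarrow> x j = x' j" for l x x'
  proof -
    have "\<bar>G x - G x'\<bar> = \<bar>\<integral>y. F (merge U V (x, y)) - F (merge U V (x', y)) \<partial>PiM V M\<bar>"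
      unfolding G_def using intx x by simp
    also have "\<dots> \<le> (\<integral>y. \<bar>F (merge U V (x, y)) - F (merge U V (x', y))\<bar> \<partial>PiM V M)" by (rule integral_abs_bound)
    also have "\<dots> \<le> (\<integral>y. c \<partial>PiM V M)"
    proof (rule integral_mono)
      fix y assume y: "y \<in> space (PiM V M)"
      show "\<bar>F (merge U V (x, y)) - F (merge U V (x', y))\<bar> \<le> c"
        by (rule prems(5)[of l]) (use l mem x y e in \<open>auto simp: merge_def\<close>)
    qed (use intx x in auto)
    finally show ?thesis by (simp add: PV.prob_space)
  qed
  have IH: "(\<integral>\<^sup>+x. exp (\<theta> * (G x - (\<integral>x. G x \<partial>PiM U M))) \<partial>PiM U M) \<le> ennreal (exp (real (card A) * (\<theta>\<^sup>2 * c\<^sup>2 / 8)))"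
    unfolding U_def
  proof (rule insert.IH)
    show "\<And>i. i \<in> A \<Longrightarrow> finite (B i)" using insert.prems(1) by auto
    show "disjoint_family_on B A" using insert.prems(2) by (auto simp: disjoint_family_on_def)
    show "\<And>x. x \<in> space (Pi\<^sub>M (\<Union> (B ` A)) M) \<Longrightarrow> \<bar>G x\<bar> \<le> K" using GK by (simp add: U_def)
  qed (use G Gd in \<open>auto simp: U_def\<close>)
  define m where "m = (\<integral>x. G x \<partial>PiM U M)"
  have inner: "(\<integral>\<^sup>+y. exp (\<theta> * (F (merge U V (x, y)) - m)) \<partial>PiM V M) \<le> ennreal (exp (\<theta>\<^sup>2 * c\<^sup>2 / 8)) * exp (\<theta> * (G x - m))"
    if x: "x \<in> space (PiM U M)" for x
  proof -
    have "(\<integral>\<^sup>+y. exp (\<theta> * (F (merge U V (x, y)) - m)) \<partial>PiM V M)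
      = (\<integral>\<^sup>+y. ennreal (exp (\<theta> * (F (merge U V (x, y)) - G x))) * exp (\<theta> * (G x - m)) \<partial>PiM V M)"
      by (simp add: ennreal_mult[symmetric] exp_add[symmetric] algebra_simps)
    also have "\<dots> = (\<integral>\<^sup>+y. ennreal (exp (\<theta> * (F (merge U V (x, y)) - G x))) \<partial>PiM V M) * exp (\<theta> * (G x - m))"
      by (rule nn_integral_multc) (use Fxm[OF x] in simp)
    also have "(\<integral>\<^sup>+y. ennreal (exp (\<theta> * (F (merge U V (x, y)) - G x))) \<partial>PiM V M) \<le> ennreal (exp (\<theta>\<^sup>2 * c\<^sup>2 / 8))"
      unfolding G_def
    proof (rule PV.hoeffding_oscillation[OF Fxm[OF x] _ _ \<theta>])
      show "\<bar>F (merge U V (x, y))\<bar> \<le> K" if "y \<in> space (PiM V M)" for y using prems(4) mem[OF x that] by simp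
      show "\<bar>F (merge U V (x, y)) - F (merge U V (x, z))\<bar> \<le> c" if "y \<in> space (PiM V M)" "z \<in> space (PiM V M)" for y z
        by (rule prems(5)[of i]) (use mem[OF x] that V_def in \<open>auto simp: merge_def\<close>)
    qed
    finally show ?thesis by (simp add: mult_right_mono)
  qed
  have "(\<integral>\<^sup>+x. exp (\<theta> * (F x - m)) \<partial>PiM (U \<union> V) M)
    = (\<integral>\<^sup>+x. \<integral>\<^sup>+y. exp (\<theta> * (F (merge U V (x, y)) - m)) \<partial>PiM V M \<partial>PiM U M)"
    by (rule product_nn_integral_fold[OF disj fin]) measurable
  also have "\<dots> \<le> (\<integral>\<^sup>+x. ennreal (exp (\<theta>\<^sup>2 * c\<^sup>2 / 8)) * exp (\<theta> * (G x - m)) \<partial>PiM U M)"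
    by (intro nn_integral_mono inner)
  also have "\<dots> = ennreal (exp (\<theta>\<^sup>2 * c\<^sup>2 / 8)) * (\<integral>\<^sup>+x. exp (\<theta> * (G x - m)) \<partial>PiM U M)"
    by (rule nn_integral_cmult) measurable
  also have "\<dots> \<le> ennreal (exp (\<theta>\<^sup>2 * c\<^sup>2 / 8)) * ennreal (exp (real (card A) * (\<theta>\<^sup>2 * c\<^sup>2 / 8)))"
    using IH by (intro mult_left_mono) (auto simp: m_def)
  also have "\<dots> = ennreal (exp (real (card (insert i A)) * (\<theta>\<^sup>2 * c\<^sup>2 / 8)))"
    using insert.hyps by (simp add: ennreal_mult[symmetric] exp_add[symmetric] algebra_simps)
  finally show ?case unfolding UV EG m_def .
qed

section \<open>Tail and mean deviation from a sub-Gaussian moment generating function\<close>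

lemma (in prob_space) sub_gaussian_tail:
  assumes X [measurable]: "X \<in> borel_measurable M" and V: "0 < V" and t: "0 < t"
    and mgf: "\<And>\<theta>. 0 < \<theta> \<Longrightarrow> (\<integral>\<^sup>+x. exp (\<theta> * X x) \<partial>M) \<le> ennreal (exp (\<theta>\<^sup>2 * V / 8))"
  shows "prob {x \<in> space M. t \<le> X x} \<le> exp (- 2 * t\<^sup>2 / V)"
proof -
  \<comment> \<open>The minimiser of \<open>- \<theta> * t + \<theta>^2 * V / 8\<close> in the
    Chernoff bound.\<close>
  define \<theta> where "\<theta> = 4 * t / V"
  have \<theta>: "0 < \<theta>" using V t by (simp add: \<theta>_def)
  have "{x \<in> space M. t \<le> X x} \<subseteq> {x \<in> space M. 1 \<le> ennreal (exp (- \<theta> * t)) * ennreal (exp (\<theta> * X x))}"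
    using \<theta> by (auto simp: ennreal_mult[symmetric] exp_add[symmetric] simp flip: ennreal_1)
  then have "emeasure M {x \<in> space M. t \<le> X x} \<le> emeasure M {x \<in> space M. 1 \<le> ennreal (exp (- \<theta> * t)) * ennreal (exp (\<theta> * X x))}"
    by (intro emeasure_mono) auto
  also have "\<dots> \<le> ennreal (exp (- \<theta> * t)) * (\<integral>\<^sup>+x. ennreal (exp (\<theta> * X x)) \<partial>M)"
  proof -
    have "emeasure M {x \<in> space M. 1 \<le> ennreal (exp (- \<theta> * t)) * ennreal (exp (\<theta> * X x))}
      \<le> ennreal (exp (- \<theta> * t)) * (\<integral>\<^sup>+x. ennreal (exp (\<theta> * X x)) * indicator (space M) x \<partial>M)"
      by (rule nn_integral_Markov_inequality) auto
    also have "(\<integral>\<^sup>+x. ennreal (exp (\<theta> * X x)) * indicator (space M) x \<partial>M) = (\<integral>\<^sup>+x. ennreal (exp (\<theta> * X x)) \<partial>M)"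
      by (rule nn_integral_cong) simp
    finally show ?thesis .
  qed
  also have "\<dots> \<le> ennreal (exp (- \<theta> * t)) * ennreal (exp (\<theta>\<^sup>2 * V / 8))"
    by (intro mult_left_mono mgf \<theta>) auto
  also have "\<dots> = ennreal (exp (- \<theta> * t + \<theta>\<^sup>2 * V / 8))" by (simp add: ennreal_mult[symmetric] exp_add[symmetric])
  also have "- \<theta> * t + \<theta>\<^sup>2 * V / 8 = - 2 * t\<^sup>2 / V" using V by (simp add: \<theta>_def power2_eq_square field_simps)
  finally show ?thesis by (simp add: emeasure_eq_measure)
qed

lemma (in prob_space) sub_gaussian_mean_abs:
  assumes X [measurable]: "X \<in> borel_measurable M" and V: "0 < V"
    and mgf: "\<And>\<theta>. 0 < \<theta> \<Longrightarrow> (\<integral>\<^sup>+x. exp (\<theta> * X x) \<partial>M) \<le> ennreal (exp (\<theta>\<^sup>2 * V / 8))"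
    and mgf': "\<And>\<theta>. 0 < \<theta> \<Longrightarrow> (\<integral>\<^sup>+x. exp (\<theta> * (- X x)) \<partial>M) \<le> ennreal (exp (\<theta>\<^sup>2 * V / 8))"
  shows "(\<integral>\<^sup>+x. ennreal \<bar>X x\<bar> \<partial>M) \<le> ennreal (2 * sqrt V)"
proof -
  \<comment> \<open>Chosen so that both exponentials integrate to at most
    \<open>exp (1 / 2)\<close>, while \<open>2 / \<theta>\<close> is \<open>sqrt V\<close>.\<close>
  define \<theta> where "\<theta> = 2 / sqrt V"
  have \<theta>: "0 < \<theta>" using V by (simp add: \<theta>_def)
  have \<theta>V: "\<theta>\<^sup>2 * V / 8 = 1 / 2" using V by (simp add: \<theta>_def power_divide)
  have "ennreal \<bar>X x\<bar> \<le> ennreal (1 / \<theta>) * (ennreal (exp (\<theta> * X x)) + ennreal (exp (\<theta> * (- X x))))" for x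
  proof -
    have "\<theta> * \<bar>X x\<bar> \<le> exp (\<theta> * \<bar>X x\<bar>)" using exp_ge_add_one_self[of "\<theta> * \<bar>X x\<bar>"] by linarith
    also have "\<dots> \<le> exp (\<theta> * X x) + exp (\<theta> * (- X x))" by (cases "0 \<le> X x") auto
    finally have "\<bar>X x\<bar> \<le> 1 / \<theta> * (exp (\<theta> * X x) + exp (\<theta> * (- X x)))" using \<theta> by (simp add: field_simps)
    then show ?thesis
      using \<theta> by (simp add: ennreal_mult[symmetric] ennreal_plus[symmetric] del: ennreal_plus)
  qed
  then have "(\<integral>\<^sup>+x. ennreal \<bar>X x\<bar> \<partial>M) \<le> (\<integral>\<^sup>+x. ennreal (1 / \<theta>) * (ennreal (exp (\<theta> * X x)) + ennreal (exp (\<theta> * (- X x)))) \<partial>M)"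
    by (intro nn_integral_mono)
  also have "\<dots> = ennreal (1 / \<theta>) * ((\<integral>\<^sup>+x. ennreal (exp (\<theta> * X x)) \<partial>M) + (\<integral>\<^sup>+x. ennreal (exp (\<theta> * (- X x))) \<partial>M))"
    by (subst nn_integral_cmult) (auto simp: nn_integral_add)
  also have "\<dots> \<le> ennreal (1 / \<theta>) * (ennreal (exp (1 / 2)) + ennreal (exp (1 / 2)))"
    using mgf[OF \<theta>] mgf'[OF \<theta>] unfolding \<theta>V by (intro mult_left_mono add_mono) auto
  also have "\<dots> = ennreal (sqrt V * exp (1 / 2))"
    using \<theta> by (simp add: ennreal_mult[symmetric] ennreal_plus[symmetric] \<theta>_def del: ennreal_plus)
  also have "\<dots> \<le> ennreal (2 * sqrt V)"
  proof (rule ennreal_leI)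
    have "exp (1 / 2 :: real) \<le> 2" using exp_bound_half[of "1/2::real"] by simp
    then show "sqrt V * exp (1 / 2) \<le> 2 * sqrt V" using V by (simp add: mult.commute mult_right_mono)
  qed
  finally show ?thesis .
qed

section \<open>Gaussian quadratic forms\<close>

lemma gauss_moments:
  assumes sd: "0 < sd"
  shows "integrable (gauss sd) (\<lambda>x. x ^ k)"
    and "(\<integral>x. x \<partial>gauss sd) = 0" "(\<integral>x. x\<^sup>2 \<partial>gauss sd) = sd\<^sup>2"
    and "(\<integral>x. x ^ 3 \<partial>gauss sd) = 0" "(\<integral>x. x ^ 4 \<partial>gauss sd) = 3 * (sd\<^sup>2)\<^sup>2"
proof -
  have e: "(\<integral>x. x ^ k \<partial>gauss sd) = (\<integral>x. normal_density 0 sd x * (x - 0) ^ k \<partial>lborel)" for k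
    by (subst integral_density) auto
  show "integrable (gauss sd) (\<lambda>x. x ^ k)"
    using integrable_normal_moment[OF sd, of 0 k] by (subst integrable_density) auto
  show "(\<integral>x. x \<partial>gauss sd) = 0"
    using e[of 1] integral_normal_moment_odd[OF sd, of 0 0] by simp
  show "(\<integral>x. x\<^sup>2 \<partial>gauss sd) = sd\<^sup>2"
    using e[of 2] integral_normal_moment_even[OF sd, of 0 1] by (simp add: fact_numeral)
  show "(\<integral>x. x ^ 3 \<partial>gauss sd) = 0"
    using e[of 3] integral_normal_moment_odd[OF sd, of 0 1] by (simp add: eval_nat_numeral)
  show "(\<integral>x. x ^ 4 \<partial>gauss sd) = 3 * (sd\<^sup>2)\<^sup>2"
    using e[of 4] integral_normal_moment_even[OF sd, of 0 2] by (simp add: fact_numeral power_divide)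
qed

text \<open>\<open>1\<close>, \<open>y\<close> and \<open>y^2 - sd^2\<close> are the Hermite
  polynomials for this variance: orthogonal, with squared norms \<open>1\<close>,
  \<open>sd^2\<close> and \<open>2 * sd^4\<close>. Quadratic forms are built up in this basis one
  variable at a time.\<close>

lemma gauss_poly4:
  fixes a b e :: real
  assumes sd: "0 < sd"
  shows "(\<integral>y. a + b * y + e * (y\<^sup>2 - sd\<^sup>2) \<partial>gauss sd) = a"
    and "(\<integral>\<^sup>+y. ennreal ((a + b * y + e * (y\<^sup>2 - sd\<^sup>2))\<^sup>2) \<partial>gauss sd) = ennreal (a\<^sup>2 + sd\<^sup>2 * b\<^sup>2 + 2 * (sd\<^sup>2)\<^sup>2 * e\<^sup>2)"
proof -
  interpret prob_space "gauss sd" by (rule prob_space_gauss[OF sd])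
  note M = gauss_moments[OF sd]
  have I: "integrable (gauss sd) (\<lambda>x. x)" "integrable (gauss sd) (\<lambda>x. x\<^sup>2)" "integrable (gauss sd) (\<lambda>x. x^3)" "integrable (gauss sd) (\<lambda>x. x^4)"
    using M(1)[of 1] M(1)[of 2] M(1)[of 3] M(1)[of 4] by auto
  show "(\<integral>y. a + b * y + e * (y\<^sup>2 - sd\<^sup>2) \<partial>gauss sd) = a" using I M prob_space[simplified] by simp
  let ?d = "a - e * sd\<^sup>2"
  have *: "(a + b * y + e * (y\<^sup>2 - sd\<^sup>2))\<^sup>2 = ?d\<^sup>2 + (2 * ?d * b) * y + (b\<^sup>2 + 2 * ?d * e) * y\<^sup>2 + (2 * b * e) * y^3 + e\<^sup>2 * y^4" for y
    by (simp add: eval_nat_numeral algebra_simps)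
  have "integrable (gauss sd) (\<lambda>y. (a + b * y + e * (y\<^sup>2 - sd\<^sup>2))\<^sup>2)" unfolding * using I by (intro Bochner_Integration.integrable_add integrable_mult_right) auto
  then have "(\<integral>\<^sup>+y. ennreal ((a + b * y + e * (y\<^sup>2 - sd\<^sup>2))\<^sup>2) \<partial>gauss sd) = ennreal (\<integral>y. (a + b * y + e * (y\<^sup>2 - sd\<^sup>2))\<^sup>2 \<partial>gauss sd)"
    by (intro nn_integral_eq_integral) auto
  also have "(\<integral>y. (a + b * y + e * (y\<^sup>2 - sd\<^sup>2))\<^sup>2 \<partial>gauss sd) = ?d\<^sup>2 + (b\<^sup>2 + 2 * ?d * e) * sd\<^sup>2 + e\<^sup>2 * (3 * (sd\<^sup>2)\<^sup>2)"
    unfolding * using I M prob_space[simplified] by simp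
  also have "\<dots> = a\<^sup>2 + sd\<^sup>2 * b\<^sup>2 + 2 * (sd\<^sup>2)\<^sup>2 * e\<^sup>2" by (simp add: power2_eq_square algebra_simps)
  finally show "(\<integral>\<^sup>+y. ennreal ((a + b * y + e * (y\<^sup>2 - sd\<^sup>2))\<^sup>2) \<partial>gauss sd) = ennreal (a\<^sup>2 + sd\<^sup>2 * b\<^sup>2 + 2 * (sd\<^sup>2)\<^sup>2 * e\<^sup>2)" .
qed

context
  fixes sd :: real
  assumes sd: "0 < sd"
begin

abbreviation "GP J \<equiv> PiM J (\<lambda>_. gauss sd)"

lemma gauss_product_prob_space: "product_prob_space (\<lambda>_. gauss sd)"
proof -
  interpret prob_space "gauss sd" by (rule prob_space_gauss[OF sd])
  show ?thesis by standard
qed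

lemma nn_integral_gauss_linear_sq:
  assumes J: "finite J"
  shows "(\<integral>\<^sup>+x. ennreal ((\<Sum>l\<in>J. b l * x l)\<^sup>2) \<partial>GP J) = ennreal (sd\<^sup>2 * (\<Sum>l\<in>J. (b l)\<^sup>2))"
  using J
proof (induction J)
  case empty
  then show ?case by simp
next
  case (insert p J)
  interpret product_prob_space "\<lambda>_. gauss sd" by (rule gauss_product_prob_space)
  interpret PJ: prob_space "GP J" by (rule prob_space_PiM) (rule prob_space_gauss[OF sd])
  have "(\<integral>\<^sup>+x. ennreal ((\<Sum>l\<in>insert p J. b l * x l)\<^sup>2) \<partial>GP (insert p J))
    = (\<integral>\<^sup>+x. \<integral>\<^sup>+y. ennreal ((\<Sum>l\<in>insert p J. b l * (x(p := y)) l)\<^sup>2) \<partial>gauss sd \<partial>GP J)"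
    using insert.hyps by (intro product_nn_integral_insert) measurable
  also have "\<dots> = (\<integral>\<^sup>+x. ennreal ((\<Sum>l\<in>J. b l * x l)\<^sup>2) + ennreal (sd\<^sup>2 * (b p)\<^sup>2) \<partial>GP J)"
  proof (rule nn_integral_cong)
    fix x :: "'a \<Rightarrow> real"
    have "(\<Sum>l\<in>insert p J. b l * (x(p := y)) l) = (\<Sum>l\<in>J. b l * x l) + b p * y + 0 * (y\<^sup>2 - sd\<^sup>2)" for y
    proof -
      have "(\<Sum>l\<in>J. b l * (x(p := y)) l) = (\<Sum>l\<in>J. b l * x l)"
        using insert.hyps by (intro sum.cong) auto
      then show ?thesis using insert.hyps by simp
    qed
    then show "(\<integral>\<^sup>+y. ennreal ((\<Sum>l\<in>insert p J. b l * (x(p := y)) l)\<^sup>2) \<partial>gauss sd) = ennreal ((\<Sum>l\<in>J. b l * x l)\<^sup>2) + ennreal (sd\<^sup>2 * (b p)\<^sup>2)"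
      using gauss_poly4(2)[OF sd, of "\<Sum>l\<in>J. b l * x l" "b p" 0] by simp
  qed
  also have "\<dots> = ennreal (sd\<^sup>2 * (\<Sum>l\<in>J. (b l)\<^sup>2)) + ennreal (sd\<^sup>2 * (b p)\<^sup>2)"
    by (subst nn_integral_add) (auto simp: insert.IH PJ.emeasure_space_1)
  finally show ?case using insert.hyps by (simp add: sum_nonneg algebra_simps flip: ennreal_plus)
qed

definition quad_centered :: "'i set \<Rightarrow> ('i \<Rightarrow> 'i \<Rightarrow> real) \<Rightarrow> ('i \<Rightarrow> real) \<Rightarrow> real" where
  "quad_centered J R x = (\<Sum>k\<in>J. \<Sum>l\<in>J. R k l * x k * x l) - sd\<^sup>2 * (\<Sum>k\<in>J. R k k)"

text \<open>Centring by the trace makes the new variable enter through Hermite polynomials with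
  coefficients in the old variables, exactly the shape that \<open>gauss_poly4\<close>
  integrates.\<close>

lemma quad_centered_insert:
  assumes J: "finite J" "p \<notin> J" and sym: "\<And>k l. R k l = R l k"
  shows "quad_centered (insert p J) R (x(p := y))
    = quad_centered J R x + (2 * (\<Sum>l\<in>J. R p l * x l)) * y + R p p * (y\<^sup>2 - sd\<^sup>2)"
proof -
  have 1: "(x(p := y)) l = x l" if "l \<in> J" for l using that J by auto
  have 2: "(\<Sum>k\<in>J. R k p * x k * y) = (\<Sum>l\<in>J. R p l * x l) * y"
    using sym[of _ p] by (simp add: sum_distrib_right)
  have 3: "(\<Sum>l\<in>J. R p l * y * x l) = (\<Sum>l\<in>J. R p l * x l) * y"
    unfolding sum_distrib_right by (intro sum.cong) auto
  have "(\<Sum>k\<in>insert p J. \<Sum>l\<in>insert p J. R k l * (x(p := y)) k * (x(p := y)) l)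
    = (R p p * y * y + (\<Sum>l\<in>J. R p l * y * x l)) + (\<Sum>k\<in>J. R k p * x k * y + (\<Sum>l\<in>J. R k l * x k * x l))"
  proof -
    have a: "(\<Sum>l\<in>J. R p l * y * (x(p := y)) l) = (\<Sum>l\<in>J. R p l * y * x l)"
      by (rule sum.cong) (simp_all only: 1)
    have b: "(\<Sum>k\<in>J. R k p * (x(p := y)) k * y + (\<Sum>l\<in>J. R k l * (x(p := y)) k * (x(p := y)) l))
        = (\<Sum>k\<in>J. R k p * x k * y + (\<Sum>l\<in>J. R k l * x k * x l))"
      by (rule sum.cong[OF refl], rule arg_cong2[of _ _ _ _ "(+)"], simp only: 1, rule sum.cong) (simp_all only: 1)
    show ?thesis unfolding sum.insert[OF J] fun_upd_same a b ..
  qed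
  also have "\<dots> = (\<Sum>k\<in>J. \<Sum>l\<in>J. R k l * x k * x l) + (2 * (\<Sum>l\<in>J. R p l * x l)) * y + R p p * y\<^sup>2"
    unfolding sum.distrib 2 3 by (simp add: algebra_simps power2_eq_square)
  finally have E: "(\<Sum>k\<in>insert p J. \<Sum>l\<in>insert p J. R k l * (x(p := y)) k * (x(p := y)) l)
    = (\<Sum>k\<in>J. \<Sum>l\<in>J. R k l * x k * x l) + (2 * (\<Sum>l\<in>J. R p l * x l)) * y + R p p * y\<^sup>2" .
  have T: "(\<Sum>k\<in>insert p J. R k k) = R p p + (\<Sum>k\<in>J. R k k)" by (rule sum.insert[OF J])
  show ?thesis unfolding quad_centered_def E T by (simp add: algebra_simps)
qed

lemma quad_centered_measurable [measurable]:
  "quad_centered J R \<in> borel_measurable (GP J)"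
  unfolding quad_centered_def by measurable

text \<open>Adding the variable \<open>p\<close> contributes \<open>2 * sd^4 * (R p p)^2\<close>
  from the square term and \<open>4 * sd^4\<close> times the sum of the \<open>(R p l)^2\<close>
  from the linear term. By symmetry the latter covers row and column \<open>p\<close> together, so
  the factor stays at \<open>2 * sd^4\<close> over all entries.\<close>

lemma nn_integral_quad_centered_sq:
  assumes J: "finite J" and sym: "\<And>k l. R k l = R l k"
  shows "(\<integral>\<^sup>+x. ennreal ((quad_centered J R x)\<^sup>2) \<partial>GP J)
    = ennreal (2 * (sd\<^sup>2)\<^sup>2 * (\<Sum>k\<in>J. \<Sum>l\<in>J. (R k l)\<^sup>2))"
  using J
proof (induction J)
  case empty
  then show ?case by (simp add: quad_centered_def)
next
  case (insert p J)
  interpret product_prob_space "\<lambda>_. gauss sd" by (rule gauss_product_prob_space)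
  interpret PJ: prob_space "GP J" by (rule prob_space_PiM) (rule prob_space_gauss[OF sd])
  let ?L = "\<lambda>x. \<Sum>l\<in>J. R p l * x l"
  have "(\<integral>\<^sup>+x. ennreal ((quad_centered (insert p J) R x)\<^sup>2) \<partial>GP (insert p J))
    = (\<integral>\<^sup>+x. \<integral>\<^sup>+y. ennreal ((quad_centered (insert p J) R (x(p := y)))\<^sup>2) \<partial>gauss sd \<partial>GP J)"
    using insert.hyps by (intro product_nn_integral_insert) measurable
  also have "\<dots> = (\<integral>\<^sup>+x. ennreal ((quad_centered J R x)\<^sup>2) + ennreal (4 * sd\<^sup>2) * ennreal ((?L x)\<^sup>2) + ennreal (2 * (sd\<^sup>2)\<^sup>2 * (R p p)\<^sup>2) \<partial>GP J)"
    unfolding quad_centered_insert[OF insert.hyps sym] gauss_poly4(2)[OF sd]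
  proof (rule nn_integral_cong)
    fix x :: "'a \<Rightarrow> real"
    have "ennreal (4 * sd\<^sup>2) * ennreal ((?L x)\<^sup>2) = ennreal (sd\<^sup>2 * (2 * ?L x)\<^sup>2)"
      by (subst ennreal_mult[symmetric]) (auto simp: power_mult_distrib)
    then show "ennreal ((quad_centered J R x)\<^sup>2 + sd\<^sup>2 * (2 * ?L x)\<^sup>2 + 2 * (sd\<^sup>2)\<^sup>2 * (R p p)\<^sup>2)
      = ennreal ((quad_centered J R x)\<^sup>2) + ennreal (4 * sd\<^sup>2) * ennreal ((?L x)\<^sup>2) + ennreal (2 * (sd\<^sup>2)\<^sup>2 * (R p p)\<^sup>2)"
      by (simp only: ennreal_plus add_nonneg_nonneg zero_le_power2 mult_nonneg_nonneg zero_le_numeral)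
  qed
  also have "\<dots> = ennreal (2 * (sd\<^sup>2)\<^sup>2 * (\<Sum>k\<in>J. \<Sum>l\<in>J. (R k l)\<^sup>2)) + ennreal (4 * sd\<^sup>2) * ennreal (sd\<^sup>2 * (\<Sum>l\<in>J. (R p l)\<^sup>2)) + ennreal (2 * (sd\<^sup>2)\<^sup>2 * (R p p)\<^sup>2)"
    by (simp add: nn_integral_add nn_integral_cmult insert.IH nn_integral_gauss_linear_sq[OF insert.hyps(1)] PJ.emeasure_space_1)
  also have "\<dots> = ennreal (2 * (sd\<^sup>2)\<^sup>2 * (\<Sum>k\<in>J. \<Sum>l\<in>J. (R k l)\<^sup>2) + 4 * sd\<^sup>2 * (sd\<^sup>2 * (\<Sum>l\<in>J. (R p l)\<^sup>2)) + 2 * (sd\<^sup>2)\<^sup>2 * (R p p)\<^sup>2)"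
    by (subst ennreal_mult[symmetric], simp, simp add: sum_nonneg, (subst ennreal_plus[symmetric], (simp add: sum_nonneg; fail), (simp add: sum_nonneg; fail))+) simp
  also have "2 * (sd\<^sup>2)\<^sup>2 * (\<Sum>k\<in>J. \<Sum>l\<in>J. (R k l)\<^sup>2) + 4 * sd\<^sup>2 * (sd\<^sup>2 * (\<Sum>l\<in>J. (R p l)\<^sup>2)) + 2 * (sd\<^sup>2)\<^sup>2 * (R p p)\<^sup>2
    = 2 * (sd\<^sup>2)\<^sup>2 * (\<Sum>k\<in>insert p J. \<Sum>l\<in>insert p J. (R k l)\<^sup>2)"
  proof -
    have 1: "(\<Sum>k\<in>J. (R k p)\<^sup>2) = (\<Sum>l\<in>J. (R p l)\<^sup>2)"
      by (rule sum.cong[OF refl]) (simp only: sym[of _ p])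
    have 2: "(\<Sum>k\<in>insert p J. \<Sum>l\<in>insert p J. (R k l)\<^sup>2) = (\<Sum>k\<in>J. \<Sum>l\<in>J. (R k l)\<^sup>2) + 2 * (\<Sum>l\<in>J. (R p l)\<^sup>2) + (R p p)\<^sup>2"
      unfolding sum.insert[OF insert.hyps] sum.distrib 1 by simp
    show ?thesis unfolding 2 by (simp add: distrib_left power2_eq_square)
  qed
  finally show ?case .
qed

lemma quad_centered_mean:
  assumes J: "finite J" and sym: "\<And>k l. R k l = R l k"
  shows "integrable (GP J) (quad_centered J R)"
    and "(\<integral>x. quad_centered J R x \<partial>GP J) = 0"
proof -
  interpret product_prob_space "\<lambda>_. gauss sd" by (rule gauss_product_prob_space)
  have int: "integrable (GP J) (quad_centered J R)" if J: "finite J" for J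
  proof -
    interpret PJ: prob_space "GP J" by (rule prob_space_PiM) (rule prob_space_gauss[OF sd])
    have "integrable (GP J) (\<lambda>x. (quad_centered J R x)\<^sup>2)"
    proof (rule integrableI_nonneg)
      show "(\<lambda>x. (quad_centered J R x)\<^sup>2) \<in> borel_measurable (GP J)"
        by (intro borel_measurable_power quad_centered_measurable)
      show "(\<integral>\<^sup>+x. ennreal ((quad_centered J R x)\<^sup>2) \<partial>GP J) < \<infinity>"
        unfolding nn_integral_quad_centered_sq[where R = R, OF J sym] unfolding infinity_ennreal_def by (rule ennreal_less_top)
    qed (rule AE_I2, rule zero_le_power2)
    then show ?thesis by (rule PJ.square_integrable_imp_integrable[OF quad_centered_measurable])
  qed
  show "integrable (GP J) (quad_centered J R)" by (rule int[OF J])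
  show "(\<integral>x. quad_centered J R x \<partial>GP J) = 0"
    using J
  proof (induction J)
    case empty
    then show ?case by (simp add: quad_centered_def)
  next
    case (insert p J)
    have "integrable (GP (insert p J)) (quad_centered (insert p J) R)"
      by (rule int) (use insert.hyps in simp)
    from product_integral_insert[OF insert.hyps this]
    have "(\<integral>x. quad_centered (insert p J) R x \<partial>GP (insert p J))
      = (\<integral>x. quad_centered J R x \<partial>GP J)"
      unfolding quad_centered_insert[OF insert.hyps sym] gauss_poly4(1)[OF sd] .
    then show ?case unfolding insert.IH .
  qed
qed

end

text \<open>Integrating \<open>|X| <= X^2 / (2 * tau) + tau / 2\<close>, with the target bound as
  parameter, takes the place of the Cauchy-Schwarz inequality.\<close>

lemma (in prob_space) nn_integral_abs_le_sqrt:
  assumes [measurable]: "X \<in> borel_measurable M" and tau: "0 < tau"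
    and X2: "(\<integral>\<^sup>+x. ennreal ((X x)\<^sup>2) \<partial>M) \<le> ennreal (tau\<^sup>2)"
  shows "(\<integral>\<^sup>+x. ennreal \<bar>X x\<bar> \<partial>M) \<le> ennreal tau"
proof -
  have "ennreal \<bar>X x\<bar> \<le> ennreal (1 / (2 * tau)) * ennreal ((X x)\<^sup>2) + ennreal (tau / 2)" for x
  proof -
    have "0 \<le> (\<bar>X x\<bar> - tau)\<^sup>2" by simp
    then have "2 * tau * \<bar>X x\<bar> \<le> (X x)\<^sup>2 + tau\<^sup>2" by (simp add: power2_eq_square algebra_simps)
    then have "\<bar>X x\<bar> \<le> ((X x)\<^sup>2 + tau\<^sup>2) / (2 * tau)" using tau by (simp add: pos_le_divide_eq mult.commute)
    also have "\<dots> = 1 / (2 * tau) * (X x)\<^sup>2 + tau / 2" using tau by (simp add: add_divide_distrib power2_eq_square[of tau])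
    finally have "\<bar>X x\<bar> \<le> 1 / (2 * tau) * (X x)\<^sup>2 + tau / 2" .
    then show ?thesis using tau by (simp add: ennreal_mult[symmetric] ennreal_plus[symmetric] del: ennreal_plus)
  qed
  then have "(\<integral>\<^sup>+x. ennreal \<bar>X x\<bar> \<partial>M) \<le> (\<integral>\<^sup>+x. ennreal (1 / (2 * tau)) * ennreal ((X x)\<^sup>2) + ennreal (tau / 2) \<partial>M)"
    by (intro nn_integral_mono)
  also have "\<dots> = ennreal (1 / (2 * tau)) * (\<integral>\<^sup>+x. ennreal ((X x)\<^sup>2) \<partial>M) + ennreal (tau / 2)"
    by (simp add: nn_integral_add nn_integral_cmult emeasure_space_1)
  also have "\<dots> \<le> ennreal (1 / (2 * tau)) * ennreal (tau\<^sup>2) + ennreal (tau / 2)"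
    by (intro add_right_mono mult_left_mono X2) auto
  also have "\<dots> = ennreal tau"
    using tau by (simp add: ennreal_mult[symmetric] ennreal_plus[symmetric] power2_eq_square del: ennreal_plus)
  finally show ?thesis .
qed

section \<open>Measurability of resolvents\<close>

lemma measurable_det [measurable (raw)]:
  assumes A: "\<And>\<omega>. A \<omega> \<in> carrier_mat n n"
    and meas: "\<And>i j. i < n \<Longrightarrow> j < n \<Longrightarrow> (\<lambda>\<omega>. A \<omega> $$ (i,j)) \<in> borel_measurable N"
  shows "(\<lambda>\<omega>. det (A \<omega>) :: real) \<in> borel_measurable N"
proof -
  have "(\<lambda>\<omega>. \<Sum>p\<in>{p. p permutes {0..<n}}. signof p * (\<Prod>i\<in>{0..<n}. A \<omega> $$ (i, p i))) \<in> borel_measurable N"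
    by (intro borel_measurable_sum borel_measurable_times borel_measurable_const borel_measurable_prod meas)
      (auto dest: permutes_in_image)
  then show ?thesis by (simp add: det_def'[OF A])
qed

text \<open>The guard avoids singular matrices, where \<open>mat_inv\<close> is unspecified;
  elsewhere Cramer's rule makes the entry a quotient of determinants. For positive shifts of
  positive semidefinite matrices the guard never fires.\<close>

lemma measurable_mat_inv_entry:
  assumes A: "\<And>\<omega>. A \<omega> \<in> carrier_mat n n"
    and meas: "\<And>i j. i < n \<Longrightarrow> j < n \<Longrightarrow> (\<lambda>\<omega>. A \<omega> $$ (i,j)) \<in> borel_measurable N"
    and i: "i < n" and j: "j < n"
  shows "(\<lambda>\<omega>. if det (A \<omega>) = 0 then 0 else mat_inv (A \<omega>) $$ (i,j)) \<in> borel_measurable N"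
proof -
  have [measurable]: "(\<lambda>\<omega>. det (A \<omega>)) \<in> borel_measurable N" by (rule measurable_det[OF A meas])
  have [measurable]: "(\<lambda>\<omega>. det (mat_delete (A \<omega>) j i)) \<in> borel_measurable N"
  proof (rule measurable_det)
    show "mat_delete (A \<omega>) j i \<in> carrier_mat (n - 1) (n - 1)" for \<omega>
      using A by (rule mat_delete_carrier)
    fix k l assume kl: "k < n - 1" "l < n - 1"
    then have "mat_delete (A \<omega>) j i $$ (k,l) = A \<omega> $$ (if k < j then k else Suc k, if l < i then l else Suc l)" for \<omega>
      using A[of \<omega>] by (simp add: mat_delete_def)
    then show "(\<lambda>\<omega>. mat_delete (A \<omega>) j i $$ (k,l)) \<in> borel_measurable N"
      using kl by (simp add: meas)
  qed
  have "(if det (A \<omega>) = 0 then 0 else mat_inv (A \<omega>) $$ (i,j))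
    = (if det (A \<omega>) = 0 then 0 else 1 / det (A \<omega>) * ((-1) ^ (j + i) * det (mat_delete (A \<omega>) j i)))" for \<omega>
    using mat_inv_adj[OF A[of \<omega>]] A[of \<omega>] i j by (auto simp: adj_mat_def cofactor_def)
  then show ?thesis by simp
qed

lemma measurable_resolvent_entry:
  assumes A: "\<And>\<omega>. sym_psd_mat n (A \<omega>)" and x: "0 < x"
    and meas: "\<And>i j. i < n \<Longrightarrow> j < n \<Longrightarrow> (\<lambda>\<omega>. A \<omega> $$ (i,j)) \<in> borel_measurable N"
    and i: "i < n" and j: "j < n"
  shows "(\<lambda>\<omega>. resolvent n (A \<omega>) x $$ (i,j)) \<in> borel_measurable N"
proof -
  have "(\<lambda>\<omega>. if det (A \<omega> + x \<cdot>\<^sub>m 1\<^sub>m n) = 0 then 0 else mat_inv (A \<omega> + x \<cdot>\<^sub>m 1\<^sub>m n) $$ (i,j)) \<in> borel_measurable N"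
  proof (rule measurable_mat_inv_entry[OF _ _ i j])
    show "A \<omega> + x \<cdot>\<^sub>m 1\<^sub>m n \<in> carrier_mat n n" for \<omega> using sym_psd_matD(1)[OF A] by simp
    fix k l assume kl: "k < n" "l < n"
    have "(A \<omega> + x \<cdot>\<^sub>m 1\<^sub>m n) $$ (k,l) = A \<omega> $$ (k,l) + x * of_bool (k = l)" for \<omega>
      using sym_psd_matD(1)[OF A[of \<omega>]] kl by simp
    then show "(\<lambda>\<omega>. (A \<omega> + x \<cdot>\<^sub>m 1\<^sub>m n) $$ (k,l)) \<in> borel_measurable N" using meas[OF kl] by simp
  qed
  moreover have "det (A \<omega> + x \<cdot>\<^sub>m 1\<^sub>m n) \<noteq> 0" for \<omega>
    using psd_reg_pos[OF A x] by (simp add: psd_reg_def)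
  ultimately show ?thesis by (simp add: resolvent_def)
qed

lemma measurable_resolvent_tr:
  assumes A: "\<And>\<omega>. sym_psd_mat n (A \<omega>)" and x: "0 < x"
    and meas: "\<And>i j. i < n \<Longrightarrow> j < n \<Longrightarrow> (\<lambda>\<omega>. A \<omega> $$ (i,j)) \<in> borel_measurable N"
  shows "(\<lambda>\<omega>. mat_tr (resolvent n (A \<omega>) x)) \<in> borel_measurable N"
  unfolding resolvent_tr[OF psd_reg_pos[OF A x]]
  by (intro borel_measurable_sum measurable_resolvent_entry[OF A x meas]) auto

section \<open>Size bounds on entries, Frobenius norm and trace\<close>

lemma resolvent_diag_le:
  assumes A: "psd_reg n A x" and x: "0 < x" and i: "i < n"
  shows "resolvent n A x $$ (i,i) \<le> 1 / x"
proof -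
  let ?r = "resolvent n A x $$ (i,i)"
  have r0: "0 \<le> ?r" by (rule resolvent_diag_nonneg[OF A i])
  have "?r\<^sup>2 \<le> (\<Sum>j<n. (resolvent n A x $$ (i,j))\<^sup>2)" by (rule member_le_sum) (use i in auto)
  then have "x * ?r\<^sup>2 \<le> x * (\<Sum>j<n. (resolvent n A x $$ (i,j))\<^sup>2)" using x by simp
  also have "\<dots> \<le> ?r" by (rule resolvent_row_sq[OF A i])
  finally have "?r * (x * ?r) \<le> ?r * 1" by (simp add: power2_eq_square mult_ac)
  then have "x * ?r \<le> 1 \<or> ?r = 0" using r0 by (cases "?r = 0") (auto simp: mult_le_cancel_left)
  then show ?thesis using x by (auto simp: field_simps)
qed

lemma resolvent_sq_sum_le:
  assumes A: "psd_reg n A x" and x: "0 < x"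
  shows "(\<Sum>i<n. \<Sum>j<n. (resolvent n A x $$ (i,j))\<^sup>2) \<le> real n / x\<^sup>2"
proof -
  have "(\<Sum>j<n. (resolvent n A x $$ (i,j))\<^sup>2) \<le> 1 / x\<^sup>2" if i: "i < n" for i
  proof -
    have "x * (\<Sum>j<n. (resolvent n A x $$ (i,j))\<^sup>2) \<le> 1 / x"
      using resolvent_row_sq[OF A i] resolvent_diag_le[OF A x i] by linarith
    then show ?thesis using x by (simp add: field_simps power2_eq_square)
  qed
  then have "(\<Sum>i<n. \<Sum>j<n. (resolvent n A x $$ (i,j))\<^sup>2) \<le> real (card {..<n}) * (1 / x\<^sup>2)"
    by (intro sum_bounded_above) auto
  then show ?thesis by simp
qed

lemma resolvent_tr_le:
  assumes A: "psd_reg n A x" and x: "0 < x"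
  shows "mat_tr (resolvent n A x) \<le> real n / x"
  unfolding resolvent_tr[OF A]
  using sum_bounded_above[of "{..<n}" "\<lambda>i. resolvent n A x $$ (i,i)" "1 / x"] resolvent_diag_le[OF A x] by simp

section \<open>Sketches of diagonal matrices\<close>

text \<open>\<open>S diag(h) S^T\<close> with the entries of \<open>S\<close> in \<open>w\<close>.
  Since \<open>h\<close> is a function, a column is deleted by \<open>h(j := 0)\<close>, with all
  sizes, index sets and the law of \<open>w\<close> unchanged.\<close>

definition wgram :: "nat \<Rightarrow> nat \<Rightarrow> (nat \<Rightarrow> real) \<Rightarrow> (nat \<times> nat \<Rightarrow> real) \<Rightarrow> real mat" where
  "wgram m d h w = Matrix.mat m m (\<lambda>(k,l). \<Sum>j<d. h j * w (k,j) * w (l,j))"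

text \<open>\<open>S diag(sqrt h)\<close>: for nonnegative \<open>h\<close> its two Gram matrices
  are \<open>wgram\<close> and the d x d companion matrix.\<close>

definition wfactor :: "nat \<Rightarrow> nat \<Rightarrow> (nat \<Rightarrow> real) \<Rightarrow> (nat \<times> nat \<Rightarrow> real) \<Rightarrow> real mat" where
  "wfactor m d h w = Matrix.mat m d (\<lambda>(k,j). sqrt (h j) * w (k,j))"

lemma wgram_eq_factor:
  assumes h: "\<And>j. 0 \<le> h j"
  shows "wgram m d h w = wfactor m d h w * transpose_mat (wfactor m d h w)"
proof (rule eq_matI)
  fix i j assume "i < dim_row (wfactor m d h w * transpose_mat (wfactor m d h w))"
    "j < dim_col (wfactor m d h w * transpose_mat (wfactor m d h w))"
  then have ij: "i < m" "j < m" by (auto simp: wfactor_def)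
  have e: "sqrt (h l) * w (i,l) * (sqrt (h l) * w (j,l)) = h l * w (i,l) * w (j,l)" for l
  proof -
    have "sqrt (h l) * w (i,l) * (sqrt (h l) * w (j,l)) = (sqrt (h l) * sqrt (h l)) * w (i,l) * w (j,l)"
      by (simp only: mult_ac)
    then show ?thesis using h[of l] by simp
  qed
  show "wgram m d h w $$ (i,j) = (wfactor m d h w * transpose_mat (wfactor m d h w)) $$ (i,j)"
    using ij by (simp add: wgram_def wfactor_def scalar_prod_def atLeast0LessThan e[unfolded mult.assoc] mult.assoc)
qed (auto simp: wgram_def wfactor_def)

lemma wgram_psd:
  assumes h: "\<And>j. 0 \<le> h j"
  shows "sym_psd_mat m (wgram m d h w)"
  unfolding wgram_eq_factor[OF h] by (rule sym_psd_mat_gram[of _ m d]) (simp add: wfactor_def)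

lemma wgram_carrier [simp]: "wgram m d h w \<in> carrier_mat m m"
  by (simp add: wgram_def)

lemma mult_vec_rank_one_update:
  assumes A: "A \<in> carrier_mat n n" and A': "A' \<in> carrier_mat n n" and c: "c \<in> carrier_vec n"
    and v: "(v :: real vec) \<in> carrier_vec n"
    and eq: "\<And>i j. i < n \<Longrightarrow> j < n \<Longrightarrow> A' $$ (i,j) = A $$ (i,j) + h * c $ i * c $ j"
  shows "A' *\<^sub>v v = A *\<^sub>v v + (h * (c \<bullet> v)) \<cdot>\<^sub>v c"
proof (rule eq_vecI)
  fix i assume "i < dim_vec (A *\<^sub>v v + (h * (c \<bullet> v)) \<cdot>\<^sub>v c)"
  then have i: "i < n" using c by simp
  have "(\<Sum>j\<in>{0..<n}. A' $$ (i,j) * v $ j) = (\<Sum>j\<in>{0..<n}. A $$ (i,j) * v $ j + h * c $ i * (c $ j * v $ j))"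
    by (rule sum.cong) (use eq[OF i] in \<open>auto simp: algebra_simps\<close>)
  also have "\<dots> = (\<Sum>j\<in>{0..<n}. A $$ (i,j) * v $ j) + h * c $ i * (\<Sum>j\<in>{0..<n}. c $ j * v $ j)"
    by (simp add: sum.distrib sum_distrib_left)
  finally show "(A' *\<^sub>v v) $ i = (A *\<^sub>v v + (h * (c \<bullet> v)) \<cdot>\<^sub>v c) $ i"
    using i A A' c v by (simp add: scalar_prod_def)
qed (use A' c in simp)

lemma wgram_entry_remove_column:
  assumes "j < d" "k < m" "l < m"
  shows "wgram m d h w $$ (k,l) = wgram m d (h(j := 0)) w $$ (k,l) + h j * w (k,j) * w (l,j)"
proof -
  have "(\<Sum>i<d. (h(j := 0)) i * w (k,i) * w (l,i)) = (\<Sum>i\<in>{..<d} - {j}. h i * w (k,i) * w (l,i))"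
    using assms by (subst sum.remove[of _ j]) (auto intro!: sum.cong)
  moreover have "(\<Sum>i<d. h i * w (k,i) * w (l,i)) = h j * w (k,j) * w (l,j) + (\<Sum>i\<in>{..<d} - {j}. h i * w (k,i) * w (l,i))"
    using assms by (subst sum.remove[of _ j]) auto
  ultimately show ?thesis using assms by (simp add: wgram_def)
qed

text \<open>The leave-one-out form q_j: its matrix is the resolvent without column \<open>j\<close>,
  hence independent of the column at which it is evaluated.\<close>

definition col_quad :: "nat \<Rightarrow> nat \<Rightarrow> (nat \<Rightarrow> real) \<Rightarrow> real \<Rightarrow> (nat \<times> nat \<Rightarrow> real) \<Rightarrow> nat \<Rightarrow> real" where
  "col_quad m d h x w j = (\<Sum>k<m. \<Sum>l<m. resolvent m (wgram m d (h(j := 0)) w) x $$ (k,l) * w (k,j) * w (l,j))"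

definition res_tr :: "nat \<Rightarrow> nat \<Rightarrow> (nat \<Rightarrow> real) \<Rightarrow> real \<Rightarrow> (nat \<times> nat \<Rightarrow> real) \<Rightarrow> real" where
  "res_tr m d h x w = mat_tr (resolvent m (wgram m d h w) x)"

lemma quad_form_sum:
  assumes R: "R \<in> carrier_mat m m"
  shows "vec m f \<bullet> (R *\<^sub>v vec m f) = (\<Sum>k<m. \<Sum>l<m. R $$ (k,l) * f k * (f l :: real))"
  using R by (auto simp: scalar_prod_def sum_distrib_left atLeast0LessThan mult_ac intro!: sum.cong)

text \<open>The first claim is positivity of the resolvent. The others come from the rank-one update
  that puts column \<open>j\<close> back with weight \<open>h j\<close>.\<close>

lemma
  assumes h: "\<And>j. 0 \<le> h j" and x: "0 < x" and j: "j < d"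
  shows col_quad_nonneg: "0 \<le> col_quad m d h x w j"
    and col_quad_full: "(\<Sum>k<m. \<Sum>l<m. resolvent m (wgram m d h w) x $$ (k,l) * w (k,j) * w (l,j))
      = col_quad m d h x w j / (1 + h j * col_quad m d h x w j)"
    and res_tr_remove_column_ge: "res_tr m d h x w \<le> res_tr m d (h(j := 0)) x w"
    and res_tr_remove_column_le: "res_tr m d (h(j := 0)) x w \<le> res_tr m d h x w + 1 / x"
proof -
  have h': "0 \<le> (h(j := 0)) i" for i using h by simp
  let ?A = "wgram m d (h(j := 0)) w" and ?A' = "wgram m d h w"
  have A: "psd_reg m ?A x" by (rule psd_reg_pos[OF wgram_psd[of "h(j := 0)", OF h'] x])
  have A': "psd_reg m ?A' x" by (rule psd_reg_pos[OF wgram_psd[of h, OF h] x])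
  let ?c = "vec m (\<lambda>k. w (k,j))"
  have c: "?c \<in> carrier_vec m" by simp
  have upd: "?A' *\<^sub>v v = ?A *\<^sub>v v + (h j * (?c \<bullet> v)) \<cdot>\<^sub>v ?c" if "v \<in> carrier_vec m" for v
    by (rule mult_vec_rank_one_update[OF wgram_carrier wgram_carrier c that])
      (simp add: wgram_entry_remove_column[OF j, where h = h])
  have q: "?c \<bullet> (resolvent m ?A x *\<^sub>v ?c) = col_quad m d h x w j"
    unfolding quad_form_sum[OF resolvent_inv(1)[OF A]] col_quad_def ..
  show "0 \<le> col_quad m d h x w j" unfolding q[symmetric] by (rule resolvent_quad(2)[OF A c])
  note r1 = resolvent_tr_rank_one[OF A A' c h upd, unfolded q]
  show "(\<Sum>k<m. \<Sum>l<m. resolvent m ?A' x $$ (k,l) * w (k,j) * w (l,j))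
      = col_quad m d h x w j / (1 + h j * col_quad m d h x w j)"
    using r1(1) unfolding quad_form_sum[OF resolvent_inv(1)[OF A']] .
  show "res_tr m d h x w \<le> res_tr m d (h(j := 0)) x w" using r1(3) by (simp add: res_tr_def)
  show "res_tr m d (h(j := 0)) x w \<le> res_tr m d h x w + 1 / x"
  proof -
    have "x * (res_tr m d (h(j := 0)) x w - res_tr m d h x w) \<le> 1" using r1(2) by (simp add: res_tr_def)
    then have "res_tr m d (h(j := 0)) x w - res_tr m d h x w \<le> 1 / x" using x by (simp add: pos_le_divide_eq mult.commute)
    then show ?thesis by simp
  qed
qed

text \<open>Taking the trace of \<open>A R + x R = 1\<close> and expanding \<open>A\<close> into its
  rank-one columns leaves \<open>h j\<close> times the form of the full resolvent at column
  \<open>j\<close>; \<open>col_quad_full\<close> trades that for the resolvent without the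
  column.\<close>

lemma res_tr_identity:
  assumes h: "\<And>j. 0 \<le> h j" and x: "0 < x"
  shows "x * res_tr m d h x w + (\<Sum>j<d. h j * col_quad m d h x w j / (1 + h j * col_quad m d h x w j)) = real m"
proof -
  let ?A = "wgram m d h w"
  have A: "psd_reg m ?A x" by (rule psd_reg_pos[OF wgram_psd[of h, OF h] x])
  let ?R = "resolvent m ?A x"
  note R = resolvent_inv[OF A]
  have "mat_tr (?A * ?R) = (\<Sum>k<m. \<Sum>l<m. ?A $$ (k,l) * ?R $$ (l,k))"
    using R(1) by (auto simp: mat_tr_def scalar_prod_def atLeast0LessThan wgram_def intro!: sum.cong)
  also have "\<dots> = (\<Sum>k<m. \<Sum>l<m. \<Sum>j<d. h j * (?R $$ (k,l) * w (k,j) * w (l,j)))"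
  proof (intro sum.cong refl)
    fix k l assume "k \<in> {..<m}" "l \<in> {..<m}"
    then have kl: "k < m" "l < m" by auto
    have "?A $$ (k,l) = (\<Sum>j<d. h j * w (k,j) * w (l,j))" using kl by (simp add: wgram_def)
    then have "?A $$ (k,l) * ?R $$ (l,k) = (\<Sum>j<d. h j * w (k,j) * w (l,j)) * ?R $$ (k,l)"
      using resolvent_entry_sym[OF A kl] by simp
    also have "\<dots> = (\<Sum>j<d. h j * (?R $$ (k,l) * w (k,j) * w (l,j)))"
      unfolding sum_distrib_right by (rule sum.cong) (simp_all only: mult_ac)
    finally show "?A $$ (k,l) * ?R $$ (l,k) = (\<Sum>j<d. h j * (?R $$ (k,l) * w (k,j) * w (l,j)))" .
  qed
  also have "\<dots> = (\<Sum>k<m. \<Sum>j<d. \<Sum>l<m. h j * (?R $$ (k,l) * w (k,j) * w (l,j)))"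
    by (intro sum.cong refl sum.swap)
  also have "\<dots> = (\<Sum>j<d. \<Sum>k<m. \<Sum>l<m. h j * (?R $$ (k,l) * w (k,j) * w (l,j)))"
    by (rule sum.swap)
  also have "\<dots> = (\<Sum>j<d. h j * (\<Sum>k<m. \<Sum>l<m. ?R $$ (k,l) * w (k,j) * w (l,j)))"
    by (simp only: sum_distrib_left)
  also have "\<dots> = (\<Sum>j<d. h j * col_quad m d h x w j / (1 + h j * col_quad m d h x w j))"
  proof (rule sum.cong[OF refl])
    fix j assume "j \<in> {..<d}"
    then have j: "j < d" by simp
    show "h j * (\<Sum>k<m. \<Sum>l<m. ?R $$ (k,l) * w (k,j) * w (l,j)) = h j * col_quad m d h x w j / (1 + h j * col_quad m d h x w j)"
      unfolding col_quad_full[of h, OF h x j] by simp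
  qed
  finally show ?thesis using resolvent_tr_identity[OF A] by (simp add: res_tr_def)
qed

lemma wfactor_gram_entry:
  assumes "i < d" "j < d"
  shows "(transpose_mat (wfactor m d h w) * wfactor m d h w) $$ (i,j)
    = (\<Sum>k<m. sqrt (h i) * w (k,i) * (sqrt (h j) * w (k,j)))"
  using assms by (simp add: wfactor_def scalar_prod_def atLeast0LessThan)

text \<open>In the d x d companion a row change swaps one rank-one term for another. Both matrices
  are compared with the one whose row \<open>i\<close> is zero: both traces lie in the same window
  of width \<open>1 / x\<close> below its trace, which yields \<open>1 / x\<close> and not
  \<open>2 / x\<close>.\<close>

lemma res_tr_row_change:
  assumes h: "\<And>j. 0 \<le> h j" and x: "0 < x" and i: "i < m"
    and agree: "\<And>k j. k \<noteq> i \<Longrightarrow> w (k,j) = w' (k,j)"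
  shows "\<bar>res_tr m d h x w - res_tr m d h x w'\<bar> \<le> 1 / x"
proof -
  let ?Q = "\<lambda>w. transpose_mat (wfactor m d h w) * wfactor m d h w"
  have W: "wfactor m d h w \<in> carrier_mat m d" for w by (simp add: wfactor_def)
  have W': "transpose_mat (wfactor m d h w) \<in> carrier_mat d m" for w using W by simp
  have Q: "psd_reg d (?Q w) x" for w
    using psd_reg_pos[OF sym_psd_mat_gram[OF W'] x] by simp
  have push: "x * res_tr m d h x w = x * mat_tr (resolvent d (?Q w) x) + real m - real d" for w
    using resolvent_tr_push_through[OF W[of w] x] unfolding res_tr_def wgram_eq_factor[of h, OF h] by linarith
  define w0 where "w0 = (\<lambda>(k,j). if k = i then 0 else w (k,j))"
  have bounds: "x * mat_tr (resolvent d (?Q w0) x) - 1 \<le> x * mat_tr (resolvent d (?Q psi) x)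
      \<and> x * mat_tr (resolvent d (?Q psi) x) \<le> x * mat_tr (resolvent d (?Q w0) x)"
    if agree: "\<And>k j. k \<noteq> i \<Longrightarrow> psi (k,j) = w (k,j)" for psi
  proof -
    let ?c = "vec d (\<lambda>j. sqrt (h j) * psi (i,j))"
    have c: "?c \<in> carrier_vec d" by simp
    have upd: "?Q psi *\<^sub>v v = ?Q w0 *\<^sub>v v + (1 * (?c \<bullet> v)) \<cdot>\<^sub>v ?c" if v: "v \<in> carrier_vec d" for v
    proof (rule mult_vec_rank_one_update[OF _ _ c v])
      show "?Q w0 \<in> carrier_mat d d" by (rule mult_carrier_mat[OF W' W])
      show "?Q psi \<in> carrier_mat d d" by (rule mult_carrier_mat[OF W' W])
      fix a b assume ab: "a < d" "b < d"
      have "(\<Sum>k\<in>{..<m} - {i}. sqrt (h a) * psi (k,a) * (sqrt (h b) * psi (k,b))) = (\<Sum>k\<in>{..<m} - {i}. sqrt (h a) * w0 (k,a) * (sqrt (h b) * w0 (k,b)))"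
        by (rule sum.cong) (auto simp: w0_def agree)
      then show "?Q psi $$ (a,b) = ?Q w0 $$ (a,b) + 1 * ?c $ a * ?c $ b"
        unfolding wfactor_gram_entry[OF ab] using i ab
        by (subst (1 2) sum.remove[of "{..<m}" i]) (auto simp: w0_def)
    qed
    note r = resolvent_tr_rank_one[OF Q Q c _ upd]
    show ?thesis using r(2) r(3) x by (simp add: right_diff_distrib)
  qed
  have "\<bar>x * res_tr m d h x w - x * res_tr m d h x w'\<bar> \<le> 1"
    unfolding push abs_le_iff using bounds[of w, OF refl] bounds[of w', OF agree[symmetric]] by linarith
  then have "x * \<bar>res_tr m d h x w - res_tr m d h x w'\<bar> \<le> 1"
    using x by (simp add: abs_mult right_diff_distrib[symmetric])
  then show ?thesis using x by (simp add: pos_le_divide_eq mult.commute)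
qed

lemma res_tr_bounds:
  assumes h: "\<And>j. 0 \<le> h j" and x: "0 < x"
  shows "0 \<le> res_tr m d h x w" "res_tr m d h x w \<le> real m / x"
proof -
  have A: "psd_reg m (wgram m d h w) x" by (rule psd_reg_pos[OF wgram_psd[of h, OF h] x])
  show "0 \<le> res_tr m d h x w" unfolding res_tr_def by (rule resolvent_tr_nonneg[OF A])
  show "res_tr m d h x w \<le> real m / x" unfolding res_tr_def by (rule resolvent_tr_le[OF A x])
qed

section \<open>Mean and fluctuations of the resolvent trace\<close>

lemma gaussian_entries_eq: "gaussian_entries m d = PiM ({..<m} \<times> {..<d}) (\<lambda>_. gauss (1 / sqrt (real m)))"
  by (simp add: gaussian_entries_def)

lemma prob_space_gaussian_entries: "0 < m \<Longrightarrow> prob_space (gaussian_entries m d)"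
  unfolding gaussian_entries_eq by (intro prob_space_PiM prob_space_gauss) simp

lemma measurable_wgram_entry:
  assumes "k < m" "l < m"
  shows "(\<lambda>w. wgram m d h w $$ (k,l)) \<in> borel_measurable (gaussian_entries m d)"
proof -
  have "(\<lambda>w. \<Sum>j<d. h j * w (k,j) * w (l,j)) \<in> borel_measurable (PiM ({..<m} \<times> {..<d}) (\<lambda>_. gauss (1 / sqrt (real m))))"
    by (intro borel_measurable_sum borel_measurable_times borel_measurable_const)
      (use assms in \<open>auto intro!: measurable_component_singleton[where M = "\<lambda>_. gauss (1 / sqrt (real m))", simplified]\<close>)
  then show ?thesis using assms by (simp add: wgram_def gaussian_entries_eq)
qed

context
  fixes m d :: nat and h :: "nat \<Rightarrow> real" and x :: real
  assumes m: "0 < m" and h: "\<And>j. 0 \<le> h j" and x: "0 < x"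
begin

abbreviation "GS \<equiv> gaussian_entries m d"

lemma zero_column_nonneg: "0 \<le> (h(j := 0)) i"
  using h by simp

lemma res_tr_measurable [measurable]: "res_tr m d h x \<in> borel_measurable (GS)"
  unfolding res_tr_def[abs_def] by (rule measurable_resolvent_tr[OF wgram_psd[of h, OF h] x measurable_wgram_entry])

lemma res_tr_measurable' [measurable]: "res_tr m d (h(j := 0)) x \<in> borel_measurable (GS)"
  unfolding res_tr_def[abs_def] by (rule measurable_resolvent_tr[OF wgram_psd[of "h(j := 0)", OF zero_column_nonneg] x measurable_wgram_entry])

lemma col_quad_measurable [measurable]:
  assumes j: "j < d"
  shows "(\<lambda>w. col_quad m d h x w j) \<in> borel_measurable (GS)"
  unfolding col_quad_def
proof (intro borel_measurable_sum borel_measurable_times)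
  fix k l assume "k \<in> {..<m}" "l \<in> {..<m}"
  then have kl: "k < m" "l < m" by auto
  show "(\<lambda>w. resolvent m (wgram m d (h(j := 0)) w) x $$ (k,l)) \<in> borel_measurable (GS)"
    by (rule measurable_resolvent_entry[OF wgram_psd[of "h(j := 0)", OF zero_column_nonneg] x measurable_wgram_entry kl])
  show "(\<lambda>w. w (k,j)) \<in> borel_measurable (GS)" "(\<lambda>w. w (l,j)) \<in> borel_measurable (GS)"
    unfolding gaussian_entries_eq using kl j
    by (auto intro!: measurable_component_singleton[where M = "\<lambda>_. gauss (1 / sqrt (real m))", simplified])
qed

section \<open>Concentration of the trace around its mean\<close>

abbreviation "ET \<equiv> (\<integral>w. res_tr m d h x w \<partial>GS)"

text \<open>Bounded differences over the \<open>m\<close> rows, each of size \<open>1 / x\<close>,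
  give the variance proxy \<open>m / x^2\<close>. The sign \<open>u\<close> covers upper and lower
  deviations at once.\<close>

lemma res_tr_mgf:
  assumes \<theta>: "0 < \<theta>" and u: "\<bar>u\<bar> = 1"
  shows "(\<integral>\<^sup>+w. exp (\<theta> * (u * (res_tr m d h x w - ET))) \<partial>GS) \<le> ennreal (exp (\<theta>\<^sup>2 * (real m / x\<^sup>2) / 8))"
proof -
  let ?sd = "1 / sqrt (real m)"
  have sd: "0 < ?sd" using m by simp
  interpret product_prob_space "\<lambda>_ :: nat \<times> nat. gauss ?sd" by (rule gauss_product_prob_space[OF sd])
  have I: "(\<Union>i\<in>{..<m}. {i} \<times> {..<d}) = {..<m} \<times> {..<d}" by auto
  let ?F = "\<lambda>w. u * res_tr m d h x w"
  have "(\<integral>\<^sup>+w. exp (\<theta> * (?F w - (\<integral>w. ?F w \<partial>PiM (\<Union>i\<in>{..<m}. {i} \<times> {..<d}) (\<lambda>_. gauss ?sd)))) \<partial>PiM (\<Union>i\<in>{..<m}. {i} \<times> {..<d}) (\<lambda>_. gauss ?sd))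
    \<le> ennreal (exp (real (card {..<m}) * (\<theta>\<^sup>2 * (1 / x)\<^sup>2 / 8)))"
  proof (rule bounded_differences_mgf[OF _ _ _ _ _ _ \<theta>])
    show "disjoint_family_on (\<lambda>i. {i} \<times> {..<d}) {..<m}" by (auto simp: disjoint_family_on_def)
    show "?F \<in> borel_measurable (PiM (\<Union>i\<in>{..<m}. {i} \<times> {..<d}) (\<lambda>_. gauss ?sd))"
      unfolding I gaussian_entries_eq[symmetric] by measurable
    show "\<bar>?F w\<bar> \<le> real m / x" for w
      using res_tr_bounds[of h, OF h x, of m d w] u by (simp add: abs_mult)
    show "\<bar>?F w - ?F w'\<bar> \<le> 1 / x"
      if i: "i \<in> {..<m}" and agree: "\<And>p. p \<notin> {i} \<times> {..<d} \<Longrightarrow> w p = w' p" for i w w'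
    proof -
      have "\<bar>res_tr m d h x w - res_tr m d h x w'\<bar> \<le> 1 / x"
        by (rule res_tr_row_change[of h, OF h x, of i]) (use i agree in auto)
      then show ?thesis using u by (simp add: abs_mult flip: right_diff_distrib)
    qed
  qed auto
  then show ?thesis
    unfolding I gaussian_entries_eq[symmetric] by (simp add: right_diff_distrib power_divide mult.commute)
qed

lemma res_tr_integrable: "integrable (GS) (res_tr m d h x)"
proof -
  interpret prob_space "GS" by (rule prob_space_gaussian_entries[OF m])
  show ?thesis
    by (rule integrable_const_bound[of _ "real m / x"]) (use res_tr_bounds[of h, OF h x] in auto)
qed

lemma res_tr_integrable': "integrable (GS) (res_tr m d (h(j := 0)) x)"
proof -
  interpret prob_space "GS" by (rule prob_space_gaussian_entries[OF m])
  show ?thesis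
    by (rule integrable_const_bound[of _ "real m / x"]) (use res_tr_bounds[of "h(j := 0)", OF zero_column_nonneg x] in auto)
qed

lemma res_tr_tail:
  assumes t: "0 < t" and u: "\<bar>u\<bar> = 1"
  shows "measure (GS) {w \<in> space (GS). t \<le> u * (res_tr m d h x w - ET)}
    \<le> exp (- 2 * t\<^sup>2 * x\<^sup>2 / real m)"
proof -
  interpret prob_space "GS" by (rule prob_space_gaussian_entries[OF m])
  have V: "0 < real m / x\<^sup>2" using m x by simp
  have "prob {w \<in> space (GS). t \<le> u * (res_tr m d h x w - ET)} \<le> exp (- 2 * t\<^sup>2 / (real m / x\<^sup>2))"
    by (rule sub_gaussian_tail[OF _ V t]) (measurable, rule res_tr_mgf[OF _ u])
  then show ?thesis by simp
qed

lemma res_tr_mean_abs: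
  "(\<integral>w. \<bar>res_tr m d h x w - ET\<bar> \<partial>GS) \<le> 2 * sqrt (real m) / x"
proof -
  interpret prob_space "GS" by (rule prob_space_gaussian_entries[OF m])
  have V: "0 < real m / x\<^sup>2" using m x by simp
  have "(\<integral>\<^sup>+w. ennreal \<bar>res_tr m d h x w - ET\<bar> \<partial>GS) \<le> ennreal (2 * sqrt (real m / x\<^sup>2))"
    using res_tr_mgf[of _ 1] res_tr_mgf[of _ "-1"] by (intro sub_gaussian_mean_abs[OF _ V]) auto
  also have "sqrt (real m / x\<^sup>2) = sqrt (real m) / x" using x by (simp add: real_sqrt_divide)
  finally have "(\<integral>\<^sup>+w. ennreal \<bar>res_tr m d h x w - ET\<bar> \<partial>GS) \<le> ennreal (2 * (sqrt (real m) / x))" .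
  then have "ennreal (\<integral>w. \<bar>res_tr m d h x w - ET\<bar> \<partial>GS) \<le> ennreal (2 * (sqrt (real m) / x))"
    using res_tr_integrable by (subst nn_integral_eq_integral[symmetric]) auto
  then show ?thesis using x by (simp add: ennreal_le_iff)
qed

text \<open>Given the other columns, \<open>D\<close> is a centred Gaussian quadratic form with
  entry variance \<open>1 / m\<close> and matrix of squared Frobenius norm at most
  \<open>m / x^2\<close>; its conditional second moment is at most \<open>2 / m^2\<close> times that
  norm bound, uniformly in the condition.\<close>

lemma col_quad_deviation:
  assumes j: "j < d"
  defines "D \<equiv> \<lambda>w. col_quad m d h x w j - res_tr m d (h(j := 0)) x w / real m"
  shows "(\<integral>\<^sup>+w. ennreal ((D w)\<^sup>2) \<partial>GS) \<le> ennreal (2 / (real m * x\<^sup>2))"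
    and "integrable (GS) D"
    and "(\<integral>w. D w \<partial>GS) = 0"
proof -
  let ?sd = "1 / sqrt (real m)"
  let ?N = "\<lambda>_ :: nat \<times> nat. gauss ?sd"
  let ?h = "h(j := 0)"
  have sd: "0 < ?sd" using m by simp
  have sd2: "?sd\<^sup>2 = 1 / real m" by (simp add: power_divide)
  interpret product_prob_space ?N by (rule gauss_product_prob_space[OF sd])
  interpret G: prob_space "GS" by (rule prob_space_gaussian_entries[OF m])
  define U where "U = {..<m} \<times> ({..<d} - {j})"
  define V where "V = {..<m} \<times> {j}"
  interpret PU: prob_space "PiM U ?N" by (rule prob_space_PiM) (rule prob_space_gauss[OF sd])
  have UV: "U \<inter> V = {}" "finite U" "finite V" and I: "GS = PiM (U \<union> V) ?N"
    using j by (auto simp: U_def V_def gaussian_entries_eq intro!: arg_cong2[where f = PiM])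
  \<comment> \<open>Extended by zero so that symmetry holds at all pairs of indices, as the lemmas
    on quadratic forms demand.\<close>
  define R where "R = (\<lambda>a (p :: nat \<times> nat) (p' :: nat \<times> nat). if fst p < m \<and> fst p' < m
    then resolvent m (wgram m d ?h a) x $$ (fst p, fst p') else 0)"
  have reg: "psd_reg m (wgram m d ?h a) x" for a by (rule psd_reg_pos[OF wgram_psd[of ?h, OF zero_column_nonneg] x])
  have Rsym: "R a p p' = R a p' p" for a p p'
    using resolvent_entry_sym[OF reg] by (auto simp: R_def)
  have V_sum: "(\<Sum>p\<in>V. f p) = (\<Sum>k<m. f (k,j))" for f :: "nat \<times> nat \<Rightarrow> real"
  proof -
    have "V = (\<lambda>k. (k,j)) ` {..<m}" by (auto simp: V_def)
    then show ?thesis by (simp add: sum.reindex inj_on_def)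
  qed
  have D [measurable]: "D \<in> borel_measurable (GS)" unfolding D_def using j by measurable
  have key: "D (merge U V (a, b)) = quad_centered ?sd V (R a) b" for a b
  proof -
    have "wgram m d ?h (merge U V (a, b)) = wgram m d ?h a"
      unfolding wgram_def by (intro cong_mat refl) (auto intro!: sum.cong simp: merge_def U_def)
    moreover have "merge U V (a, b) (k,j) = b (k,j)" if "k < m" for k using that by (auto simp: merge_def U_def V_def)
    ultimately show ?thesis
      unfolding D_def quad_centered_def[OF sd] V_sum sd2 col_quad_def res_tr_def resolvent_tr[OF reg]
      by (simp add: R_def)
  qed
  have inner: "(\<integral>\<^sup>+b. ennreal ((D (merge U V (a, b)))\<^sup>2) \<partial>PiM V ?N) \<le> ennreal (2 / (real m * x\<^sup>2))" for a
  proof -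
    have "(\<Sum>p\<in>V. \<Sum>p'\<in>V. (R a p p')\<^sup>2) = (\<Sum>k<m. \<Sum>l<m. (resolvent m (wgram m d ?h a) x $$ (k,l))\<^sup>2)"
      unfolding V_sum by (simp add: R_def)
    also have "\<dots> \<le> real m / x\<^sup>2" by (rule resolvent_sq_sum_le[OF reg x])
    finally have "2 * (?sd\<^sup>2)\<^sup>2 * (\<Sum>p\<in>V. \<Sum>p'\<in>V. (R a p p')\<^sup>2) \<le> 2 * (?sd\<^sup>2)\<^sup>2 * (real m / x\<^sup>2)"
      by (intro mult_left_mono) auto
    also have "\<dots> = 2 / (real m * x\<^sup>2)" unfolding sd2 using m x by (simp add: power2_eq_square)
    finally show ?thesis
      unfolding key nn_integral_quad_centered_sq[where R = "R a", OF sd UV(3) Rsym] by (rule ennreal_leI)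
  qed
  have "(\<integral>\<^sup>+w. ennreal ((D w)\<^sup>2) \<partial>GS)
    = (\<integral>\<^sup>+a. \<integral>\<^sup>+b. ennreal ((D (merge U V (a, b)))\<^sup>2) \<partial>PiM V ?N \<partial>PiM U ?N)"
    unfolding I by (rule product_nn_integral_fold[OF UV]) (use D I in simp)
  also have "\<dots> \<le> (\<integral>\<^sup>+a. ennreal (2 / (real m * x\<^sup>2)) \<partial>PiM U ?N)" by (intro nn_integral_mono inner)
  also have "\<dots> = ennreal (2 / (real m * x\<^sup>2))" by (simp add: PU.emeasure_space_1)
  finally show 1: "(\<integral>\<^sup>+w. ennreal ((D w)\<^sup>2) \<partial>GS) \<le> ennreal (2 / (real m * x\<^sup>2))" .
  have "integrable (GS) (\<lambda>w. (D w)\<^sup>2)"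
  proof (rule integrableI_nonneg)
    show "(\<integral>\<^sup>+w. ennreal ((D w)\<^sup>2) \<partial>GS) < \<infinity>"
      using 1 by (rule le_less_trans) simp
  qed auto
  then show int: "integrable (GS) D" by (rule G.square_integrable_imp_integrable[OF D])
  have "(\<integral>w. D w \<partial>GS) = (\<integral>a. \<integral>b. D (merge U V (a, b)) \<partial>PiM V ?N \<partial>PiM U ?N)"
    unfolding I by (rule product_integral_fold[OF UV int[unfolded I]])
  also have "\<dots> = 0" unfolding key quad_centered_mean(2)[where R = "R _", OF sd UV(3) Rsym] by simp
  finally show "(\<integral>w. D w \<partial>GS) = 0" .
qed

lemma col_quad_mean_abs:
  assumes j: "j < d"
  shows "(\<integral>w. \<bar>col_quad m d h x w j - res_tr m d (h(j := 0)) x w / real m\<bar> \<partial>GS) \<le> 2 / (x * sqrt (real m))"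
proof -
  interpret prob_space "GS" by (rule prob_space_gaussian_entries[OF m])
  note D = col_quad_deviation[OF j]
  \<comment> \<open>\<open>sqrt 2\<close> is rounded up to 2, so that this bound equals the one of
    \<open>res_tr_mean_abs\<close> after division by \<open>m\<close>; together they give the 4 in
    \<open>mean_lower\<close>.\<close>
  let ?tau = "2 / (x * sqrt (real m))"
  have tau: "0 < ?tau" using x m by simp
  have "2 / (real m * x\<^sup>2) \<le> ?tau\<^sup>2" using m x by (simp add: power_divide power_mult_distrib mult.commute divide_right_mono)
  then have "(\<integral>\<^sup>+w. ennreal ((col_quad m d h x w j - res_tr m d (h(j := 0)) x w / real m)\<^sup>2) \<partial>GS) \<le> ennreal (?tau\<^sup>2)"
    using D(1) by (meson ennreal_leI order.trans)
  from nn_integral_abs_le_sqrt[OF borel_measurable_integrable[OF D(2)] tau this]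
  have "ennreal (\<integral>w. \<bar>col_quad m d h x w j - res_tr m d (h(j := 0)) x w / real m\<bar> \<partial>GS) \<le> ennreal ?tau"
    using D(2) by (subst nn_integral_eq_integral[symmetric]) auto
  then show ?thesis using tau by (simp add: ennreal_le_iff)
qed

lemma col_quad_integrable:
  assumes j: "j < d"
  shows "integrable (GS) (\<lambda>w. col_quad m d h x w j)"
    and "(\<integral>w. col_quad m d h x w j \<partial>GS) = (\<integral>w. res_tr m d (h(j := 0)) x w \<partial>GS) / real m"
proof -
  note D = col_quad_deviation[OF j]
  have i: "integrable (GS) (\<lambda>w. res_tr m d (h(j := 0)) x w / real m)"
    using res_tr_integrable' by simp
  have e: "col_quad m d h x w j = (col_quad m d h x w j - res_tr m d (h(j := 0)) x w / real m) + res_tr m d (h(j := 0)) x w / real m" for w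
    by simp
  show "integrable (GS) (\<lambda>w. col_quad m d h x w j)"
    by (subst e) (rule Bochner_Integration.integrable_add[OF D(2) i])
  show "(\<integral>w. col_quad m d h x w j \<partial>GS) = (\<integral>w. res_tr m d (h(j := 0)) x w \<partial>GS) / real m"
    by (subst e, subst Bochner_Integration.integral_add[OF D(2) i]) (simp add: D(3))
qed

section \<open>The averaged trace identity and its two comparisons with a deterministic
  level\<close>

abbreviation "sat j q \<equiv> h j * q / (1 + h j * q)"

lemma sat_integrable:
  assumes j: "j < d"
  shows "integrable (GS) (\<lambda>w. sat j (col_quad m d h x w j))"
proof -
  interpret prob_space "GS" by (rule prob_space_gaussian_entries[OF m])
  have "norm (sat j (col_quad m d h x w j)) \<le> 1" for w
  proof -
    have "0 \<le> h j * col_quad m d h x w j" using h col_quad_nonneg[of h, OF h x j] by simp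
    then show ?thesis by simp
  qed
  then show ?thesis using j by (intro integrable_const_bound[of _ 1]) auto
qed

lemma mean_identity:
  "real m = x * ET + (\<Sum>j<d. \<integral>w. sat j (col_quad m d h x w j) \<partial>GS)"
proof -
  interpret prob_space "GS" by (rule prob_space_gaussian_entries[OF m])
  have "real m = (\<integral>w. x * res_tr m d h x w + (\<Sum>j<d. sat j (col_quad m d h x w j)) \<partial>GS)"
    unfolding res_tr_identity[of h, OF h x] by (simp add: prob_space)
  also have "\<dots> = (\<integral>w. x * res_tr m d h x w \<partial>GS) + (\<integral>w. (\<Sum>j<d. sat j (col_quad m d h x w j)) \<partial>GS)"
    by (intro Bochner_Integration.integral_add Bochner_Integration.integrable_sum sat_integrable) (auto simp: res_tr_integrable)
  also have "(\<integral>w. (\<Sum>j<d. sat j (col_quad m d h x w j)) \<partial>GS) = (\<Sum>j<d. \<integral>w. sat j (col_quad m d h x w j) \<partial>GS)"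
    by (intro Bochner_Integration.integral_sum sat_integrable) auto
  finally show ?thesis by simp
qed

lemma ET_bounds: "0 \<le> ET"
  by (rule Bochner_Integration.integral_nonneg) (rule res_tr_bounds(1)[of h, OF h x])

text \<open>Jensen's inequality, through the tangent of the concave function \<open>q \<mapsto> h q / (1 + h q)\<close>.\<close>

lemma mean_upper: "real m \<le> x * ET + (\<Sum>j<d. sat j (ET / real m + 1 / (real m * x)))"
proof -
  interpret prob_space "GS" by (rule prob_space_gaussian_entries[OF m])
  \<comment> \<open>The second term pays for the increase of the trace when a column is deleted, so
    \<open>s\<close> dominates the mean of every \<open>col_quad\<close>.\<close>
  define s where "s = ET / real m + 1 / (real m * x)"
  have s: "0 \<le> s" using ET_bounds m x by (simp add: s_def)
  have "(\<integral>w. sat j (col_quad m d h x w j) \<partial>GS) \<le> sat j s" if j: "j < d" for j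
  proof -
    let ?g = "h j / (1 + h j * s)\<^sup>2"
    have g: "0 \<le> ?g" using h by simp
    have tangent: "sat j q \<le> sat j s + ?g * (q - s)" if q: "0 \<le> q" for q
    proof -
      have a: "0 < 1 + h j * q" "0 < 1 + h j * s" using h[of j] q s by (auto intro: add_pos_nonneg)
      have "sat j s + ?g * (q - s) - sat j q = (h j * (q - s))\<^sup>2 / ((1 + h j * s)\<^sup>2 * (1 + h j * q))"
        using a by (simp add: divide_simps) (simp add: algebra_simps power2_eq_square)
      also have "\<dots> \<ge> 0" using a by simp
      finally show ?thesis by simp
    qed
    have "(\<integral>w. sat j (col_quad m d h x w j) \<partial>GS) \<le> (\<integral>w. sat j s + ?g * (col_quad m d h x w j - s) \<partial>GS)"
      by (intro integral_mono sat_integrable j tangent col_quad_nonneg[of h, OF h x j])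
        (use col_quad_integrable[OF j] in auto)
    also have "\<dots> = sat j s + ?g * ((\<integral>w. col_quad m d h x w j \<partial>GS) - s)"
      using col_quad_integrable[OF j] by (simp add: prob_space)
    also have "\<dots> \<le> sat j s"
    proof -
      have "(\<integral>w. res_tr m d (h(j := 0)) x w \<partial>GS) \<le> (\<integral>w. res_tr m d h x w + 1 / x \<partial>GS)"
        by (intro integral_mono res_tr_integrable' res_tr_remove_column_le[of h, OF h x j])
          (use res_tr_integrable in auto)
      also have "\<dots> = ET + 1 / x" using res_tr_integrable by (simp add: prob_space)
      finally have "(\<integral>w. col_quad m d h x w j \<partial>GS) \<le> (ET + 1 / x) / real m"
        unfolding col_quad_integrable(2)[OF j] by (intro divide_right_mono) auto
      also have "\<dots> = s" using m by (simp add: s_def add_divide_distrib mult.commute)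
      finally have "(\<integral>w. col_quad m d h x w j \<partial>GS) - s \<le> 0" by simp
      from mult_nonneg_nonpos[OF g this] show ?thesis by linarith
    qed
    finally show ?thesis .
  qed
  then have "(\<Sum>j<d. \<integral>w. sat j (col_quad m d h x w j) \<partial>GS) \<le> (\<Sum>j<d. sat j s)"
    by (intro sum_mono) auto
  then show ?thesis using mean_identity by (simp add: s_def)
qed

text \<open>Any level \<open>s\<close> up to the normalised mean trace is allowed, so that an
  explicit candidate near \<open>1 / lam\<close> can be inserted. The weight
  \<open>h j / (1 + h j * s)\<close> of the loss is what lets its sum be controlled by the effective
  dimension.\<close>

lemma mean_lower:
  assumes s: "0 \<le> s" "real m * s \<le> ET"
  shows "x * ET + (\<Sum>j<d. sat j s - h j / (1 + h j * s) * (4 / (x * sqrt (real m)))) \<le> real m"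
proof -
  interpret prob_space "GS" by (rule prob_space_gaussian_entries[OF m])
  have "sat j s - h j / (1 + h j * s) * (4 / (x * sqrt (real m))) \<le> (\<integral>w. sat j (col_quad m d h x w j) \<partial>GS)" if j: "j < d" for j
  proof -
    let ?g = "h j / (1 + h j * s)"
    have hs: "0 \<le> h j * s" using h[of j] s by simp
    have g: "0 \<le> ?g" using h[of j] hs by simp
    let ?D = "\<lambda>w. \<bar>col_quad m d h x w j - res_tr m d (h(j := 0)) x w / real m\<bar>"
    let ?E = "\<lambda>w. \<bar>res_tr m d h x w - ET\<bar> / real m"
    have chord: "sat j s - ?g * (?D w + ?E w) \<le> sat j (col_quad m d h x w j)" for w
    proof -
      define q where "q = col_quad m d h x w j"
      have q: "0 \<le> q" unfolding q_def by (rule col_quad_nonneg[of h, OF h x j])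
      then have hq: "0 \<le> h j * q" using h[of j] by simp
      have diff: "sat j s - sat j q = ?g * (s - q) / (1 + h j * q)"
        using hs hq by (simp add: divide_simps) (simp add: algebra_simps)
      have DE: "0 \<le> ?D w + ?E w" by simp
      have "?g * (s - q) / (1 + h j * q) \<le> ?g * (?D w + ?E w)"
      proof (cases "q \<le> s")
        case True
        then have p: "0 \<le> ?g * (s - q)" by (intro mult_nonneg_nonneg g) simp
        have "?g * (s - q) / (1 + h j * q) \<le> ?g * (s - q) / 1"
          by (rule divide_left_mono) (use p hq in auto)
        then have "?g * (s - q) / (1 + h j * q) \<le> ?g * (s - q)" by simp
        \<comment> \<open>Deleting a column only raises the trace, so passing to the trace without
          column \<open>j\<close> costs nothing in this direction.\<close>
        also have "s - q \<le> ?D w + ?E w"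
        proof -
          have "s \<le> ET / real m" using s m by (simp add: pos_le_divide_eq mult.commute)
          moreover have "res_tr m d h x w / real m \<le> res_tr m d (h(j := 0)) x w / real m"
            by (intro divide_right_mono res_tr_remove_column_ge[of h, OF h x j]) simp
          moreover have "ET / real m - res_tr m d h x w / real m \<le> ?E w"
            unfolding diff_divide_distrib[symmetric] by (intro divide_right_mono) auto
          moreover have "res_tr m d (h(j := 0)) x w / real m - q \<le> ?D w" by (simp add: q_def)
          ultimately show ?thesis by linarith
        qed
        then have "?g * (s - q) \<le> ?g * (?D w + ?E w)" using g by (rule mult_left_mono)
        finally show ?thesis .
      next
        case False
        then have "?g * (s - q) \<le> 0" by (intro mult_nonneg_nonpos g) simp
        then have "?g * (s - q) / (1 + h j * q) \<le> 0" by (rule divide_nonpos_pos) (use hq in simp)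
        then show ?thesis using mult_nonneg_nonneg[OF g DE] by linarith
      qed
      then show ?thesis using diff unfolding q_def by linarith
    qed
    have iD: "integrable (GS) ?D" using col_quad_deviation(2)[OF j] by simp
    have iE: "integrable (GS) ?E" using res_tr_integrable by simp
    have ED: "(\<integral>w. ?D w \<partial>GS) \<le> 2 / (x * sqrt (real m))" by (rule col_quad_mean_abs[OF j])
    have "(\<integral>w. ?E w \<partial>GS) = (\<integral>w. \<bar>res_tr m d h x w - ET\<bar> \<partial>GS) / real m" by simp
    also have "\<dots> \<le> (2 * sqrt (real m) / x) / real m" by (intro divide_right_mono res_tr_mean_abs) simp
    also have "\<dots> = 2 / (x * sqrt (real m))"
    proof -
      have "real m = sqrt (real m) * sqrt (real m)" by simp
      then show ?thesis using m x by (simp add: field_simps)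
    qed
    finally have EE: "(\<integral>w. ?E w \<partial>GS) \<le> 2 / (x * sqrt (real m))" .
    have "(\<integral>w. ?D w + ?E w \<partial>GS) \<le> 4 / (x * sqrt (real m))"
      unfolding Bochner_Integration.integral_add[OF iD iE] using add_mono[OF ED EE]
      by (simp flip: add_divide_distrib)
    then have "sat j s - ?g * (4 / (x * sqrt (real m))) \<le> sat j s - ?g * (\<integral>w. ?D w + ?E w \<partial>GS)"
      using g by (intro diff_left_mono mult_left_mono)
    also have "\<dots> = (\<integral>w. sat j s - ?g * (?D w + ?E w) \<partial>GS)"
    proof -
      have i: "integrable (GS) (\<lambda>w. ?g * (?D w + ?E w))"
        by (intro integrable_mult_right Bochner_Integration.integrable_add iD iE)
      show ?thesis
        by (subst Bochner_Integration.integral_diff[OF _ i]) (simp_all add: prob_space)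
    qed
    also have "\<dots> \<le> (\<integral>w. sat j (col_quad m d h x w j) \<partial>GS)"
    proof (rule integral_mono[OF _ sat_integrable[OF j] chord])
      show "integrable (GS) (\<lambda>w. sat j s - ?g * (?D w + ?E w))"
        by (intro Bochner_Integration.integrable_diff integrable_mult_right Bochner_Integration.integrable_add iD iE) simp
    qed
    finally show ?thesis .
  qed
  then have "(\<Sum>j<d. sat j s - h j / (1 + h j * s) * (4 / (x * sqrt (real m)))) \<le> (\<Sum>j<d. \<integral>w. sat j (col_quad m d h x w j) \<partial>GS)"
    by (intro sum_mono) auto
  then show ?thesis using mean_identity by linarith
qed

end

section \<open>Bracketing the root\<close>

text \<open>Only traces at two fixed shifts occur, so the event is measurable and its probability
  depends only on the law of \<open>A\<close>. The threshold is the level \<open>1 / lam\<close>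
  before division by \<open>m\<close>.\<close>

definition brackets :: "nat \<Rightarrow> real \<Rightarrow> real \<Rightarrow> real \<Rightarrow> real mat \<Rightarrow> bool" where
  "brackets m lam a b A \<longleftrightarrow> real m / lam < mat_tr (resolvent m A a) \<and> mat_tr (resolvent m A b) < real m / lam"

text \<open>At the level \<open>rho / lam\<close> the summand is
  \<open>h * rho / (lam + h * rho)\<close>. It is compared with its value at \<open>rho = 1\<close>,
  the summand of the effective dimension, up to a factor that does not depend on
  \<open>h\<close>.\<close>

lemma saturation_scale:
  fixes h lam rho :: real
  assumes h: "0 \<le> h" and lam: "0 < lam" and rho: "0 < rho"
  shows "h * (rho / lam) / (1 + h * (rho / lam)) \<le> max 1 rho * (h / (h + lam))"
    and "min 1 rho * (h / (h + lam)) \<le> h * (rho / lam) / (1 + h * (rho / lam))"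
proof -
  have p: "0 < lam + h * rho" "0 < h + lam" using assms by (auto intro: add_pos_nonneg add_nonneg_pos)
  have e: "h * (rho / lam) / (1 + h * (rho / lam)) = h * rho / (lam + h * rho)"
    using p lam by (simp add: field_simps)
  show "h * (rho / lam) / (1 + h * (rho / lam)) \<le> max 1 rho * (h / (h + lam))"
  proof (cases "1 \<le> rho")
    case True
    have "h * rho / (lam + h * rho) \<le> h * rho / (h + lam)"
      using True assms p by (intro divide_left_mono) (auto simp: mult_le_cancel_left1)
    then show ?thesis unfolding e using True by (simp add: mult.commute)
  next
    case False
    have "h * (rho * (h + lam)) \<le> h * (lam + h * rho)"
      using False assms by (intro mult_left_mono) (auto simp: distrib_left mult_le_cancel_right1 mult.commute)
    then have "h * rho / (lam + h * rho) \<le> h / (h + lam)" using p by (simp add: divide_simps mult_ac)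
    then show ?thesis unfolding e using False by simp
  qed
  show "min 1 rho * (h / (h + lam)) \<le> h * (rho / lam) / (1 + h * (rho / lam))"
  proof (cases "1 \<le> rho")
    case True
    have "h * (lam + h * rho) \<le> h * (rho * (h + lam))"
      using True assms by (intro mult_left_mono) (auto simp: distrib_left mult_le_cancel_right1 mult.commute)
    then have "h / (h + lam) \<le> h * rho / (lam + h * rho)" using p by (simp add: divide_simps mult_ac)
    then show ?thesis unfolding e using True by simp
  next
    case False
    have "h * rho / (h + lam) \<le> h * rho / (lam + h * rho)"
      using False assms p by (intro divide_left_mono) (auto simp: mult_le_cancel_left2)
    then show ?thesis unfolding e using False by (simp add: mult.commute)
  qed
qed

lemma exp_le_half:
  fixes \<delta> y :: real
  assumes \<delta>: "0 < \<delta>" and y: "1 + ln (1 / \<delta>) \<le> y"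
  shows "exp (- y) \<le> \<delta> / 2"
proof -
  have "exp (- y) \<le> exp (- 1 - ln (1 / \<delta>))" using y by simp
  also have "\<dots> = \<delta> / exp 1" using \<delta> by (simp add: exp_diff ln_div exp_add[symmetric] exp_minus field_simps)
  also have "\<dots> \<le> \<delta> / 2" using \<delta> exp_ge_add_one_self[of 1] by (intro divide_left_mono) auto
  finally show ?thesis .
qed

section \<open>Diagonal case: the mean trace at both ends of the bracket\<close>

context
  fixes m d :: nat and h :: "nat \<Rightarrow> real" and lam \<epsilon> \<delta> D lt :: real
  assumes m: "0 < m" and h: "\<And>j. 0 \<le> h j" and lam: "0 < lam" and \<epsilon>: "0 < \<epsilon>" "\<epsilon> \<le> 1 / 2"
    and \<delta>: "0 < \<delta>" "\<delta> < 1"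
    and D: "D = (\<Sum>j<d. h j / (h j + lam)) / real m" "D \<le> 2 / 3"
    and lt: "lt = lam * (1 - D)"
    and big: "10816 * (1 + ln (1 / \<delta>)) \<le> real m * \<epsilon>\<^sup>2"
begin

lemma shifted_lam_ge: "lam / 3 \<le> lt"
proof -
  have "lam * (1 / 3) \<le> lam * (1 - D)" using lam D(2) by (intro mult_left_mono) auto
  then show ?thesis by (simp add: lt)
qed

lemma D_nonneg: "0 \<le> D"
  unfolding D using h lam by (intro divide_nonneg_nonneg sum_nonneg) (auto intro: add_nonneg_nonneg)

lemma sum_saturation: "(\<Sum>j<d. h j / (h j + lam)) = real m * D"
  using m by (simp add: D)

lemma m_eps_sq_ge: "10816 \<le> real m * \<epsilon>\<^sup>2"
proof -
  have "0 \<le> ln (1 / \<delta>)" using \<delta> by simp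
  then have "10816 * (1 :: real) \<le> 10816 * (1 + ln (1 / \<delta>))" by (intro mult_left_mono) auto
  then show ?thesis using order.trans[OF _ big] by simp
qed

text \<open>With \<open>x \<ge> lam / 6\<close>, the value 72 brings the column-removal shift
  \<open>lam / (m x)\<close> below \<open>\<epsilon> / 12\<close> in
  \<open>mean_at_lower\<close>.\<close>

lemma m_eps_ge: "72 \<le> real m * \<epsilon>"
proof -
  have "real m * \<epsilon>\<^sup>2 \<le> real m * \<epsilon>"
    using \<epsilon> by (intro mult_left_mono) (auto simp: power2_eq_square mult_le_cancel_left2)
  then show ?thesis using m_eps_sq_ge by linarith
qed

text \<open>\<open>10816\<close> is the square of 104, and 104 is what brings the replacement loss
  in \<open>mean_at_upper\<close>, before division by \<open>1 - t\<close>, down to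
  \<open>\<epsilon> / 13\<close>.\<close>

lemma sqrt_m_eps_ge: "104 \<le> sqrt (real m) * \<epsilon>"
proof -
  have "sqrt 10816 \<le> sqrt (real m * \<epsilon>\<^sup>2)" by (rule real_sqrt_le_mono[OF m_eps_sq_ge])
  moreover have "sqrt 10816 = (104::real)" by (rule real_sqrt_unique) auto
  ultimately show ?thesis using \<epsilon> by (simp add: real_sqrt_mult)
qed

text \<open>\<open>mean_upper\<close> becomes \<open>1 \<le> X * rho + max 1 rho * D\<close> with
  \<open>X = x / lam\<close>. Since \<open>X + D\<close> falls short of 1 by
  \<open>\<epsilon> * (1 - D)\<close>, at least \<open>\<epsilon> / 3\<close>, the factor
  \<open>rho\<close> must make up for it and be at least \<open>1 + \<epsilon> / 3\<close>.\<close>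

lemma mean_at_lower:
  defines "x \<equiv> (1 - \<epsilon>) * lt"
  shows "lam / 6 \<le> x"
    and "real m / lam * (1 + \<epsilon> / 4) \<le> (\<integral>w. res_tr m d h x w \<partial>gaussian_entries m d)"
proof -
  have "1 / 2 * (lam / 3) \<le> (1 - \<epsilon>) * lt" using \<epsilon> shifted_lam_ge lam by (intro mult_mono) auto
  then show x6: "lam / 6 \<le> x" by (simp add: x_def)
  then have x: "0 < x" using lam by simp
  define s where "s = (\<integral>w. res_tr m d h x w \<partial>gaussian_entries m d) / real m"
  define rho where "rho = lam * (s + 1 / (real m * x))"
  have s0: "0 \<le> s" using ET_bounds[of m h x d, OF m h x] m by (simp add: s_def)
  have rho: "0 < rho" unfolding rho_def using lam s0 m x by (intro mult_pos_pos add_nonneg_pos) auto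
  have rhol: "s + 1 / (real m * x) = rho / lam" using lam by (simp add: rho_def)
  define X where "X = (1 - \<epsilon>) * (1 - D)"
  have X: "0 \<le> X" "x = lam * X" using \<epsilon> D(2) by (auto simp: X_def x_def lt)
  have "real m \<le> x * (real m * s) + (\<Sum>j<d. h j * (rho / lam) / (1 + h j * (rho / lam)))"
    using mean_upper[of m h x d, OF m h x] m unfolding rhol[symmetric] s_def by simp
  also have "\<dots> \<le> x * (real m * s) + (\<Sum>j<d. max 1 rho * (h j / (h j + lam)))"
    by (intro add_left_mono sum_mono saturation_scale(1) h lam rho)
  also have "\<dots> = real m * (x * s + max 1 rho * D)"
    unfolding sum_distrib_left[symmetric] sum_saturation by (simp add: algebra_simps)
  finally have "1 \<le> x * s + max 1 rho * D" using m by (simp add: mult_le_cancel_left1)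
  also have "x * s \<le> x * (rho / lam)" unfolding rhol[symmetric] using x m by (intro mult_left_mono) auto
  also have "x * (rho / lam) = X * rho" using lam X(2) by simp
  finally have main: "1 \<le> X * rho + max 1 rho * D" by simp
  have XD: "X + D \<le> 1 - \<epsilon> / 3"
  proof -
    have "\<epsilon> * (1 / 3) \<le> \<epsilon> * (1 - D)" using \<epsilon> D(2) by (intro mult_left_mono) auto
    then show ?thesis by (simp add: X_def algebra_simps)
  qed
  have "1 + \<epsilon> / 3 \<le> rho"
  proof (rule ccontr)
    assume c: "\<not> ?thesis"
    have "X * rho + max 1 rho * D \<le> max 1 rho * (X + D)"
      using mult_left_mono[OF max.cobounded2 X(1), of rho 1] by (simp add: algebra_simps)
    also have "\<dots> \<le> (1 + \<epsilon> / 3) * (X + D)"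
      using c \<epsilon> X(1) D_nonneg by (intro mult_right_mono) auto
    also have "\<dots> \<le> (1 + \<epsilon> / 3) * (1 - \<epsilon> / 3)" using XD \<epsilon> by (intro mult_left_mono) auto
    also have "\<dots> < 1" using \<epsilon> by (simp add: algebra_simps)
    finally show False using main by simp
  qed
  \<comment> \<open>\<open>rho\<close> still contains the column-removal shift; subtracting it
    leaves \<open>\<epsilon> / 4\<close> of the gain \<open>\<epsilon> / 3\<close>.\<close>
  moreover have "lam * (1 / (real m * x)) \<le> \<epsilon> / 12"
  proof -
    have "lam / x \<le> 6" using x6 x by (simp add: pos_divide_le_eq)
    then have "lam / x / real m \<le> 6 / real m" by (intro divide_right_mono) auto
    also have "\<dots> \<le> \<epsilon> / 12" using m_eps_ge m by (simp add: field_simps)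
    finally show ?thesis by (simp add: mult.commute)
  qed
  ultimately have "1 + \<epsilon> / 4 \<le> lam * s" unfolding rho_def distrib_left by linarith
  then have "(1 + \<epsilon> / 4) / lam \<le> s" using lam by (simp add: pos_divide_le_eq mult.commute)
  then have "real m * ((1 + \<epsilon> / 4) / lam) \<le> real m * s" by (intro mult_left_mono) auto
  then show "real m / lam * (1 + \<epsilon> / 4) \<le> (\<integral>w. res_tr m d h x w \<partial>gaussian_entries m d)"
    using m by (simp add: s_def)
qed

text \<open>A larger mean would allow \<open>mean_lower\<close> at the level
  \<open>(1 - t) / lam\<close>. There \<open>x / lam + D\<close> is at least
  \<open>1 + \<epsilon> / 3\<close>, and neither the factor \<open>1 - t\<close> nor the fluctuation
  loss brings it back to 1.\<close>

lemma mean_at_upper: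
  defines "x \<equiv> (1 + \<epsilon>) * lt"
  shows "lam / 3 \<le> x"
    and "(\<integral>w. res_tr m d h x w \<partial>gaussian_entries m d) \<le> real m / lam * (1 - \<epsilon> / 12)"
proof -
  have "1 * (lam / 3) \<le> (1 + \<epsilon>) * lt" using \<epsilon> shifted_lam_ge lam by (intro mult_mono) auto
  then show x3: "lam / 3 \<le> x" by (simp add: x_def)
  then have x: "0 < x" using lam by simp
  let ?E = "\<integral>w. res_tr m d h x w \<partial>gaussian_entries m d"
  \<comment> \<open>Small enough that \<open>(1 - t) * (1 + \<epsilon> / 3)\<close> exceeds 1 by
    more than \<open>\<epsilon> / 12\<close>, the allowance for the fluctuation loss.\<close>
  define t where "t = \<epsilon> / 12"
  have t: "0 < t" "t \<le> 1 / 24" using \<epsilon> by (auto simp: t_def)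
  define eta where "eta = 4 / (x * sqrt (real m))"
  show "?E \<le> real m / lam * (1 - \<epsilon> / 12)"
  proof (rule ccontr)
    assume "\<not> ?thesis"
    then have E: "real m * ((1 - t) / lam) \<le> ?E" by (simp add: t_def)
    have t0: "0 < 1 - t" using t by simp
    \<comment> \<open>The weight of the loss is at most \<open>lam / (1 - t)\<close> times a summand
      of the effective dimension, so the total over \<open>j\<close> involves \<open>m * D\<close>
      and not \<open>d\<close>.\<close>
    have summand: "(1 - t) * (h j / (h j + lam)) - lam * (h j / (h j + lam)) / (1 - t) * eta
        \<le> h j * ((1 - t) / lam) / (1 + h j * ((1 - t) / lam)) - h j / (1 + h j * ((1 - t) / lam)) * eta" for j
    proof -
      have 1: "(1 - t) * (h j / (h j + lam)) \<le> h j * ((1 - t) / lam) / (1 + h j * ((1 - t) / lam))"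
        using saturation_scale(2)[OF h lam t0, of j] t by simp
      have 2: "h j / (1 + h j * ((1 - t) / lam)) \<le> lam * (h j / (h j + lam)) / (1 - t)"
      proof -
        have p: "0 < h j + lam" using h[of j] lam by simp
        have "h j / (1 + h j * ((1 - t) / lam)) = (h j * ((1 - t) / lam) / (1 + h j * ((1 - t) / lam))) * lam / (1 - t)"
          using t0 lam by simp
        also have "\<dots> \<le> (max 1 (1 - t) * (h j / (h j + lam))) * lam / (1 - t)"
          using t0 lam by (intro divide_right_mono mult_right_mono saturation_scale(1) h) auto
        also have "max 1 (1 - t) = 1" using t by simp
        finally show ?thesis by (simp add: mult.commute)
      qed
      have "0 \<le> eta" using x by (simp add: eta_def)
      from mult_right_mono[OF 2 this] 1 show ?thesis by linarith
    qed
    have "x * (real m * ((1 - t) / lam)) + (\<Sum>j<d. (1 - t) * (h j / (h j + lam)) - lam * (h j / (h j + lam)) / (1 - t) * eta)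
      \<le> x * ?E + (\<Sum>j<d. h j * ((1 - t) / lam) / (1 + h j * ((1 - t) / lam)) - h j / (1 + h j * ((1 - t) / lam)) * eta)"
      using E x by (intro add_mono mult_left_mono sum_mono summand) auto
    also have "\<dots> \<le> real m"
      unfolding eta_def by (rule mean_lower[of m h x, OF m h x _ E]) (use t0 lam in simp)
    also have "(\<Sum>j<d. (1 - t) * (h j / (h j + lam)) - lam * (h j / (h j + lam)) / (1 - t) * eta)
      = (1 - t) * (real m * D) - lam * (real m * D) / (1 - t) * eta"
      unfolding sum_saturation[symmetric] sum_subtractf sum_distrib_left sum_divide_distrib sum_distrib_right ..
    also have "x * (real m * ((1 - t) / lam)) + ((1 - t) * (real m * D) - lam * (real m * D) / (1 - t) * eta)
      = real m * ((1 - t) * (x / lam + D) - D * (lam * eta) / (1 - t))"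
      by (simp add: algebra_simps add_divide_distrib)
    finally have main: "(1 - t) * (x / lam + D) - D * (lam * eta) / (1 - t) \<le> 1" using m by (simp add: mult_le_cancel_left2)
    have "x / lam = (1 + \<epsilon>) * (1 - D)" using lam by (simp add: x_def lt)
    then have "x / lam + D = 1 + \<epsilon> * (1 - D)" by (simp add: algebra_simps)
    also have "\<dots> \<ge> 1 + \<epsilon> * (1 / 3)" using \<epsilon> D(2) by (intro add_left_mono mult_left_mono) auto
    finally have "(1 - t) * (1 + \<epsilon> / 3) \<le> (1 - t) * (x / lam + D)" using t0 by (intro mult_left_mono) auto
    moreover have "(1 - t) * (1 + \<epsilon> / 3) \<ge> 1 + \<epsilon> / 4 - \<epsilon> / 72"
    proof -
      have "t * \<epsilon> \<le> t * (1 / 2)" using t \<epsilon> by (intro mult_left_mono) auto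
      moreover have "(1 - t) * (1 + \<epsilon> / 3) = 1 + \<epsilon> / 3 - t - t * \<epsilon> / 3" by (simp add: field_simps)
      ultimately show ?thesis unfolding t_def by linarith
    qed
    moreover have "D * (lam * eta) / (1 - t) \<le> \<epsilon> / 12"
    proof -
      have sm: "0 < sqrt (real m)" using m by simp
      have "lam * eta = (lam / x) * (4 / sqrt (real m))" by (simp add: eta_def)
      also have "\<dots> \<le> 3 * (4 / sqrt (real m))"
        using x3 x by (intro mult_right_mono) (auto simp: pos_divide_le_eq)
      also have "4 / sqrt (real m) \<le> \<epsilon> / 26" using sqrt_m_eps_ge sm by (simp add: field_simps)
      finally have le: "lam * eta \<le> 3 * (\<epsilon> / 26)" by simp
      have nn: "0 \<le> lam * eta" using lam x by (simp add: eta_def)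
      have "D * (lam * eta) \<le> 2 / 3 * (3 * (\<epsilon> / 26))" by (rule mult_mono[OF D(2) le _ nn]) simp
      also have "\<dots> = \<epsilon> / 13" by simp
      also have "\<epsilon> / 13 \<le> \<epsilon> / 12 * (23 / 24)" using \<epsilon> by simp
      also have "\<dots> \<le> \<epsilon> / 12 * (1 - t)" using t \<epsilon> by (intro mult_left_mono) auto
      finally show ?thesis using t0 by (simp add: pos_divide_le_eq)
    qed
    ultimately show False using main \<epsilon> by linarith
  qed
qed

text \<open>The means clear the level \<open>m / lam\<close> by a relative margin of order
  \<open>\<epsilon>\<close> at each end; failure at an end is a deviation of that size, and each
  gets half of \<open>\<delta>\<close>.\<close>

lemma diagonal_brackets_prob:
  "1 - \<delta> \<le> measure (gaussian_entries m d)
    {w \<in> space (gaussian_entries m d). brackets m lam ((1 - \<epsilon>) * lt) ((1 + \<epsilon>) * lt) (wgram m d h w)}"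
proof -
  interpret prob_space "gaussian_entries m d" by (rule prob_space_gaussian_entries[OF m])
  let ?G = "gaussian_entries m d"
  let ?a = "(1 - \<epsilon>) * lt" and ?b = "(1 + \<epsilon>) * lt"
  have a: "0 < ?a" using mean_at_lower(1) lam by simp
  have b: "0 < ?b" using mean_at_upper(1) lam by simp
  have [measurable]: "res_tr m d h ?a \<in> borel_measurable ?G" "res_tr m d h ?b \<in> borel_measurable ?G"
    using res_tr_measurable[of m h _ d, OF m h a] res_tr_measurable[of m h _ d, OF m h b] by auto
  \<comment> \<open>\<open>lam * r\<close> is a lower bound for the shift and
    \<open>\<epsilon> * e\<close> the relative margin: \<open>(1/6, 1/4)\<close> at the lower end,
    \<open>(1/3, 1/12)\<close> at the upper. The 21632 is \<open>2 * 10816\<close>, the 2 coming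
    from the exponent of the tail bound.\<close>
  have tail: "measure ?G {w \<in> space ?G. t \<le> u * (res_tr m d h x w - (\<integral>w. res_tr m d h x w \<partial>?G))} \<le> \<delta> / 2"
    if u: "\<bar>u\<bar> = 1" and x: "lam * r \<le> x" "0 < r" and t: "t = real m / lam * (\<epsilon> * e)" "0 < e" and re: "1 \<le> 21632 * (r * e)\<^sup>2" for u x t r e
  proof -
    have x0: "0 < x" using x lam by (smt (verit) mult_pos_pos)
    have t0: "0 < t" using t m lam \<epsilon> by simp
    have "measure ?G {w \<in> space ?G. t \<le> u * (res_tr m d h x w - (\<integral>w. res_tr m d h x w \<partial>?G))} \<le> exp (- 2 * t\<^sup>2 * x\<^sup>2 / real m)"
      by (rule res_tr_tail[of m h x, OF m h x0 t0 u])
    also have "\<dots> = exp (- (2 * t\<^sup>2 * x\<^sup>2 / real m))" by simp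
    also have "\<dots> \<le> \<delta> / 2"
    proof (rule exp_le_half[OF \<delta>(1)])
      have ln0: "0 \<le> 1 + ln (1 / \<delta>)" using \<delta> by simp
      have "1 + ln (1 / \<delta>) \<le> (21632 * (r * e)\<^sup>2) * (1 + ln (1 / \<delta>))"
        using mult_right_mono[OF re ln0] by simp
      also have "\<dots> = 2 * (r * e)\<^sup>2 * (10816 * (1 + ln (1 / \<delta>)))" by simp
      also have "\<dots> \<le> 2 * (r * e)\<^sup>2 * (real m * \<epsilon>\<^sup>2)" using big by (intro mult_left_mono) auto
      also have "\<dots> = 2 * t\<^sup>2 * (lam * r)\<^sup>2 / real m"
        using m lam by (simp add: t power2_eq_square)
      also have "\<dots> \<le> 2 * t\<^sup>2 * x\<^sup>2 / real m"
        using x lam by (intro divide_right_mono mult_left_mono power_mono) auto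
      finally show "1 + ln (1 / \<delta>) \<le> 2 * t\<^sup>2 * x\<^sup>2 / real m" .
    qed
    finally show ?thesis .
  qed
  let ?A = "{w \<in> space ?G. res_tr m d h ?a w \<le> real m / lam}"
  let ?B = "{w \<in> space ?G. real m / lam \<le> res_tr m d h ?b w}"
  have "prob ?A \<le> prob {w \<in> space ?G. real m / lam * (\<epsilon> * (1/4)) \<le> (-1) * (res_tr m d h ?a w - (\<integral>w. res_tr m d h ?a w \<partial>?G))}"
  proof (rule finite_measure_mono)
    show "?A \<subseteq> {w \<in> space ?G. real m / lam * (\<epsilon> * (1/4)) \<le> (-1) * (res_tr m d h ?a w - (\<integral>w. res_tr m d h ?a w \<partial>?G))}"
      using mean_at_lower(2) by (auto simp: distrib_left)
  qed measurable
  also have "\<dots> \<le> \<delta> / 2"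
  proof -
    have "lam * (1/6) \<le> ?a" "(0::real) < 1/6" "(0::real) < 1/4" "1 \<le> 21632 * ((1/6) * (1/4) :: real)\<^sup>2"
      using mean_at_lower(1) by (auto simp: power2_eq_square)
    from tail[OF _ this(1,2) refl this(3,4), of "-1"] show ?thesis by simp
  qed
  finally have A: "prob ?A \<le> \<delta> / 2" .
  have "prob ?B \<le> prob {w \<in> space ?G. real m / lam * (\<epsilon> * (1/12)) \<le> 1 * (res_tr m d h ?b w - (\<integral>w. res_tr m d h ?b w \<partial>?G))}"
  proof (rule finite_measure_mono)
    show "?B \<subseteq> {w \<in> space ?G. real m / lam * (\<epsilon> * (1/12)) \<le> 1 * (res_tr m d h ?b w - (\<integral>w. res_tr m d h ?b w \<partial>?G))}"
      using mean_at_upper(2) by (auto simp: right_diff_distrib)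
  qed measurable
  also have "\<dots> \<le> \<delta> / 2"
  proof -
    have "lam * (1/3) \<le> ?b" "(0::real) < 1/3" "(0::real) < 1/12" "1 \<le> 21632 * ((1/3) * (1/12) :: real)\<^sup>2"
      using mean_at_upper(1) by (auto simp: power2_eq_square)
    from tail[OF _ this(1,2) refl this(3,4), of 1] show ?thesis by simp
  qed
  finally have B: "prob ?B \<le> \<delta> / 2" .
  have "prob (?A \<union> ?B) \<le> prob ?A + prob ?B" by (rule measure_Un_le) measurable
  then have "1 - \<delta> \<le> 1 - prob (?A \<union> ?B)" using A B by simp
  also have "\<dots> = prob (space ?G - (?A \<union> ?B))" by (rule prob_compl[symmetric]) measurable
  also have "space ?G - (?A \<union> ?B) = {w \<in> space ?G. brackets m lam ?a ?b (wgram m d h w)}"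
    by (auto simp: brackets_def res_tr_def not_le)
  finally show ?thesis .
qed

end

section \<open>Reduction to diagonal matrices\<close>

lemma sketched_psd:
  assumes H: "sym_psd_mat d H" and S: "S \<in> carrier_mat m d"
  shows "sym_psd_mat m (sketched H S)"
proof -
  note HD = sym_psd_matD[OF H]
  have T: "transpose_mat S \<in> carrier_mat d m" using S by simp
  have SH: "S * H \<in> carrier_mat m d" using S HD(1) by simp
  have "transpose_mat (S * H * transpose_mat S) = S * (H * transpose_mat S)"
    by (simp only: transpose_mult[OF SH T] transpose_mult[OF S HD(1)] Matrix.transpose_transpose HD(2))
  then have "transpose_mat (S * H * transpose_mat S) = S * H * transpose_mat S"
    unfolding assoc_mult_mat[OF S HD(1) T] .
  moreover have "0 \<le> v \<bullet> (S * H * transpose_mat S *\<^sub>v v)" if v: "v \<in> carrier_vec m" for v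
  proof -
    define u where "u = transpose_mat S *\<^sub>v v"
    have u: "u \<in> carrier_vec d" unfolding u_def by (rule mult_mat_vec_carrier[OF T v])
    have Hu: "H *\<^sub>v u \<in> carrier_vec d" by (rule mult_mat_vec_carrier[OF HD(1) u])
    have "v \<bullet> (S * H * transpose_mat S *\<^sub>v v) = v \<bullet> (S *\<^sub>v (H *\<^sub>v u))"
      unfolding assoc_mult_mat_vec[OF SH T v] u_def[symmetric] assoc_mult_mat_vec[OF S HD(1) u] ..
    also have "\<dots> = u \<bullet> (H *\<^sub>v u)"
      unfolding u_def by (rule transpose_vec_mult_scalar[OF S Hu[unfolded u_def] v, symmetric])
    finally show ?thesis using HD(3)[OF u] by simp
  qed
  ultimately show ?thesis using SH T by (auto simp: sym_psd_mat_def sketched_def intro!: mult_carrier_mat[of _ m d])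
qed

lemma sketch_of_carrier [simp]: "sketch_of m d w \<in> carrier_mat m d"
  by (simp add: sketch_of_def)

lemma measurable_sketched_entry:
  assumes H: "H \<in> carrier_mat d d" and k: "k < m" and l: "l < m"
  shows "(\<lambda>w. sketched H (sketch_of m d w) $$ (k,l)) \<in> borel_measurable (gaussian_entries m d)"
proof -
  have "sketched H (sketch_of m d w) $$ (k,l) = (\<Sum>j<d. (\<Sum>i<d. w (k,i) * H $$ (i,j)) * w (l,j))" for w
    using H k l by (simp add: sketched_def sketch_of_def scalar_prod_def atLeast0LessThan)
  moreover have "(\<lambda>w. w (k,i)) \<in> borel_measurable (gaussian_entries m d)" if "k < m" "i < d" for k i
    unfolding gaussian_entries_eq using that
    by (auto intro!: measurable_component_singleton[where M = "\<lambda>_. gauss (1 / sqrt (real m))", simplified])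
  ultimately show ?thesis
    using k l by (auto intro!: borel_measurable_sum borel_measurable_times)
qed

lemma measurable_sketched_resolvent_tr:
  assumes H: "sym_psd_mat d H" and x: "0 < x"
  shows "(\<lambda>w. mat_tr (resolvent m (sketched H (sketch_of m d w)) x)) \<in> borel_measurable (gaussian_entries m d)"
  by (rule measurable_resolvent_tr[OF sketched_psd[OF H sketch_of_carrier] x measurable_sketched_entry[OF sym_psd_matD(1)[OF H]]])

section \<open>The effective dimension under rotation and for diagonal matrices\<close>

lemma eff_dim_resolvent:
  assumes H: "sym_psd_mat d H" and x: "0 < x"
  shows "eff_dim H x = real d - x * mat_tr (resolvent d H x)"
proof -
  have "dim_row H = d" using sym_psd_matD(1)[OF H] by simp
  then show ?thesis
    using resolvent_tr_identity[OF psd_reg_pos[OF H x]] by (simp add: eff_dim_def resolvent_def)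
qed

text \<open>The resolvent is conjugated together with \<open>H\<close>, and the trace is
  cyclic.\<close>

lemma
  assumes H: "sym_psd_mat d H" and G: "G \<in> carrier_mat d d"
    and orth: "transpose_mat G * G = 1\<^sub>m d" "G * transpose_mat G = 1\<^sub>m d"
  shows sym_psd_mat_conjugate: "sym_psd_mat d (transpose_mat G * H * G)"
    and eff_dim_conjugate: "0 < x \<Longrightarrow> eff_dim (transpose_mat G * H * G) x = eff_dim H x"
proof -
  let ?T = "transpose_mat G"
  have T: "?T \<in> carrier_mat d d" using G by simp
  have "transpose_mat ?T = G" by simp
  then show psd: "sym_psd_mat d (?T * H * G)" using sketched_psd[OF H T] by (simp add: sketched_def)
  assume x: "0 < x"
  note HD = sym_psd_matD[OF H]
  note R = resolvent_inv[OF psd_reg_pos[OF H x]]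
  let ?R = "resolvent d H x"
  define M where "M = H + x \<cdot>\<^sub>m 1\<^sub>m d"
  have M: "M \<in> carrier_mat d d" using HD(1) by (simp add: M_def)
  have MR: "M * ?R = 1\<^sub>m d" using R(2) by (simp add: M_def)
  have TM: "?T * M \<in> carrier_mat d d" and RG: "?R * G \<in> carrier_mat d d" and TRG: "?T * ?R * G \<in> carrier_mat d d" and TR: "?T * ?R \<in> carrier_mat d d"
    and MG: "M * G \<in> carrier_mat d d" and TH: "?T * H \<in> carrier_mat d d"
    using T M R(1) G HD(1) by (auto intro!: mult_carrier_mat[of _ d d])
  have shift: "?T * H * G + x \<cdot>\<^sub>m 1\<^sub>m d = ?T * M * G"
  proof -
    have "?T * M = ?T * H + x \<cdot>\<^sub>m ?T"
      unfolding M_def using T HD(1) by (subst mult_add_distrib_mat[of _ d d]) (auto simp: mult_smult_distrib[of _ d d])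
    then have "?T * M * G = ?T * H * G + x \<cdot>\<^sub>m (?T * G)"
      using T TH G by (simp add: add_mult_distrib_mat[of _ d d] mult_smult_assoc_mat[of _ d d])
    then show ?thesis unfolding orth(1) by simp
  qed
  have "resolvent d (?T * H * G) x = ?T * ?R * G"
    unfolding resolvent_def shift
  proof (rule mat_inv_eqI[of _ d])
    show "?T * M * G \<in> carrier_mat d d" using TM G by simp
    show TRG': "?T * mat_inv (H + x \<cdot>\<^sub>m 1\<^sub>m d) * G \<in> carrier_mat d d" using TRG by (simp add: resolvent_def)
    have 1: "?T * ?R * G = ?T * (?R * G)" by (rule assoc_mult_mat[OF T R(1) G])
    have 2: "G * (?T * (?R * G)) = ?R * G"
      using assoc_mult_mat[OF G T RG, symmetric] unfolding orth(2) left_mult_one_mat[OF RG] .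
    have 3: "M * (?R * G) = G" using assoc_mult_mat[OF M R(1) G, symmetric] G by (simp add: MR)
    have "?T * M * G * (?T * ?R * G) = ?T * M * (G * (?T * (?R * G)))"
      unfolding 1 using assoc_mult_mat[OF TM G mult_carrier_mat[OF T RG]] .
    also have "\<dots> = ?T * (M * (?R * G))" unfolding 2 by (rule assoc_mult_mat[OF T M RG])
    also have "\<dots> = 1\<^sub>m d" unfolding 3 by (rule orth(1))
    finally show "?T * M * G * (?T * mat_inv (H + x \<cdot>\<^sub>m 1\<^sub>m d) * G) = 1\<^sub>m d" by (simp add: resolvent_def)
  qed
  moreover have "mat_tr (?T * ?R * G) = mat_tr ?R"
  proof -
    have "mat_tr (?T * ?R * G) = mat_tr (G * (?T * ?R))" by (rule mat_tr_mult_comm[OF TR G])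
    also have "G * (?T * ?R) = ?R" using assoc_mult_mat[OF G T R(1), symmetric] R(1) by (simp add: orth(2))
    finally show ?thesis .
  qed
  ultimately show "eff_dim (?T * H * G) x = eff_dim H x"
    unfolding eff_dim_resolvent[OF psd x] eff_dim_resolvent[OF H x] by simp
qed

lemma eff_dim_diagonal:
  assumes H: "sym_psd_mat d H" and diag: "\<And>i j. i < d \<Longrightarrow> j < d \<Longrightarrow> i \<noteq> j \<Longrightarrow> H $$ (i,j) = 0"
    and x: "0 < x"
  shows "eff_dim H x = (\<Sum>j<d. H $$ (j,j) / (H $$ (j,j) + x))"
    and "j < d \<Longrightarrow> 0 \<le> H $$ (j,j)"
proof -
  note HD = sym_psd_matD[OF H]
  show nn: "0 \<le> H $$ (j,j)" if j: "j < d" for j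
  proof -
    have "(H *\<^sub>v unit_vec d j) $ j = H $$ (j,j)"
      using HD(1) j by (simp only: mat_mult_unit_vec[OF HD(1) j]) simp
    moreover have "H *\<^sub>v unit_vec d j \<in> carrier_vec d" by (rule mult_mat_vec_carrier[OF HD(1)]) simp
    ultimately show ?thesis using HD(3)[of "unit_vec d j"] j by (simp add: scalar_prod_left_unit[of _ d])
  qed
  let ?B = "Matrix.mat d d (\<lambda>(i,j). if i = j then 1 / (H $$ (i,i) + x) else 0)"
  have "resolvent d H x = ?B"
    unfolding resolvent_def
  proof (rule mat_inv_eqI[of _ d])
    show "(H + x \<cdot>\<^sub>m 1\<^sub>m d) * ?B = 1\<^sub>m d"
    proof (rule eq_matI)
      fix i j assume "i < dim_row (1\<^sub>m d)" "j < dim_col (1\<^sub>m d)"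
      then have ij: "i < d" "j < d" by auto
      have "((H + x \<cdot>\<^sub>m 1\<^sub>m d) * ?B) $$ (i,j) = (\<Sum>k\<in>{0..<d}. (H $$ (i,k) + x * of_bool (i = k)) * (if k = j then 1 / (H $$ (k,k) + x) else 0))"
        using HD(1) ij by (auto simp: scalar_prod_def intro!: sum.cong)
      also have "\<dots> = (H $$ (i,j) + x * of_bool (i = j)) * (1 / (H $$ (j,j) + x))"
        using ij by (subst sum.remove[of _ j]) auto
      also have "\<dots> = 1\<^sub>m d $$ (i,j)" using ij diag[OF ij] nn[OF ij(2)] x by auto
      finally show "((H + x \<cdot>\<^sub>m 1\<^sub>m d) * ?B) $$ (i,j) = 1\<^sub>m d $$ (i,j)" .
    qed (use HD(1) in auto)
  qed (use HD(1) in auto)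
  then have "mat_tr (resolvent d H x) = (\<Sum>j<d. 1 / (H $$ (j,j) + x))" by (simp add: mat_tr_def)
  then have "eff_dim H x = (\<Sum>j<d. 1 - x * (1 / (H $$ (j,j) + x)))"
    unfolding eff_dim_resolvent[OF H x] by (simp add: sum_subtractf sum_distrib_left)
  also have "\<dots> = (\<Sum>j<d. H $$ (j,j) / (H $$ (j,j) + x))"
  proof (rule sum.cong[OF refl])
    fix j assume "j \<in> {..<d}"
    then have "0 < H $$ (j,j) + x" using nn[of j] x by simp
    then show "1 - x * (1 / (H $$ (j,j) + x)) = H $$ (j,j) / (H $$ (j,j) + x)" by (simp add: field_simps)
  qed
  finally show "eff_dim H x = (\<Sum>j<d. H $$ (j,j) / (H $$ (j,j) + x))" .
qed

lemma brackets_measurable: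
  assumes H: "sym_psd_mat d H" and ab: "0 < a" "0 < b"
  shows "{w \<in> space (gaussian_entries m d). brackets m lam a b (sketched H (sketch_of m d w))} \<in> sets (gaussian_entries m d)"
proof -
  note [measurable] = measurable_sketched_resolvent_tr[OF H ab(1), of m] measurable_sketched_resolvent_tr[OF H ab(2), of m]
  show ?thesis unfolding brackets_def by measurable
qed

text \<open>Sketching the rotated matrix \<open>G^T H G\<close> with \<open>S\<close> is sketching
  \<open>H\<close> with \<open>S G^T\<close>, which has the law of \<open>S\<close>. The
  probabilities are written as integrals of indicators because the invariance is stated for
  integrals.\<close>

lemma brackets_prob_rotate:
  assumes H: "sym_psd_mat d H" and m: "0 < m" and pq: "p < d" "q < d" "p \<noteq> q" and cs: "c\<^sup>2 + s\<^sup>2 = 1"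
    and ab: "0 < a" "0 < b"
  defines "G \<equiv> givens d p q c s"
  shows "measure (gaussian_entries m d) {w \<in> space (gaussian_entries m d). brackets m lam a b (sketched (transpose_mat G * H * G) (sketch_of m d w))}
    = measure (gaussian_entries m d) {w \<in> space (gaussian_entries m d). brackets m lam a b (sketched H (sketch_of m d w))}"
proof -
  let ?P = "gaussian_entries m d" and ?T = "transpose_mat G"
  let ?rot = "\<lambda>w (i,j). if i < m \<and> j = p then c * w (i,p) - s * w (i,q)
            else if i < m \<and> j = q then s * w (i,p) + c * w (i,q) else w (i,j)"
  have G: "G \<in> carrier_mat d d" and T: "?T \<in> carrier_mat d d" by (simp_all add: G_def)
  note orth = givens_orthogonal[OF pq cs, folded G_def]
  note H' = sym_psd_mat_conjugate[OF H G orth]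
  have HD: "H \<in> carrier_mat d d" by (rule sym_psd_matD(1)[OF H])
  have rot: "sketch_of m d (?rot w) = sketch_of m d w * ?T" for w :: "nat \<times> nat \<Rightarrow> real"
  proof (rule eq_matI)
    fix i j assume "i < dim_row (sketch_of m d w * ?T)" "j < dim_col (sketch_of m d w * ?T)"
    then have ij: "i < m" "j < d" by (auto simp: sketch_of_def G_def givens_def)
    define v where "v = Matrix.row (sketch_of m d w) i"
    have v: "v \<in> carrier_vec d" "\<And>l. l < d \<Longrightarrow> v $ l = w (i,l)" using ij by (auto simp: v_def sketch_of_def)
    have rG: "Matrix.row G j \<in> carrier_vec d" using G ij by auto
    have "(sketch_of m d w * ?T) $$ (i,j) = v \<bullet> Matrix.row G j"
      using ij G by (simp add: v_def sketch_of_def)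
    also have "\<dots> = (G *\<^sub>v v) $ j" using G ij comm_scalar_prod[OF v(1) rG] by simp
    also have "\<dots> = ?rot w (i,j)"
      unfolding G_def givens_mult_vec[OF pq v(1) ij(2)] using v(2) pq ij by auto
    finally show "sketch_of m d (?rot w) $$ (i,j) = (sketch_of m d w * ?T) $$ (i,j)"
      using ij by (simp add: sketch_of_def)
  qed (auto simp: sketch_of_def G_def givens_def)
  have conj: "sketched (?T * H * G) S = sketched H (S * ?T)" if S: "S \<in> carrier_mat m d" for S
  proof -
    have ST: "transpose_mat S \<in> carrier_mat d m" using S by simp
    have TH: "?T * H \<in> carrier_mat d d" by (rule mult_carrier_mat[OF T HD])
    have SxT: "S * ?T \<in> carrier_mat m d" by (rule mult_carrier_mat[OF S T])
    have "S * (?T * H * G) = (S * (?T * H)) * G" by (rule assoc_mult_mat[OF S TH G, symmetric])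
    also have "S * (?T * H) = (S * ?T) * H" by (rule assoc_mult_mat[OF S T HD, symmetric])
    finally have 1: "S * (?T * H * G) = (S * ?T) * H * G" .
    have "(S * ?T) * H * G * transpose_mat S = (S * ?T) * H * (G * transpose_mat S)"
      by (rule assoc_mult_mat[OF mult_carrier_mat[OF SxT HD] G ST])
    also have "G * transpose_mat S = transpose_mat (S * ?T)" using transpose_mult[OF S T] by simp
    finally show ?thesis unfolding sketched_def 1 .
  qed
  let ?F = "\<lambda>w. indicator {w. brackets m lam a b (sketched H (sketch_of m d w))} w :: ennreal"
  have F: "?F \<in> borel_measurable ?P"
    by (rule borel_measurable_indicator') (use brackets_measurable[OF H ab, of m lam] in \<open>simp add: vimage_def Int_def conj_commute\<close>)
  have e: "emeasure ?P {w \<in> space ?P. brackets m lam a b (K w)} = (\<integral>\<^sup>+w. indicator {w. brackets m lam a b (K w)} w \<partial>?P)"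
    if "{w \<in> space ?P. brackets m lam a b (K w)} \<in> sets ?P" for K :: "(nat \<times> nat \<Rightarrow> real) \<Rightarrow> real mat"
    unfolding nn_integral_indicator[OF that, symmetric]
    by (rule nn_integral_cong) (simp add: indicator_def)
  have "emeasure ?P {w \<in> space ?P. brackets m lam a b (sketched (?T * H * G) (sketch_of m d w))}
    = (\<integral>\<^sup>+w. ?F (?rot w) \<partial>?P)"
    unfolding e[OF brackets_measurable[OF H' ab]]
    by (rule nn_integral_cong) (simp only: indicator_def mem_Collect_eq rot conj[OF sketch_of_carrier])
  also have "\<dots> = (\<integral>\<^sup>+w. ?F w \<partial>?P)"
    by (rule nn_integral_gaussian_entries_rotate[OF m pq cs F order_refl])
  also have "\<dots> = emeasure ?P {w \<in> space ?P. brackets m lam a b (sketched H (sketch_of m d w))}"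
    by (rule e[OF brackets_measurable[OF H ab], symmetric])
  finally show ?thesis by (simp add: measure_def)
qed

text \<open>A plane rotation changes neither the effective dimension, hence not
  \<open>lam_tilde\<close>, nor the probability of the bracket, so the claim descends to the
  diagonal case along the rotation induction.\<close>

lemma brackets_prob:
  assumes H: "sym_psd_mat d H" and m: "0 < m" and lam: "0 < lam" and \<epsilon>: "0 < \<epsilon>" "\<epsilon> \<le> 1 / 2"
    and \<delta>: "0 < \<delta>" "\<delta> < 1" and dim: "3 / 2 * eff_dim H lam \<le> real m"
    and big: "10816 * (1 + ln (1 / \<delta>)) \<le> real m * \<epsilon>\<^sup>2"
  shows "1 - \<delta> \<le> measure (gaussian_entries m d) {w \<in> space (gaussian_entries m d).
    brackets m lam ((1 - \<epsilon>) * lam_tilde H lam m) ((1 + \<epsilon>) * lam_tilde H lam m) (sketched H (sketch_of m d w))}"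
proof -
  \<comment> \<open>Positive semidefiniteness and the dimension bound become premises inside the
    claim, because the induction rule carries only symmetry along.\<close>
  have "sym_psd_mat d H \<longrightarrow> 3 / 2 * eff_dim H lam \<le> real m \<longrightarrow> 1 - \<delta> \<le> measure (gaussian_entries m d) {w \<in> space (gaussian_entries m d).
    brackets m lam ((1 - \<epsilon>) * lam_tilde H lam m) ((1 + \<epsilon>) * lam_tilde H lam m) (sketched H (sketch_of m d w))}"
    using sym_psd_matD(1,2)[OF H]
  proof (induction rule: symmetric_mat_givens_induct)
    case (diagonal H)
    show ?case
    proof (intro impI)
      assume psd: "sym_psd_mat d H" and dim: "3 / 2 * eff_dim H lam \<le> real m"
      note E = eff_dim_diagonal[OF psd diagonal(2) lam]
      \<comment> \<open>Zero beyond \<open>d\<close>, since the diagonal lemmas ask for nonnegative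
        weights at all indices.\<close>
      define h where "h = (\<lambda>j. if j < d then H $$ (j,j) else 0)"
      define D where "D = (\<Sum>j<d. h j / (h j + lam)) / real m"
      have h: "0 \<le> h j" for j using E(2) by (simp add: h_def)
      have eD: "eff_dim H lam = real m * D" using m by (simp add: E(1) D_def h_def)
      have D23: "D \<le> 2 / 3"
      proof -
        have "3 / 2 * (real m * D) \<le> real m" using dim by (simp only: eD)
        then have "real m * (3 / 2 * D) \<le> real m * 1" by (simp add: mult_ac)
        then have "3 / 2 * D \<le> 1" using m by (subst (asm) mult_le_cancel_left_pos) auto
        then show ?thesis by simp
      qed
      have lt: "lam_tilde H lam m = lam * (1 - D)" using m by (simp add: lam_tilde_def eD)
      have "sketched H (sketch_of m d w) = wgram m d h w" for w
      proof (rule eq_matI)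
        fix k l assume "k < dim_row (wgram m d h w)" "l < dim_col (wgram m d h w)"
        then have kl: "k < m" "l < m" by (auto simp: wgram_def)
        have "(\<Sum>i<d. w (k,i) * H $$ (i,j)) = w (k,j) * H $$ (j,j)" if j: "j < d" for j
        proof -
          have "(\<Sum>i\<in>{..<d} - {j}. w (k,i) * H $$ (i,j)) = 0"
            by (rule sum.neutral) (use diagonal(2) j in auto)
          then show ?thesis using j by (subst sum.remove[of _ j]) auto
        qed
        then have "sketched H (sketch_of m d w) $$ (k,l) = (\<Sum>j<d. w (k,j) * H $$ (j,j) * w (l,j))"
          using diagonal(1) kl by (simp add: sketched_def sketch_of_def scalar_prod_def atLeast0LessThan)
        then show "sketched H (sketch_of m d w) $$ (k,l) = wgram m d h w $$ (k,l)"
          using kl by (simp add: wgram_def h_def mult_ac)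
      qed (auto simp: sketched_def sketch_of_def wgram_def)
      then show "1 - \<delta> \<le> measure (gaussian_entries m d) {w \<in> space (gaussian_entries m d).
        brackets m lam ((1 - \<epsilon>) * lam_tilde H lam m) ((1 + \<epsilon>) * lam_tilde H lam m) (sketched H (sketch_of m d w))}"
        using diagonal_brackets_prob[OF m h lam \<epsilon> \<delta> D_def D23 lt big] by simp
    qed
  next
    case (rotate H p q c s)
    show ?case
    proof (intro impI)
      assume psd: "sym_psd_mat d H" and dim: "3 / 2 * eff_dim H lam \<le> real m"
      let ?G = "givens d p q c s"
      note orth = givens_orthogonal[OF rotate(3-6)]
      have psd': "sym_psd_mat d (transpose_mat ?G * H * ?G)" by (rule sym_psd_mat_conjugate[OF psd givens_carrier orth])
      have eff: "eff_dim (transpose_mat ?G * H * ?G) lam = eff_dim H lam" by (rule eff_dim_conjugate[OF psd givens_carrier orth lam])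
      have lt: "lam_tilde (transpose_mat ?G * H * ?G) lam m = lam_tilde H lam m" by (simp add: lam_tilde_def eff)
      have "1 / real m * eff_dim H lam \<le> 2 / 3" using dim m by (simp add: divide_simps)
      then have "0 < lam_tilde H lam m" unfolding lam_tilde_def using lam by (intro mult_pos_pos) linarith+
      then have ab: "0 < (1 - \<epsilon>) * lam_tilde H lam m" "0 < (1 + \<epsilon>) * lam_tilde H lam m"
        using \<epsilon> by auto
      show "1 - \<delta> \<le> measure (gaussian_entries m d) {w \<in> space (gaussian_entries m d).
        brackets m lam ((1 - \<epsilon>) * lam_tilde H lam m) ((1 + \<epsilon>) * lam_tilde H lam m) (sketched H (sketch_of m d w))}"
        using rotate(7) psd' dim unfolding eff lt brackets_prob_rotate[OF psd m rotate(3-6) ab] by blast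
    qed
  qed
  with H dim show ?thesis by blast
qed

section \<open>The search output\<close>

text \<open>Monotonicity in one direction, the intermediate value theorem in the other. The
  right-hand side sees \<open>g\<close> only at the two ends, which makes the existence of a root a
  measurable event.\<close>

lemma decreasing_root_iff:
  fixes g :: "real \<Rightarrow> real"
  assumes dec: "\<And>x y. 0 < x \<Longrightarrow> x < y \<Longrightarrow> g y < g x" and cont: "continuous_on {0<..} g" and a: "0 < a"
  shows "(\<exists>l. a \<le> l \<and> l \<le> b \<and> g l = c) \<longleftrightarrow> a \<le> b \<and> c \<le> g a \<and> g b \<le> c"
proof
  assume "\<exists>l. a \<le> l \<and> l \<le> b \<and> g l = c"
  then obtain l where l: "a \<le> l" "l \<le> b" "g l = c" by auto
  have "c \<le> g a" using dec[OF a, of l] l by (cases "a = l") auto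
  moreover have "g b \<le> c" using dec[of l b] l a by (cases "l = b") auto
  ultimately show "a \<le> b \<and> c \<le> g a \<and> g b \<le> c" using l by auto
next
  assume *: "a \<le> b \<and> c \<le> g a \<and> g b \<le> c"
  have "continuous_on {a..b} g" by (rule continuous_on_subset[OF cont]) (use a in auto)
  then show "\<exists>l. a \<le> l \<and> l \<le> b \<and> g l = c" using IVT2'[of g b c a] * by auto
qed

text \<open>There is at most one root, so a claim about all roots is a claim about existence in the
  smaller interval, which \<open>decreasing_root_iff\<close> can treat.\<close>

lemma decreasing_roots_in_iff:
  fixes g :: "real \<Rightarrow> real"
  assumes dec: "\<And>x y. 0 < x \<Longrightarrow> x < y \<Longrightarrow> g y < g x" and a: "0 < a"
  shows "(\<forall>l. a \<le> l \<and> l \<le> b \<and> g l = c \<longrightarrow> u \<le> l \<and> l \<le> v)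
    \<longleftrightarrow> (\<exists>l. a \<le> l \<and> l \<le> b \<and> g l = c) \<longrightarrow> (\<exists>l. max a u \<le> l \<and> l \<le> min b v \<and> g l = c)"
proof -
  have uniq: "l = l'" if "a \<le> l" "a \<le> l'" "g l = c" "g l' = c" for l l'
    using dec[of l l'] dec[of l' l] that a by (cases l l' rule: linorder_cases) auto
  show ?thesis
  proof (intro iffI impI allI)
    assume "\<forall>l. a \<le> l \<and> l \<le> b \<and> g l = c \<longrightarrow> u \<le> l \<and> l \<le> v" "\<exists>l. a \<le> l \<and> l \<le> b \<and> g l = c"
    then show "\<exists>l. max a u \<le> l \<and> l \<le> min b v \<and> g l = c" by auto
  next
    fix l assume l: "a \<le> l \<and> l \<le> b \<and> g l = c"
      and "(\<exists>l. a \<le> l \<and> l \<le> b \<and> g l = c) \<longrightarrow> (\<exists>l. max a u \<le> l \<and> l \<le> min b v \<and> g l = c)"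
    then obtain l' where l': "max a u \<le> l'" "l' \<le> min b v" "g l' = c" by auto
    have "l = l'" by (rule uniq) (use l l' in auto)
    with l' show "u \<le> l \<and> l \<le> v" by simp
  qed
qed

text \<open>The Lipschitz constant from \<open>resolvent_tr_diff_le\<close> is uniform only away
  from zero, so each point \<open>z\<close> is treated in the half-line above
  \<open>z / 2\<close>.\<close>

lemma continuous_on_resolvent_tr:
  assumes A: "sym_psd_mat n A"
  shows "continuous_on {0<..} (\<lambda>x. mat_tr (resolvent n A x))"
proof (rule continuous_on_eq_continuous_at[THEN iffD2, OF open_greaterThan], safe)
  fix z :: real assume "0 < z"
  define a where "a = z / 2"
  have a: "0 < a" "a < z" using \<open>0 < z\<close> by (auto simp: a_def)
  let ?g = "\<lambda>x. mat_tr (resolvent n A x)"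
  have lip: "?g x - ?g y \<le> (real n / a\<^sup>2) * (y - x)" "0 \<le> ?g x - ?g y" if xy: "a < x" "x < y" for x y
  proof -
    have X: "psd_reg n A x" and Y: "psd_reg n A y" using psd_reg_pos[OF A, of x] psd_reg_pos[OF A, of y] xy a by auto
    have "?g x - ?g y \<le> real n * ((y - x) / (x * y))"
      by (rule resolvent_tr_diff_le[OF X Y _ xy(2)]) (use xy a in simp)
    also have "\<dots> \<le> real n * ((y - x) / a\<^sup>2)"
      using xy a by (intro mult_left_mono divide_left_mono) (auto simp: power2_eq_square intro!: mult_mono)
    finally show "?g x - ?g y \<le> (real n / a\<^sup>2) * (y - x)" by simp
    show "0 \<le> ?g x - ?g y"
    proof (cases "n = 0")
      case True then show ?thesis unfolding resolvent_tr[OF X] resolvent_tr[OF Y] by simp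
    next
      case False then show ?thesis using resolvent_tr_less[OF _ X Y xy(2)] by simp
    qed
  qed
  have "(real n / a\<^sup>2)-lipschitz_on {a<..} ?g"
  proof (rule lipschitz_onI)
    fix x y assume "x \<in> {a<..}" "y \<in> {a<..}"
    then have xy: "a < x" "a < y" by auto
    show "dist (?g x) (?g y) \<le> (real n / a\<^sup>2) * dist x y"
    proof (cases x y rule: linorder_cases)
      case less with lip[OF xy(1) less] show ?thesis by (simp add: dist_real_def)
    next
      case greater with lip[OF xy(2) greater] show ?thesis by (simp add: dist_real_def)
    qed simp
  qed simp
  then have "continuous_on {a<..} ?g" by (rule lipschitz_on_continuous_on)
  then show "isCont ?g z" using a by (simp add: continuous_on_eq_continuous_at)
qed

lemma s_hat_pos:
  assumes A: "sketched H S \<in> carrier_mat m m" and S: "S \<in> carrier_mat m d" and l: "0 < l"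
  shows "s_hat H S (- l) = ereal (1 / real m * mat_tr (resolvent m (sketched H S) l))"
proof -
  have "sketched H S - (- l) \<cdot>\<^sub>m 1\<^sub>m m = sketched H S + l \<cdot>\<^sub>m 1\<^sub>m m" using A by (intro eq_matI) auto
  then show ?thesis using S l by (simp add: s_hat_def resolvent_def)
qed

text \<open>The eigenvalue test becomes the vanishing of a determinant, which is a measurable
  condition.\<close>

lemma s_hat_zero:
  assumes A: "sketched H S \<in> carrier_mat m m" and S: "S \<in> carrier_mat m d"
  shows "s_hat H S 0 = (if det (sketched H S) = 0 then \<infinity> else ereal (1 / real m * mat_tr (resolvent m (sketched H S) 0)))"
proof -
  have 1: "sketched H S - 0 \<cdot>\<^sub>m 1\<^sub>m m = sketched H S" "sketched H S + 0 \<cdot>\<^sub>m 1\<^sub>m m = sketched H S" "char_matrix (sketched H S) 0 = sketched H S"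
    using A by (auto intro!: eq_matI simp: char_matrix_def)
  show ?thesis using S by (simp add: s_hat_def resolvent_def 1 eigenvalue_det[OF A])
qed

lemma s_hat_zero_measurable:
  assumes H: "sym_psd_mat d H"
  shows "{w \<in> space (gaussian_entries m d). s_hat H (sketch_of m d w) 0 \<le> ereal c} \<in> sets (gaussian_entries m d)"
proof -
  let ?A = "\<lambda>w. sketched H (sketch_of m d w)" and ?P = "gaussian_entries m d"
  have A: "?A w \<in> carrier_mat m m" for w by (rule sym_psd_matD(1)[OF sketched_psd[OF H sketch_of_carrier]])
  have A0: "?A w + 0 \<cdot>\<^sub>m 1\<^sub>m m = ?A w" for w using A[of w] by (intro eq_matI) auto
  note entry = measurable_sketched_entry[OF sym_psd_matD(1)[OF H], of _ m]
  have [measurable]: "(\<lambda>w. det (?A w)) \<in> borel_measurable ?P" by (rule measurable_det[OF A entry])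
  have [measurable]: "(\<lambda>w. \<Sum>i<m. if det (?A w) = 0 then 0 else mat_inv (?A w) $$ (i,i)) \<in> borel_measurable ?P"
    by (intro borel_measurable_sum measurable_mat_inv_entry[OF A entry]) auto
  have "s_hat H (sketch_of m d w) 0 \<le> ereal c \<longleftrightarrow> det (?A w) \<noteq> 0
    \<and> 1 / real m * (\<Sum>i<m. if det (?A w) = 0 then 0 else mat_inv (?A w) $$ (i,i)) \<le> c" for w
    unfolding s_hat_zero[OF A sketch_of_carrier] resolvent_def A0
    using mat_inv_nonsing(1)[OF A, of w] by (auto simp: mat_tr_def)
  then show ?thesis by simp
qed

text \<open>The second conjunct of the event guards against a vacuous first one:
  \<open>search_output\<close> may relate a sketch to no output. The dimension bound only gives
  \<open>lam_tilde >= lam / 3\<close>, which can lie below the search interval, so existence is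
  claimed when the lower end of the tolerance window is at least
  \<open>5 * lam / 12\<close>.\<close>

theorem theorem6:
  shows "\<exists>C::real. C > 0 \<and>
    (\<forall>(d::nat) (H::real mat) (lam::real) (\<delta>::real) (\<epsilon>::real) (m::nat).
       sym_psd_mat d H \<and> lam > 0 \<and> 0 < \<delta> \<and> \<delta> < 1 \<and> \<epsilon> > 0 \<and> m > 0 \<and>
       real m \<ge> 3 / 2 * eff_dim H lam \<and>
       real m \<ge> C * ((1 + ln (1 / \<delta>)) / \<epsilon>\<^sup>2) \<longrightarrow>
       measure (gaussian_entries m d)
         {\<omega> \<in> space (gaussian_entries m d).
            (\<forall>l W. search_output H lam (sketch_of m d \<omega>) (l, W) \<longrightarrow>
                \<bar>l - lam_tilde H lam m\<bar> \<le> \<epsilon> * lam_tilde H lam m) \<and>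
            (5 * lam / 12 \<le> (1 - \<epsilon>) * lam_tilde H lam m \<longrightarrow>
                (\<exists>l W. search_output H lam (sketch_of m d \<omega>) (l, W)))}
       \<ge> 1 - \<delta>)"
proof (intro exI[of _ "173056"] conjI allI impI)
  \<comment> \<open>\<open>173056 = 16 * 10816\<close>, because the bracket is applied with
    precision \<open>\<epsilon> / 4\<close>.\<close>
  show "(0::real) < 173056" by simp
  fix d H and lam \<delta> \<epsilon> :: real and m :: nat
  assume asm: "sym_psd_mat d H \<and> lam > 0 \<and> 0 < \<delta> \<and> \<delta> < 1 \<and> \<epsilon> > 0 \<and> m > 0 \<and>
       real m \<ge> 3 / 2 * eff_dim H lam \<and> real m \<ge> 173056 * ((1 + ln (1 / \<delta>)) / \<epsilon>\<^sup>2)"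
  then have H: "sym_psd_mat d H" and lam: "0 < lam" and \<delta>: "0 < \<delta>" "\<delta> < 1" and \<epsilon>: "0 < \<epsilon>" and m: "0 < m"
    and dim: "3 / 2 * eff_dim H lam \<le> real m" and big: "173056 * ((1 + ln (1 / \<delta>)) / \<epsilon>\<^sup>2) \<le> real m" by auto
  interpret prob_space "gaussian_entries m d" by (rule prob_space_gaussian_entries[OF m])
  let ?P = "gaussian_entries m d"
  define A where "A = (\<lambda>w. sketched H (sketch_of m d w))"
  define g where "g = (\<lambda>w x. 1 / real m * mat_tr (resolvent m (A w) x))"
  define t where "t = lam_tilde H lam m"
  define a where "a = 5 * lam / 12"
  have a: "0 < a" "a < lam" using lam by (auto simp: a_def)
  have Apsd: "sym_psd_mat m (A w)" for w unfolding A_def by (rule sketched_psd[OF H sketch_of_carrier])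
  have Ac: "A w \<in> carrier_mat m m" for w by (rule sym_psd_matD(1)[OF Apsd])
  have dec: "g w y < g w x" if "0 < x" "x < y" for w x y
    unfolding g_def using resolvent_tr_less[OF m psd_reg_pos[OF Apsd that(1)] psd_reg_pos[OF Apsd] that(2)] that m
    by (intro mult_strict_left_mono) auto
  have cont: "continuous_on {0<..} (g w)" for w
    unfolding g_def by (intro continuous_intros continuous_on_resolvent_tr Apsd)
  have t: "lam / 3 \<le> t"
  proof -
    have "1 / real m * eff_dim H lam \<le> 2 / 3" using dim m by (simp add: divide_simps)
    then have "lam * (1 / 3) \<le> lam * (1 - 1 / real m * eff_dim H lam)" using lam by (intro mult_left_mono) auto
    then show ?thesis by (simp add: t_def lam_tilde_def)
  qed
  then have t0: "0 < t" using lam by simp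
  define E0 where "E0 = (\<lambda>w. s_hat H (sketch_of m d w) 0 \<le> ereal (1 / lam))"
  define root where "root = (\<lambda>w u v. \<exists>l. u \<le> l \<and> l \<le> v \<and> g w l = 1 / lam)"
  have root_iff: "root w u v \<longleftrightarrow> u \<le> v \<and> 1 / lam \<le> g w u \<and> g w v \<le> 1 / lam" if "0 < u" for w u v
    unfolding root_def by (rule decreasing_root_iff[of "g w", OF dec cont that])
  define ok where "ok = (\<lambda>w. (\<forall>l W. search_output H lam (sketch_of m d w) (l, W) \<longrightarrow> \<bar>l - t\<bar> \<le> \<epsilon> * t) \<and>
            (5 * lam / 12 \<le> (1 - \<epsilon>) * t \<longrightarrow> (\<exists>l W. search_output H lam (sketch_of m d w) (l, W))))"
  \<comment> \<open>\<open>W\<close> is determined by \<open>l\<close>, so only the scalar output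
    remains to be studied.\<close>
  have search_iff: "(\<exists>W. search_output H lam (sketch_of m d w) (l, W)) \<longleftrightarrow>
      (if E0 w then l = a else a \<le> l \<and> l \<le> lam \<and> g w l = 1 / lam)" for w l
  proof -
    have "s_hat H (sketch_of m d w) (- l) = ereal (g w l)" if "a \<le> l"
      using s_hat_pos[OF Ac[unfolded A_def] sketch_of_carrier, of l] that a by (simp add: g_def A_def)
    then show ?thesis by (auto simp: search_output_def E0_def a_def)
  qed
  have ok_iff: "ok w \<longleftrightarrow> (E0 w \<and> \<bar>a - t\<bar> \<le> \<epsilon> * t) \<or> (\<not> E0 w \<and>
      (root w a lam \<longrightarrow> root w (max a (t - \<epsilon> * t)) (min lam (t + \<epsilon> * t))) \<and>
      (a \<le> (1 - \<epsilon>) * t \<longrightarrow> root w a lam))" for w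
  proof -
    have "(\<forall>l. a \<le> l \<and> l \<le> lam \<and> g w l = 1 / lam \<longrightarrow> \<bar>l - t\<bar> \<le> \<epsilon> * t)
      \<longleftrightarrow> (root w a lam \<longrightarrow> root w (max a (t - \<epsilon> * t)) (min lam (t + \<epsilon> * t)))"
    proof -
      have "\<bar>l - t\<bar> \<le> \<epsilon> * t \<longleftrightarrow> t - \<epsilon> * t \<le> l \<and> l \<le> t + \<epsilon> * t" for l
        unfolding abs_le_iff by linarith
      then have "(\<forall>l. a \<le> l \<and> l \<le> lam \<and> g w l = 1 / lam \<longrightarrow> \<bar>l - t\<bar> \<le> \<epsilon> * t)
        \<longleftrightarrow> (\<forall>l. a \<le> l \<and> l \<le> lam \<and> g w l = 1 / lam \<longrightarrow> t - \<epsilon> * t \<le> l \<and> l \<le> t + \<epsilon> * t)"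
        by (simp only:)
      also have "\<dots> \<longleftrightarrow> (root w a lam \<longrightarrow> root w (max a (t - \<epsilon> * t)) (min lam (t + \<epsilon> * t)))"
        unfolding root_def by (rule decreasing_roots_in_iff[of "g w", OF dec a(1)])
      finally show ?thesis .
    qed
    moreover have "ok w \<longleftrightarrow> (\<forall>l. (\<exists>W. search_output H lam (sketch_of m d w) (l, W)) \<longrightarrow> \<bar>l - t\<bar> \<le> \<epsilon> * t) \<and>
            (a \<le> (1 - \<epsilon>) * t \<longrightarrow> (\<exists>l. \<exists>W. search_output H lam (sketch_of m d w) (l, W)))"
      by (auto simp: ok_def a_def)
    ultimately show ?thesis unfolding search_iff root_def by (cases "E0 w") auto
  qed
  have root_meas: "{w \<in> space ?P. root w u v} \<in> sets ?P" if u: "0 < u" for u v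
  proof (cases "u \<le> v")
    case True
    have [measurable]: "(\<lambda>w. g w u) \<in> borel_measurable ?P" "(\<lambda>w. g w v) \<in> borel_measurable ?P"
      unfolding g_def A_def using u True
      by (intro borel_measurable_times borel_measurable_const measurable_sketched_resolvent_tr[OF H]; simp)+
    show ?thesis unfolding root_iff[OF u] by measurable
  next
    case False
    then show ?thesis unfolding root_iff[OF u] by simp
  qed
  have E0_meas: "{w \<in> space ?P. E0 w} \<in> sets ?P"
    unfolding E0_def by (rule s_hat_zero_measurable[OF H])
  \<comment> \<open>Measurability matters for the bound itself: \<open>measure\<close> is zero on a
    set that is not measurable, and monotonicity is used towards this event.\<close>
  have ok_meas: "{w \<in> space ?P. ok w} \<in> sets ?P"
    unfolding ok_iff using root_meas[of a lam] root_meas[of "max a (t - \<epsilon> * t)" "min lam (t + \<epsilon> * t)"] a E0_meas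
    by (intro sets.sets_Collect_disj sets.sets_Collect_conj sets.sets_Collect_neg sets.sets_Collect_imp sets.sets_Collect_const) auto
  have "1 - \<delta> \<le> prob {w \<in> space ?P. ok w}"
  \<comment> \<open>\<open>brackets_prob\<close> wants a precision of at most 1/2, which
    \<open>\<epsilon> / 4\<close> is for \<open>\<epsilon> < 2\<close>. Beyond that the tolerance
    covers the whole search interval.\<close>
  proof (cases "\<epsilon> < 2")
    case True
    define e where "e = \<epsilon> / 4"
    have e: "0 < e" "e \<le> 1 / 2" "e \<le> \<epsilon>" using \<epsilon> True by (auto simp: e_def)
    have "10816 * (1 + ln (1 / \<delta>)) \<le> real m * e\<^sup>2"
      using big \<epsilon> by (simp add: e_def power_divide divide_simps mult_ac)
    from brackets_prob[OF H m lam e(1,2) \<delta> dim this]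
    have "1 - \<delta> \<le> prob {w \<in> space ?P. brackets m lam ((1 - e) * t) ((1 + e) * t) (A w)}"
      by (simp add: t_def A_def)
    also have "\<dots> \<le> prob {w \<in> space ?P. ok w}"
    proof (rule finite_measure_mono[OF _ ok_meas], safe)
      fix w assume B: "brackets m lam ((1 - e) * t) ((1 + e) * t) (A w)"
      let ?x = "(1 - e) * t" and ?y = "(1 + e) * t"
      have x0: "0 < ?x" "?x < ?y" using e t0 by auto
      have gx: "1 / lam < g w ?x" and gy: "g w ?y < 1 / lam"
        using B m lam by (auto simp: brackets_def g_def field_simps)
      \<comment> \<open>The error branch would mean a trace at shift zero below the level, hence by
        monotonicity also one at \<open>?x\<close>, against the bracket.\<close>
      have notE0: "\<not> E0 w"
      proof
        assume "E0 w"
        then have det: "det (A w) \<noteq> 0" and le: "1 / real m * mat_tr (resolvent m (A w) 0) \<le> 1 / lam"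
          unfolding E0_def s_hat_zero[OF Ac[unfolded A_def] sketch_of_carrier] by (auto simp: A_def split: if_splits)
        have "A w + 0 \<cdot>\<^sub>m 1\<^sub>m m = A w" using Ac[of w] by (intro eq_matI) auto
        then have "psd_reg m (A w) 0" using Apsd det by (simp add: psd_reg_def)
        from resolvent_tr_less[OF m this psd_reg_pos[OF Apsd x0(1)] x0(1)]
        have "g w ?x \<le> 1 / real m * mat_tr (resolvent m (A w) 0)"
          unfolding g_def by (intro mult_left_mono) auto
        with le gx show False by simp
      qed
      have between: "?x \<le> l \<and> l \<le> ?y" if "0 < l" "g w l = 1 / lam" for l
      proof -
        have "\<not> l < ?x" using dec[OF that(1), of ?x w] that(2) gx by auto
        moreover have "\<not> ?y < l" using dec[of ?y l w] that(2) gy x0 by auto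
        ultimately show ?thesis by simp
      qed
      have et: "e * t \<le> \<epsilon> * t" using e t0 by simp
      have win: "max a (t - \<epsilon> * t) \<le> l \<and> l \<le> min lam (t + \<epsilon> * t)" if "a \<le> l" "l \<le> lam" "g w l = 1 / lam" for l
        using between[of l] that a et by (auto simp: algebra_simps)
      \<comment> \<open>Every diagonal entry of the resolvent at \<open>lam\<close> is at most
        \<open>1 / lam\<close>, so the upper end of the search interval never excludes the
        root.\<close>
      have glam: "g w lam \<le> 1 / lam"
        using resolvent_tr_le[OF psd_reg_pos[OF Apsd lam] lam, of w] m by (simp add: g_def field_simps)
      have ex: "root w a lam" if "a \<le> (1 - \<epsilon>) * t"
      proof -
        have "a \<le> ?x" using that et by (simp add: algebra_simps)
        then have "1 / lam \<le> g w a" using dec[OF a(1), of ?x w] gx by (cases "a = ?x") auto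
        then show ?thesis unfolding root_iff[OF a(1)] using glam a by auto
      qed
      show "ok w" unfolding ok_iff using notE0 ex win by (auto simp: root_def)
    qed
    finally show ?thesis .
  next
    case False
    have "ok w" for w
    proof -
      \<comment> \<open>\<open>lam \<le> 3 * t\<close> and \<open>0 < l\<close> place
        \<open>l - t\<close> between \<open>- t\<close> and \<open>2 * t\<close>.\<close>
      have bd: "\<bar>l - t\<bar> \<le> \<epsilon> * t" if "a \<le> l" "l \<le> lam" for l
      proof -
        have "l - t \<le> 2 * t" "t - l \<le> t" using that t a by auto
        moreover have "2 * t \<le> \<epsilon> * t" by (rule mult_right_mono) (use False t0 in auto)
        ultimately show ?thesis using t0 unfolding abs_le_iff by linarith
      qed
      have "(1 - \<epsilon>) * t \<le> 0" using False t0 by (intro mult_nonpos_nonneg) auto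
      then have no: "\<not> a \<le> (1 - \<epsilon>) * t" using a by linarith
      have "(\<exists>W. search_output H lam (sketch_of m d w) (l, W)) \<Longrightarrow> \<bar>l - t\<bar> \<le> \<epsilon> * t" for l
        unfolding search_iff using bd[of l] a by (auto split: if_splits)
      then show ?thesis using no by (auto simp: ok_def a_def)
    qed
    then show ?thesis using prob_space \<delta> by simp
  qed
  then show "measure ?P
         {w \<in> space ?P.
            (\<forall>l W. search_output H lam (sketch_of m d w) (l, W) \<longrightarrow>
                \<bar>l - lam_tilde H lam m\<bar> \<le> \<epsilon> * lam_tilde H lam m) \<and>
            (5 * lam / 12 \<le> (1 - \<epsilon>) * lam_tilde H lam m \<longrightarrow>
                (\<exists>l W. search_output H lam (sketch_of m d w) (l, W)))}
       \<ge> 1 - \<delta>"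
    unfolding ok_def t_def .
qed

end
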